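(* Let $k_{||},k_{\perp}\in(0,1)$ be constants with $k_{||}^2+k_{\perp}^2=1$. (i) Let $M^6$ be a $6$-dimensional manifold endowed with an $SU(2)$ structure $(J,g,\alpha,\omega,\Omega)$ such that the associated $2$-forms $Re(\Omega)_{||}$, $Re(\Omega)_{\perp}$, $Im(\Omega)$ (together with $\alpha$) satisfy the SUSY equations IIA. Then $M^6$ admits a symplectic half-flat $SU(2)$ structure $(\hat J,\hat g,\hat\alpha,\hat\omega,\hat\Omega)$ with $d(Re(\hat\alpha))=0$, namely the one given by $$\hat\alpha=Re(\alpha)+i\,k_{||}\,Im(\alpha),\qquad \hat\omega=\frac{1}{k_{\perp}}Re(\Omega)_{\perp},\qquad \hat\Omega=Im(\Omega)-i\,\frac{1}{k_{||}}Re(\Omega)_{||}.$$ (ii) Conversely, if $M^6$ has a symplectic half-flat $SU(2)$ structure $(\hat J,\hat g,\hat\alpha,\hat\omega,\hat\Omega)$ such that $d(Re(\hat\alpha))=0$, then the forms $(Re(\Omega)_{||},Re(\Omega)_{\perp},Im(\Omega),\alpha)$ defined by $$\frac{1}{k_{\perp}}Re(\Omega)_{\perp}=\hat\omega,\qquad Im(\Omega)-i\,\frac{1}{k_{||}}Re(\Omega)_{||}=\hat\Omega,\qquad Re(\alpha)+i\,k_{||}\,Im(\alpha)=\hat\alpha$$ are a solution of the SUSY equations IIA.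
   Context: An $SU(3)$ structure $(F,\Psi)$ on a $6$-manifold consists of an almost Hermitian structure $(J,g)$ with fundamental $2$-form $F(X,Y)=g(JX,Y)$ and a $(3,0)$-form $\Psi$ with $F\wedge\Psi=0$ and $\frac43F^3=i\,\Psi\wedge\overline\Psi\neq0$. An $SU(2)$ structure $(J,g,\alpha,\omega,\Omega)$ on a $6$-manifold $M^6$ consists of an almost Hermitian structure $(J,g)$, a $(1,0)$-form $\alpha$ with $\|\alpha\|^2=i_{\overline\alpha}\alpha=2$, a real $2$-form $\omega$ and a $(2,0)$-form $\Omega$ with $\omega^2=\frac12\Omega\wedge\overline\Omega\neq0$, $\omega\wedge\Omega=0$, $\Omega\wedge\Omega=0$, $i_\alpha\Omega=0$, $i_\alpha\omega=0$, where $i_\alpha$ denotes contraction by the vector field dual to $\alpha$; its associated $SU(3)$ structure is $F=\omega+\frac i2\alpha\wedge\overline\alpha$ (the fundamental form of $(J,g)$) and $\Psi=\alpha\wedge\Omega$. The pair $(J,g)$ is determined by $(\alpha,\omega,\Omega)$. An $SU(3)$ structure is half-flat if $d(F\wedge F)=0$ and $d(Re(\Psi))=0$; it is symplectic half-flat if in addition $dF=0$. An $SU(2)$ structure is called symplectic half-flat if its associated $SU(3)$ structure is. Type IIA projection forms: given an $SU(2)$ structure and the constants $k_{||},k_\perp$, let $\phi\in(-\frac\pi2,0)$ be defined by $k_{||}=-\sin\phi$, $k_\perp=\cos\phi$, and put $$Re(\Omega)_{||}=\tfrac12\big((1-\cos2\phi)Re(\Omega)+\sin(2\phi)\,\omega\big),\quad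 Re(\Omega)_\perp=\tfrac12\big((1+\cos2\phi)Re(\Omega)-\sin(2\phi)\,\omega\big).$$ SUSY equations IIA: the forms $(\alpha,Re(\Omega)_{||},Re(\Omega)_\perp,Im(\Omega))$ arising in this way from an $SU(2)$ structure are a solution if, for the $3$-form $H$ determined by the second equation, $$d(Re(\alpha))=0,\qquad k_{||}H=k_\perp d(Im(\Omega)),\qquad d(Re(\Omega)_\perp)=k_{||}k_\perp Re(\alpha)\wedge d(Im(\alpha)),$$ $$H\wedge Re(\alpha)=-\frac{k_\perp}{k_{||}}\,d\big(Im(\alpha)\wedge Re(\Omega)_{||}\big).$$ *)

theory Defs
  imports "HOL-Analysis.Analysis" "HOL-Combinatorics.Permutations"
begin

section \<open>Smooth 6-manifolds\<close>

text \<open>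
  \<open>Ck_on k S f\<close> is meant for open \<open>S\<close>: all iterated directional derivatives of \<open>f\<close> up to order
  \<open>k\<close> exist and are continuous on \<open>S\<close>.
\<close>

primrec Ck_on ::
  "nat \<Rightarrow> 'v::euclidean_space set \<Rightarrow> ('v \<Rightarrow> 'b::real_normed_vector) \<Rightarrow> bool" where
  "Ck_on 0 S f \<longleftrightarrow> continuous_on S f"
| "Ck_on (Suc k) S f \<longleftrightarrow>
     (\<forall>x\<in>S. f differentiable (at x)) \<and> (\<forall>v. Ck_on k S (\<lambda>x. frechet_derivative f (at x) v))"

definition smooth_on :: "'v::euclidean_space set \<Rightarrow> ('v \<Rightarrow> 'b::real_normed_vector) \<Rightarrow> bool" where
  "smooth_on S f \<longleftrightarrow> (\<forall>k. Ck_on k S f)"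

text \<open>A chart is a pair of its domain and its coordinate map.\<close>

type_synonym 'a chart = "'a set \<times> ('a \<Rightarrow> real^6)"

abbreviation chart_dom :: "'a chart \<Rightarrow> 'a set" where "chart_dom c \<equiv> fst c"
abbreviation chart_map :: "'a chart \<Rightarrow> 'a \<Rightarrow> real^6" where "chart_map c \<equiv> snd c"

definition chart_inv :: "'a chart \<Rightarrow> real^6 \<Rightarrow> 'a" where
  "chart_inv c = inv_into (chart_dom c) (chart_map c)"

definition is_chart :: "'a topology \<Rightarrow> 'a chart \<Rightarrow> bool" where
  "is_chart X c \<longleftrightarrow>
     openin X (chart_dom c) \<and> open (chart_map c ` chart_dom c) \<and>
     homeomorphic_map (subtopology X (chart_dom c))
       (top_of_set (chart_map c ` chart_dom c)) (chart_map c)"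

definition transition :: "'a chart \<Rightarrow> 'a chart \<Rightarrow> real^6 \<Rightarrow> real^6" where
  "transition c c' = chart_map c' \<circ> chart_inv c"

definition smooth_manifold6 :: "'a topology \<Rightarrow> 'a chart set \<Rightarrow> bool" where
  "smooth_manifold6 X A \<longleftrightarrow>
     Hausdorff_space X \<and> second_countable X \<and>
     (\<forall>c\<in>A. is_chart X c) \<and> (\<Union>c\<in>A. chart_dom c) = topspace X \<and>
     (\<forall>c\<in>A. \<forall>c'\<in>A.
        smooth_on (chart_map c ` (chart_dom c \<inter> chart_dom c')) (transition c c'))"

definition jacobian :: "'a chart \<Rightarrow> 'a chart \<Rightarrow> 'a \<Rightarrow> real^6 \<Rightarrow> real^6" where
  "jacobian c c' p = frechet_derivative (transition c c') (at (chart_map c p))"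


section \<open>Tensor fields\<close>

text \<open>
  A tangent vector at \<open>p\<close> is represented in each chart around \<open>p\<close> by a vector of \<open>real^6\<close>, the
  representatives being related by the Jacobians of the transition maps. Accordingly, a tensor
  field \<open>T\<close> is given by its representatives \<open>T c p\<close> for the charts \<open>c\<close> of the atlas and the
  points \<open>p\<close> of the domain of \<open>c\<close>, subject to the transformation law and to smoothness in every
  chart. All other values of \<open>T\<close> are irrelevant, so tensor fields are compared with \<open>eq_on\<close>.
\<close>

definition eq_on :: "'a chart set \<Rightarrow> ('a chart \<Rightarrow> 'a \<Rightarrow> 't) \<Rightarrow> ('a chart \<Rightarrow> 'a \<Rightarrow> 't) \<Rightarrow> bool" where
  "eq_on A S T \<longleftrightarrow> (\<forall>c\<in>A. \<forall>p\<in>chart_dom c. S c p = T c p)"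

definition smooth_rep :: "'a chart \<Rightarrow> ('a \<Rightarrow> 'b::real_normed_vector) \<Rightarrow> bool" where
  "smooth_rep c f \<longleftrightarrow> smooth_on (chart_map c ` chart_dom c) (\<lambda>x. f (chart_inv c x))"

definition metric_field ::
  "'a chart set \<Rightarrow> ('a chart \<Rightarrow> 'a \<Rightarrow> real^6 \<Rightarrow> real^6 \<Rightarrow> real) \<Rightarrow> bool" where
  "metric_field A g \<longleftrightarrow>
     (\<forall>c\<in>A. (\<forall>p\<in>chart_dom c.
          bilinear (g c p) \<and> (\<forall>x y. g c p x y = g c p y x) \<and> (\<forall>x. x \<noteq> 0 \<longrightarrow> g c p x x > 0))
        \<and> (\<forall>x y. smooth_rep c (\<lambda>p. g c p x y))) \<and>
     (\<forall>c\<in>A. \<forall>c'\<in>A. \<forall>p\<in>chart_dom c \<inter> chart_dom c'. \<forall>x y.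
        g c p x y = g c' p (jacobian c c' p x) (jacobian c c' p y))"

definition endo_field ::
  "'a chart set \<Rightarrow> ('a chart \<Rightarrow> 'a \<Rightarrow> real^6 \<Rightarrow> real^6) \<Rightarrow> bool" where
  "endo_field A J \<longleftrightarrow>
     (\<forall>c\<in>A. (\<forall>p\<in>chart_dom c. linear (J c p)) \<and> (\<forall>x. smooth_rep c (\<lambda>p. J c p x))) \<and>
     (\<forall>c\<in>A. \<forall>c'\<in>A. \<forall>p\<in>chart_dom c \<inter> chart_dom c'. \<forall>x.
        jacobian c c' p (J c p x) = J c' p (jacobian c c' p x))"

definition almost_hermitian ::
  "'a chart set \<Rightarrow> ('a chart \<Rightarrow> 'a \<Rightarrow> real^6 \<Rightarrow> real^6) \<Rightarrow>
   ('a chart \<Rightarrow> 'a \<Rightarrow> real^6 \<Rightarrow> real^6 \<Rightarrow> real) \<Rightarrow> bool" where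
  "almost_hermitian A J g \<longleftrightarrow>
     endo_field A J \<and> metric_field A g \<and>
     (\<forall>c\<in>A. \<forall>p\<in>chart_dom c.
        (\<forall>x. J c p (J c p x) = - x) \<and> (\<forall>x y. g c p (J c p x) (J c p y) = g c p x y))"


section \<open>Complex-valued differential forms\<close>

text \<open>
  A \<open>k\<close>-form at a point takes a family of vectors indexed by all natural numbers and depends only
  on the first \<open>k\<close> of them.
\<close>

type_synonym 'v ptform = "(nat \<Rightarrow> 'v) \<Rightarrow> complex"
type_synonym 'a form = "'a chart \<Rightarrow> 'a \<Rightarrow> (real^6) ptform"

definition alt_form :: "nat \<Rightarrow> 'v::real_vector ptform \<Rightarrow> bool" where
  "alt_form k a \<longleftrightarrow>
     (\<forall>v w. (\<forall>i<k. v i = w i) \<longrightarrow> a v = a w) \<and>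
     (\<forall>v. \<forall>i<k. linear (\<lambda>x. a (v(i := x)))) \<and>
     (\<forall>v i j. i < j \<and> j < k \<and> v i = v j \<longrightarrow> a v = 0)"

definition diff_form :: "'a chart set \<Rightarrow> nat \<Rightarrow> 'a form \<Rightarrow> bool" where
  "diff_form A k a \<longleftrightarrow>
     (\<forall>c\<in>A. (\<forall>p\<in>chart_dom c. alt_form k (a c p)) \<and> (\<forall>v. smooth_rep c (\<lambda>p. a c p v))) \<and>
     (\<forall>c\<in>A. \<forall>c'\<in>A. \<forall>p\<in>chart_dom c \<inter> chart_dom c'. \<forall>v.
        a c p v = a c' p (\<lambda>i. jacobian c c' p (v i)))"

definition real_form :: "'a chart set \<Rightarrow> 'a form \<Rightarrow> bool" where
  "real_form A a \<longleftrightarrow> (\<forall>c\<in>A. \<forall>p\<in>chart_dom c. \<forall>v. a c p v \<in> \<real>)"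

definition nowhere_zero :: "'a chart set \<Rightarrow> 'a form \<Rightarrow> bool" where
  "nowhere_zero A a \<longleftrightarrow> (\<forall>c\<in>A. \<forall>p\<in>chart_dom c. \<exists>v. a c p v \<noteq> 0)"

definition zero_form :: "'a form" where
  "zero_form = (\<lambda>c p v. 0)"

definition add_form :: "'a form \<Rightarrow> 'a form \<Rightarrow> 'a form" (infixl \<open>\<oplus>\<^sub>F\<close> 65) where
  "a \<oplus>\<^sub>F b = (\<lambda>c p v. a c p v + b c p v)"

definition scale_form :: "complex \<Rightarrow> 'a form \<Rightarrow> 'a form" (infixr \<open>\<odot>\<^sub>F\<close> 70) where
  "z \<odot>\<^sub>F a = (\<lambda>c p v. z * a c p v)"

definition cnj_form :: "'a form \<Rightarrow> 'a form" where
  "cnj_form a = (\<lambda>c p v. cnj (a c p v))"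

definition Re_form :: "'a form \<Rightarrow> 'a form" where
  "Re_form a = (\<lambda>c p v. complex_of_real (Re (a c p v)))"

definition Im_form :: "'a form \<Rightarrow> 'a form" where
  "Im_form a = (\<lambda>c p v. complex_of_real (Im (a c p v)))"

text \<open>
  The wedge product is normalised such that \<open>(a \<and> b)(x, y) = a x * b y - a y * b x\<close> for 1-forms.
  This is the normalisation under which \<open>\<omega> + \<i>/2 \<alpha> \<and> cnj \<alpha>\<close> with \<open>\<parallel>\<alpha>\<parallel>\<^sup>2 = 2\<close> can be the
  fundamental form \<open>g (J x) y\<close> of an almost Hermitian structure.
\<close>

definition wedge_pt :: "nat \<Rightarrow> nat \<Rightarrow> 'v ptform \<Rightarrow> 'v ptform \<Rightarrow> 'v ptform" where
  "wedge_pt k l a b v =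
     (\<Sum>\<sigma> | \<sigma> permutes {..<k + l}.
        of_int (sign \<sigma>) * a (\<lambda>i. v (\<sigma> i)) * b (\<lambda>i. v (\<sigma> (k + i)))) / (fact k * fact l)"

definition wedge :: "nat \<Rightarrow> nat \<Rightarrow> 'a form \<Rightarrow> 'a form \<Rightarrow> 'a form" where
  "wedge k l a b = (\<lambda>c p. wedge_pt k l (a c p) (b c p))"

definition ext_d :: "nat \<Rightarrow> 'a form \<Rightarrow> 'a form" where
  "ext_d k a = (\<lambda>c p v.
     \<Sum>i\<le>k. (- 1) ^ i *
       frechet_derivative
         (\<lambda>x. a c (chart_inv c x) (\<lambda>j. if j < i then v j else v (Suc j))) (at (chart_map c p)) (v i))"

definition sharp :: "('v \<Rightarrow> 'v \<Rightarrow> real) \<Rightarrow> ('v \<Rightarrow> real) \<Rightarrow> 'v" where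
  "sharp g a = (THE x. \<forall>y. g x y = a y)"

text \<open>
  Contraction of \<open>b\<close> by the complex vector field dual to the complex 1-form \<open>a\<close>, where both the
  duality and the contraction are extended complex-linearly (so the dual of a (1,0)-form is of
  type (0,1), and contracting \<open>a\<close> by the dual of \<open>cnj a\<close> gives the Hermitian norm squared).
\<close>

definition contract ::
  "('a chart \<Rightarrow> 'a \<Rightarrow> real^6 \<Rightarrow> real^6 \<Rightarrow> real) \<Rightarrow> 'a form \<Rightarrow> 'a form \<Rightarrow> 'a form" where
  "contract g a b = (\<lambda>c p v.
     b c p (case_nat (sharp (g c p) (\<lambda>y. Re (a c p (\<lambda>_. y)))) v) +
     \<i> * b c p (case_nat (sharp (g c p) (\<lambda>y. Im (a c p (\<lambda>_. y)))) v))"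

text \<open>
  A \<open>k\<close>-form is of type \<open>(k,0)\<close> if it vanishes as soon as one argument is a (0,1)-vector; these
  are the vectors \<open>x + \<i> J x\<close> for real \<open>x\<close>.
\<close>

definition type_k0 ::
  "'a chart set \<Rightarrow> ('a chart \<Rightarrow> 'a \<Rightarrow> real^6 \<Rightarrow> real^6) \<Rightarrow> nat \<Rightarrow> 'a form \<Rightarrow> bool" where
  "type_k0 A J k a \<longleftrightarrow>
     (\<forall>c\<in>A. \<forall>p\<in>chart_dom c. \<forall>v. \<forall>j<k. a c p v + \<i> * a c p (v(j := J c p (v j))) = 0)"

definition fundamental_form ::
  "('a chart \<Rightarrow> 'a \<Rightarrow> real^6 \<Rightarrow> real^6) \<Rightarrow>
   ('a chart \<Rightarrow> 'a \<Rightarrow> real^6 \<Rightarrow> real^6 \<Rightarrow> real) \<Rightarrow> 'a form" where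
  "fundamental_form J g = (\<lambda>c p v. complex_of_real (g c p (J c p (v 0)) (v 1)))"


section \<open>SU(3) and SU(2) structures\<close>

definition SU3_structure ::
  "'a chart set \<Rightarrow> ('a chart \<Rightarrow> 'a \<Rightarrow> real^6 \<Rightarrow> real^6) \<Rightarrow>
   ('a chart \<Rightarrow> 'a \<Rightarrow> real^6 \<Rightarrow> real^6 \<Rightarrow> real) \<Rightarrow> 'a form \<Rightarrow> 'a form \<Rightarrow> bool" where
  "SU3_structure A J g F \<Psi> \<longleftrightarrow>
     almost_hermitian A J g \<and>
     eq_on A F (fundamental_form J g) \<and>
     diff_form A 3 \<Psi> \<and> type_k0 A J 3 \<Psi> \<and>
     eq_on A (wedge 2 3 F \<Psi>) zero_form \<and>
     eq_on A ((4/3) \<odot>\<^sub>F wedge 4 2 (wedge 2 2 F F) F) (\<i> \<odot>\<^sub>F wedge 3 3 \<Psi> (cnj_form \<Psi>)) \<and>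
     nowhere_zero A (wedge 3 3 \<Psi> (cnj_form \<Psi>))"

definition half_flat_SU3 ::
  "'a chart set \<Rightarrow> ('a chart \<Rightarrow> 'a \<Rightarrow> real^6 \<Rightarrow> real^6) \<Rightarrow>
   ('a chart \<Rightarrow> 'a \<Rightarrow> real^6 \<Rightarrow> real^6 \<Rightarrow> real) \<Rightarrow> 'a form \<Rightarrow> 'a form \<Rightarrow> bool" where
  "half_flat_SU3 A J g F \<Psi> \<longleftrightarrow>
     SU3_structure A J g F \<Psi> \<and>
     eq_on A (ext_d 4 (wedge 2 2 F F)) zero_form \<and>
     eq_on A (ext_d 3 (Re_form \<Psi>)) zero_form"

definition symplectic_half_flat_SU3 ::
  "'a chart set \<Rightarrow> ('a chart \<Rightarrow> 'a \<Rightarrow> real^6 \<Rightarrow> real^6) \<Rightarrow>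
   ('a chart \<Rightarrow> 'a \<Rightarrow> real^6 \<Rightarrow> real^6 \<Rightarrow> real) \<Rightarrow> 'a form \<Rightarrow> 'a form \<Rightarrow> bool" where
  "symplectic_half_flat_SU3 A J g F \<Psi> \<longleftrightarrow>
     half_flat_SU3 A J g F \<Psi> \<and> eq_on A (ext_d 2 F) zero_form"

definition SU2_F :: "'a form \<Rightarrow> 'a form \<Rightarrow> 'a form" where
  "SU2_F \<alpha> \<omega> = \<omega> \<oplus>\<^sub>F (\<i>/2) \<odot>\<^sub>F wedge 1 1 \<alpha> (cnj_form \<alpha>)"

definition SU2_Psi :: "'a form \<Rightarrow> 'a form \<Rightarrow> 'a form" where
  "SU2_Psi \<alpha> \<Omega> = wedge 1 2 \<alpha> \<Omega>"

definition SU2_structure ::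
  "'a chart set \<Rightarrow> ('a chart \<Rightarrow> 'a \<Rightarrow> real^6 \<Rightarrow> real^6) \<Rightarrow>
   ('a chart \<Rightarrow> 'a \<Rightarrow> real^6 \<Rightarrow> real^6 \<Rightarrow> real) \<Rightarrow> 'a form \<Rightarrow> 'a form \<Rightarrow> 'a form \<Rightarrow> bool" where
  "SU2_structure A J g \<alpha> \<omega> \<Omega> \<longleftrightarrow>
     almost_hermitian A J g \<and>
     diff_form A 1 \<alpha> \<and> type_k0 A J 1 \<alpha> \<and>
     eq_on A (contract g (cnj_form \<alpha>) \<alpha>) (\<lambda>c p v. 2) \<and>
     diff_form A 2 \<omega> \<and> real_form A \<omega> \<and>
     diff_form A 2 \<Omega> \<and> type_k0 A J 2 \<Omega> \<and>
     eq_on A (wedge 2 2 \<omega> \<omega>) ((1/2) \<odot>\<^sub>F wedge 2 2 \<Omega> (cnj_form \<Omega>)) \<and>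
     nowhere_zero A (wedge 2 2 \<omega> \<omega>) \<and>
     eq_on A (wedge 2 2 \<omega> \<Omega>) zero_form \<and>
     eq_on A (wedge 2 2 \<Omega> \<Omega>) zero_form \<and>
     eq_on A (contract g \<alpha> \<Omega>) zero_form \<and>
     eq_on A (contract g \<alpha> \<omega>) zero_form \<and>
     eq_on A (SU2_F \<alpha> \<omega>) (fundamental_form J g)"

definition symplectic_half_flat_SU2 ::
  "'a chart set \<Rightarrow> ('a chart \<Rightarrow> 'a \<Rightarrow> real^6 \<Rightarrow> real^6) \<Rightarrow>
   ('a chart \<Rightarrow> 'a \<Rightarrow> real^6 \<Rightarrow> real^6 \<Rightarrow> real) \<Rightarrow> 'a form \<Rightarrow> 'a form \<Rightarrow> 'a form \<Rightarrow> bool" where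
  "symplectic_half_flat_SU2 A J g \<alpha> \<omega> \<Omega> \<longleftrightarrow>
     SU2_structure A J g \<alpha> \<omega> \<Omega> \<and>
     symplectic_half_flat_SU3 A J g (SU2_F \<alpha> \<omega>) (SU2_Psi \<alpha> \<Omega>)"


section \<open>The SUSY equations of type IIA\<close>

definition IIA_angle :: "real \<Rightarrow> real \<Rightarrow> real" where
  "IIA_angle kpar kperp =
     (THE \<phi>. - pi / 2 < \<phi> \<and> \<phi> < 0 \<and> kpar = - sin \<phi> \<and> kperp = cos \<phi>)"

definition Re_Omega_par :: "real \<Rightarrow> real \<Rightarrow> 'a form \<Rightarrow> 'a form \<Rightarrow> 'a form" where
  "Re_Omega_par kpar kperp \<omega> \<Omega> =
     (let \<phi> = IIA_angle kpar kperp
      in (1/2) \<odot>\<^sub>F (complex_of_real (1 - cos (2 * \<phi>)) \<odot>\<^sub>F Re_form \<Omega>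
                 \<oplus>\<^sub>F complex_of_real (sin (2 * \<phi>)) \<odot>\<^sub>F \<omega>))"

definition Re_Omega_perp :: "real \<Rightarrow> real \<Rightarrow> 'a form \<Rightarrow> 'a form \<Rightarrow> 'a form" where
  "Re_Omega_perp kpar kperp \<omega> \<Omega> =
     (let \<phi> = IIA_angle kpar kperp
      in (1/2) \<odot>\<^sub>F (complex_of_real (1 + cos (2 * \<phi>)) \<odot>\<^sub>F Re_form \<Omega>
                 \<oplus>\<^sub>F complex_of_real (- sin (2 * \<phi>)) \<odot>\<^sub>F \<omega>))"

text \<open>
  In the next two definitions \<open>Rpar\<close>, \<open>Rperp\<close> and \<open>I\<close> stand for the parallel and perpendicular
  projections of \<open>Re \<Omega>\<close> and for \<open>Im \<Omega>\<close>.
\<close>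

definition IIA_equations ::
  "'a chart set \<Rightarrow> real \<Rightarrow> real \<Rightarrow> 'a form \<Rightarrow> 'a form \<Rightarrow> 'a form \<Rightarrow> 'a form \<Rightarrow> bool" where
  "IIA_equations A kpar kperp \<alpha> Rpar Rperp I \<longleftrightarrow>
     (\<exists>H. diff_form A 3 H \<and>
        eq_on A (ext_d 1 (Re_form \<alpha>)) zero_form \<and>
        eq_on A (complex_of_real kpar \<odot>\<^sub>F H) (complex_of_real kperp \<odot>\<^sub>F ext_d 2 I) \<and>
        eq_on A (ext_d 2 Rperp)
          (complex_of_real (kpar * kperp) \<odot>\<^sub>F wedge 1 2 (Re_form \<alpha>) (ext_d 1 (Im_form \<alpha>))) \<and>
        eq_on A (wedge 3 1 H (Re_form \<alpha>))
          (complex_of_real (- (kperp / kpar)) \<odot>\<^sub>F ext_d 3 (wedge 1 2 (Im_form \<alpha>) Rpar)))"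

definition IIA_solution ::
  "'a chart set \<Rightarrow> real \<Rightarrow> real \<Rightarrow> 'a form \<Rightarrow> 'a form \<Rightarrow> 'a form \<Rightarrow> 'a form \<Rightarrow> bool" where
  "IIA_solution A kpar kperp \<alpha> Rpar Rperp I \<longleftrightarrow>
     (\<exists>J g \<omega> \<Omega>. SU2_structure A J g \<alpha> \<omega> \<Omega> \<and>
        eq_on A Rpar (Re_Omega_par kpar kperp \<omega> \<Omega>) \<and>
        eq_on A Rperp (Re_Omega_perp kpar kperp \<omega> \<Omega>) \<and>
        eq_on A I (Im_form \<Omega>)) \<and>
     IIA_equations A kpar kperp \<alpha> Rpar Rperp I"

end

theory Submission
  imports Defs
begin

text \<open>
  The idea. Write \<open>\<alpha> = a + i b\<close> and think of an \<open>SU(2)\<close> structure as the pair \<open>(a, b)\<close> of orthonormal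
  1-forms together with the triple \<open>(\<omega>, Re \<Omega>, Im \<Omega>)\<close> of 2-forms on the orthogonal 4-plane of their
  dual vectors. The triple is hyperkaehler at every point: the three 2-forms have equal squares and
  vanishing mixed products, and the endomorphisms that they define satisfy the quaternion relations.
  The notion of \<open>SU(2)\<close> structure is therefore stable under rotations of the triple, and it is also
  stable under rescaling \<open>b\<close> by a constant \<open>t > 0\<close>, at the price of a new \<open>(J, g)\<close>. Since
  \<open>kpar = - sin \<phi>\<close> and \<open>kperp = cos \<phi>\<close>, the projections are \<open>kpar (kpar Re \<Omega> - kperp \<omega>)\<close> and
  \<open>kperp (kpar \<omega> + kperp Re \<Omega>)\<close>, so the passage from \<open>(\<alpha>, \<omega>, \<Omega>)\<close> to the hatted forms is such a
  rotation, followed by multiplication of \<open>\<Omega>\<close> by \<open>- i\<close>, combined with the rescaling \<open>t = kpar\<close>. The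
  inverse passage multiplies by \<open>i\<close>, rotates by the opposite angle and rescales with \<open>1 / kpar\<close>.
  This settles the algebraic part of both directions (\<open>rotate_squash\<close>, \<open>phase\<close> and their global
  forms).

  The differential part is an equivalence (\<open>half_flat_iff_IIA_equations\<close>). In terms of the
  projections \<open>P\<close>, \<open>Q\<close> and of \<open>I = Im \<Omega>\<close> one finds \<open>F = Q / kperp + kpar a \<and> b\<close> and
  \<open>Re \<Psi> = a \<and> I + b \<and> P\<close> for the hatted structure. If \<open>da = 0\<close>, the Leibniz rule gives
  \<open>dF = dQ / kperp - kpar a \<and> db\<close> and \<open>d Re \<Psi> = d(b \<and> P) - a \<and> dI\<close>. The vanishing of these two forms
  is the third and the fourth SUSY equation, \<open>H\<close> being a constant multiple of \<open>dI\<close>. The condition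
  \<open>d(F \<and> F) = 0\<close> follows from \<open>dF = 0\<close>, and the \<open>SU(3)\<close> identities follow from those of the \<open>SU(2)\<close>
  structure by wedge algebra (\<open>SU3_at\<close>).

  Around this core the exterior calculus is built from the definitions: associativity and graded
  commutativity of the wedge product, the formula \<open>da = \<Sum> e \<and> \<partial>\<^sub>e a\<close> and the Leibniz rule that it
  implies, the invariance of \<open>d\<close> under changes of charts for 2-forms, which rests on the symmetry of
  second derivatives and makes \<open>H\<close> a tensor, and the smoothness of the new almost complex structure,
  which is obtained by Cramer's rule.
\<close>


section \<open>Signs of block exchanges\<close>

text \<open>
  The permutation of \<open>k + l\<close> positions that exchanges the first \<open>k\<close> with the last \<open>l\<close>. Its sign is
  the sign in the graded commutativity of the wedge product.
\<close>

definition block_swap :: "nat \<Rightarrow> nat \<Rightarrow> nat \<Rightarrow> nat" where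
  "block_swap k l i = (if i < k then l + i else if i < k + l then i - k else i)"

text \<open>
  The cycle that sends \<open>0\<close> to \<open>n\<close> and lowers \<open>1, \<dots>, n\<close> by one. Read as a rearrangement of arguments
  it moves argument \<open>n\<close> to the front; it generates the block exchanges and has sign \<open>(- 1) ^ n\<close>.
\<close>

definition front_cycle :: "nat \<Rightarrow> nat \<Rightarrow> nat" where
  "front_cycle n j = (if j = 0 then n else if j \<le> n then j - 1 else j)"

lemma front_cycle_Suc: "front_cycle (Suc n) = Transposition.transpose n (Suc n) \<circ> front_cycle n"
  by (auto simp: fun_eq_iff front_cycle_def Transposition.transpose_def)

lemma front_cycle_permutes: "front_cycle n permutes {..n}"
proof (induction n)
  case 0
  have "front_cycle 0 = id" by (auto simp: fun_eq_iff front_cycle_def)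
  then show ?case by (simp only: permutes_id)
next
  case (Suc n)
  have "front_cycle n permutes {..Suc n}"
    using Suc by (rule permutes_subset) auto
  moreover have "Transposition.transpose n (Suc n) permutes {..Suc n}"
    by (rule permutes_swap_id) auto
  ultimately show ?case
    unfolding front_cycle_Suc by (rule permutes_compose)
qed

lemma sign_front_cycle: "sign (front_cycle n) = (- 1) ^ n"
proof (induction n)
  case 0
  have "front_cycle 0 = id" by (auto simp: fun_eq_iff front_cycle_def)
  then show ?case by simp
next
  case (Suc n)
  have "permutation (front_cycle n)"
    using front_cycle_permutes finite_atMost by (rule permutes_imp_permutation[rotated])
  then show ?case
    unfolding front_cycle_Suc using Suc
    by (subst sign_compose) (simp_all add: sign_swap_id permutation_swap_id)
qed

lemma block_swap_Suc: "block_swap (Suc k) l = front_cycle (k + l) \<circ> block_swap k (Suc l)"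
  by (auto simp: fun_eq_iff front_cycle_def block_swap_def)

lemma block_swap_permutes: "block_swap k l permutes {..<k + l}"
proof (induction k arbitrary: l)
  case 0
  have "block_swap 0 l = id" by (auto simp: fun_eq_iff block_swap_def)
  then show ?case by (simp only: permutes_id)
next
  case (Suc k)
  have "front_cycle (k + l) permutes {..<Suc k + l}"
    using front_cycle_permutes[of "k + l"] by (simp add: lessThan_Suc_atMost)
  moreover have "block_swap k (Suc l) permutes {..<Suc k + l}"
    using Suc.IH[of "Suc l"] by simp
  ultimately show ?case
    unfolding block_swap_Suc using permutes_compose by blast
qed

text \<open>
  Each step of \<open>block_swap_Suc\<close> contributes a cycle of length \<open>k + l + 1\<close>; the excess of the
  resulting exponent over \<open>k * l\<close> is even.
\<close>

lemma sign_block_swap: "sign (block_swap k l) = (- 1) ^ (k * l)"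
proof (induction k arbitrary: l)
  case 0
  have "block_swap 0 l = id" by (auto simp: fun_eq_iff block_swap_def)
  then show ?case by simp
next
  case (Suc k)
  have "permutation (front_cycle (k + l))" "permutation (block_swap k (Suc l))"
    using front_cycle_permutes block_swap_permutes by (auto intro: permutes_imp_permutation[rotated])
  then have "sign (block_swap (Suc k) l) = (- 1) ^ (k + l) * (- 1) ^ (k * Suc l)"
    using Suc.IH by (simp add: block_swap_Suc sign_compose sign_front_cycle)
  also have "\<dots> = (- 1) ^ (Suc k * l)"
    by (auto simp: minus_one_power_iff)
  finally show ?case .
qed


section \<open>The wedge product at a point\<close>

lemma alt_form_local: "alt_form k a \<Longrightarrow> (\<And>i. i < k \<Longrightarrow> v i = w i) \<Longrightarrow> a v = a w"
  by (simp add: alt_form_def)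

lemma alt_form_repeat: "alt_form k a \<Longrightarrow> i < k \<Longrightarrow> j < k \<Longrightarrow> i \<noteq> j \<Longrightarrow> v i = v j \<Longrightarrow> a v = 0"
  unfolding alt_form_def by (metis linorder_neqE_nat)

lemma alt_form_linear: "alt_form k a \<Longrightarrow> i < k \<Longrightarrow> linear (\<lambda>x. a (v(i := x)))"
  by (simp add: alt_form_def)

text \<open>
  Polarisation of \<open>a(\<dots>, x, \<dots>, x, \<dots>) = 0\<close> at \<open>x = v i + v j\<close>.
\<close>

lemma alt_form_transpose:
  assumes a: "alt_form k a" and ij: "i < k" "j < k" "i \<noteq> j"
  shows "a (v \<circ> Transposition.transpose i j) = - a v"
proof -
  define f where "f x y = a (v(i := x, j := y))" for x y
  have lx: "linear (\<lambda>x. f x y)" for y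
    using alt_form_linear[OF a ij(1), of "v(j := y)"] ij
    by (simp add: f_def fun_upd_twist)
  have ly: "linear (\<lambda>y. f x y)" for x
    unfolding f_def by (rule alt_form_linear[OF a ij(2)])
  have z: "f x x = 0" for x
    unfolding f_def by (rule alt_form_repeat[OF a ij]) (use ij in auto)
  have "0 = f (v i + v j) (v i + v j)" using z by simp
  also have "\<dots> = f (v i) (v j) + f (v j) (v i)"
    unfolding linear_add[OF lx] linear_add[OF ly] by (simp add: z)
  finally have "f (v j) (v i) = - f (v i) (v j)"
    by (simp add: add_eq_0_iff2)
  moreover have "v(i := v j, j := v i) = v \<circ> Transposition.transpose i j"
    using ij by (auto simp: fun_eq_iff Transposition.transpose_def)
  ultimately show ?thesis by (simp add: f_def)
qed

lemma finite_permutes [simp]: "finite {\<sigma>. \<sigma> permutes {..<n::nat}}"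
  by (simp add: finite_permutations)

text \<open>
  Right multiplication by \<open>r\<close> permutes the summation range. All reindexings of wedge sums below are
  of this form.
\<close>

lemma sum_permutes_compose:
  assumes r: "r permutes {..<n::nat}"
  shows "(\<Sum>\<sigma> | \<sigma> permutes {..<n}. of_int (sign \<sigma>) * f \<sigma>) =
    of_int (sign r) * (\<Sum>\<sigma> | \<sigma> permutes {..<n}. of_int (sign \<sigma>) * f (\<sigma> \<circ> r) :: complex)"
proof -
  have "(\<Sum>\<sigma> | \<sigma> permutes {..<n}. of_int (sign \<sigma>) * f \<sigma>) =
        (\<Sum>\<sigma> | \<sigma> permutes {..<n}. of_int (sign (\<sigma> \<circ> r)) * f (\<sigma> \<circ> r))"
    by (rule sum_permutations_compose_right[OF r])
  also have "\<dots> = (\<Sum>\<sigma> | \<sigma> permutes {..<n}. of_int (sign r) * (of_int (sign \<sigma>) * f (\<sigma> \<circ> r)))"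
  proof (rule sum.cong[OF refl])
    fix \<sigma> assume "\<sigma> \<in> {\<sigma>. \<sigma> permutes {..<n}}"
    then have "permutation \<sigma>" "permutation r"
      using r by (auto intro: permutes_imp_permutation[rotated])
    then show "of_int (sign (\<sigma> \<circ> r)) * f (\<sigma> \<circ> r) = of_int (sign r) * (of_int (sign \<sigma>) * f (\<sigma> \<circ> r))"
      by (simp add: sign_compose)
  qed
  finally show ?thesis by (simp add: sum_distrib_left)
qed

text \<open>
  Reindexing the defining sum by the block exchange turns one product into the other.
\<close>

lemma wedge_pt_commute:
  assumes a: "alt_form k a" and b: "alt_form l b"
  shows "wedge_pt k l a b v = (- 1) ^ (k * l) * wedge_pt l k b a v"
proof -
  let ?r = "block_swap l k"
  have "(\<Sum>\<sigma> | \<sigma> permutes {..<l + k}.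
          of_int (sign \<sigma>) * (b (\<lambda>i. v (\<sigma> i)) * a (\<lambda>i. v (\<sigma> (l + i))))) =
        of_int (sign ?r) * (\<Sum>\<sigma> | \<sigma> permutes {..<l + k}.
          of_int (sign \<sigma>) * (b (\<lambda>i. v ((\<sigma> \<circ> ?r) i)) * a (\<lambda>i. v ((\<sigma> \<circ> ?r) (l + i)))))"
    by (rule sum_permutes_compose[OF block_swap_permutes])
  also have "(\<lambda>\<sigma>. b (\<lambda>i. v ((\<sigma> \<circ> ?r) i)) * a (\<lambda>i. v ((\<sigma> \<circ> ?r) (l + i)))) =
      (\<lambda>\<sigma>. a (\<lambda>i. v (\<sigma> i)) * b (\<lambda>i. v (\<sigma> (k + i))))"
  proof
    fix \<sigma>
    have "b (\<lambda>i. v ((\<sigma> \<circ> ?r) i)) = b (\<lambda>i. v (\<sigma> (k + i)))"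
      by (rule alt_form_local[OF b]) (simp add: block_swap_def)
    moreover have "a (\<lambda>i. v ((\<sigma> \<circ> ?r) (l + i))) = a (\<lambda>i. v (\<sigma> i))"
      by (rule alt_form_local[OF a]) (simp add: block_swap_def)
    ultimately show "b (\<lambda>i. v ((\<sigma> \<circ> ?r) i)) * a (\<lambda>i. v ((\<sigma> \<circ> ?r) (l + i))) =
      a (\<lambda>i. v (\<sigma> i)) * b (\<lambda>i. v (\<sigma> (k + i)))" by simp
  qed
  finally have "wedge_pt l k b a v = of_int (sign ?r) * wedge_pt k l a b v"
    unfolding wedge_pt_def by (simp add: mult.assoc add.commute mult.commute[of "fact l"])
  then show ?thesis
    by (simp add: sign_block_swap mult.commute[of k] flip: power_mult_distrib mult.assoc)
qed

text \<open>
  A twofold product is a sum over pairs \<open>(\<sigma>, \<tau>)\<close>, where \<open>\<tau>\<close> moves only the first \<open>k + l\<close> positions.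
  Replacing \<open>\<sigma>\<close> by \<open>\<sigma> \<circ> \<tau>\<close> removes \<open>\<tau>\<close> from the summand, so that the \<open>(k + l)!\<close> choices of \<open>\<tau>\<close> cancel the
  normalisation of the inner product. What remains treats the three factors alike.
\<close>

lemma wedge_pt_triple:
  assumes c: "alt_form m c"
  shows "wedge_pt (k + l) m (wedge_pt k l a b) c v =
    (\<Sum>\<sigma> | \<sigma> permutes {..<k + l + m}. of_int (sign \<sigma>) *
       (a (\<lambda>i. v (\<sigma> i)) * b (\<lambda>i. v (\<sigma> (k + i))) * c (\<lambda>i. v (\<sigma> (k + l + i))))) /
    (fact k * fact l * fact m)" (is "_ = ?T / _")
proof -
  let ?t = "\<lambda>\<sigma>. a (\<lambda>i. v (\<sigma> i)) * b (\<lambda>i. v (\<sigma> (k + i))) * c (\<lambda>i. v (\<sigma> (k + l + i)))"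
  let ?P = "{\<sigma>. \<sigma> permutes {..<k + l + m}}" and ?Q = "{\<tau>. \<tau> permutes {..<k + l}}"
  have "(\<Sum>\<sigma>\<in>?P. of_int (sign \<sigma>) *
          (\<Sum>\<tau>\<in>?Q. of_int (sign \<tau>) * (a (\<lambda>i. v (\<sigma> (\<tau> i))) * b (\<lambda>i. v (\<sigma> (\<tau> (k + i)))))) *
          c (\<lambda>i. v (\<sigma> (k + l + i)))) =
        (\<Sum>\<tau>\<in>?Q. of_int (sign \<tau>) * (\<Sum>\<sigma>\<in>?P. of_int (sign \<sigma>) *
          (a (\<lambda>i. v (\<sigma> (\<tau> i))) * b (\<lambda>i. v (\<sigma> (\<tau> (k + i)))) * c (\<lambda>i. v (\<sigma> (k + l + i))))))"
    unfolding sum_distrib_left sum_distrib_right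
    by (subst sum.swap) (simp add: mult_ac)
  also have "\<dots> = (\<Sum>\<tau>\<in>?Q. ?T)"
  proof (rule sum.cong[OF refl])
    fix \<tau> assume \<tau>: "\<tau> \<in> ?Q"
    then have \<tau>': "\<tau> permutes {..<k + l + m}"
      by (auto intro: permutes_subset)
    have "c (\<lambda>i. v (\<sigma> (k + l + i))) = c (\<lambda>i. v (\<sigma> (\<tau> (k + l + i))))" for \<sigma>
      using \<tau> by (simp add: permutes_not_in)
    then show "of_int (sign \<tau>) * (\<Sum>\<sigma>\<in>?P. of_int (sign \<sigma>) *
          (a (\<lambda>i. v (\<sigma> (\<tau> i))) * b (\<lambda>i. v (\<sigma> (\<tau> (k + i)))) * c (\<lambda>i. v (\<sigma> (k + l + i))))) = ?T"
      unfolding sum_permutes_compose[OF \<tau>', of ?t] by simp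
  qed
  also have "\<dots> = fact (k + l) * ?T"
    by (simp add: card_permutations)
  finally have "(\<Sum>\<sigma>\<in>?P. of_int (sign \<sigma>) *
          (\<Sum>\<tau>\<in>?Q. of_int (sign \<tau>) * (a (\<lambda>i. v (\<sigma> (\<tau> i))) * b (\<lambda>i. v (\<sigma> (\<tau> (k + i)))))) *
          c (\<lambda>i. v (\<sigma> (k + l + i)))) = fact (k + l) * ?T" .
  then show ?thesis
    unfolding wedge_pt_def
    by (simp add: mult.assoc flip: sum_divide_distrib)
qed

text \<open>
  If two arguments agree, composing \<open>\<sigma>\<close> with their transposition on the left changes only the sign of
  each term, so the sum equals its own negative.
\<close>

lemma wedge_pt_alt_form:
  assumes a: "alt_form k a" and b: "alt_form l b"
  shows "alt_form (k + l) (wedge_pt k l a b)"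
  unfolding alt_form_def
proof (intro conjI allI impI)
  fix v w :: "nat \<Rightarrow> 'a" assume vw: "\<forall>i<k + l. v i = w i"
  show "wedge_pt k l a b v = wedge_pt k l a b w"
    unfolding wedge_pt_def
  proof (intro arg_cong2[where f = "(/)"] sum.cong refl)
    fix \<sigma> assume "\<sigma> \<in> {\<sigma>. \<sigma> permutes {..<k + l}}"
    then have s: "\<sigma> i < k + l" if "i < k + l" for i
      using that permutes_in_image[of \<sigma> "{..<k + l}" i] by simp
    have "a (\<lambda>i. v (\<sigma> i)) = a (\<lambda>i. w (\<sigma> i))"
      by (rule alt_form_local[OF a]) (use vw s in auto)
    moreover have "b (\<lambda>i. v (\<sigma> (k + i))) = b (\<lambda>i. w (\<sigma> (k + i)))"
      by (rule alt_form_local[OF b]) (use vw s in auto)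
    ultimately show "of_int (sign \<sigma>) * a (\<lambda>i. v (\<sigma> i)) * b (\<lambda>i. v (\<sigma> (k + i))) =
      of_int (sign \<sigma>) * a (\<lambda>i. w (\<sigma> i)) * b (\<lambda>i. w (\<sigma> (k + i)))" by simp
  qed
next
  fix v :: "nat \<Rightarrow> 'a" and i assume i: "i < k + l"
  have lin: "linear (\<lambda>x. of_int (sign \<sigma>) * a (\<lambda>j. (v(i := x)) (\<sigma> j)) * b (\<lambda>j. (v(i := x)) (\<sigma> (k + j))))"
    (is "linear ?f") if \<sigma>: "\<sigma> permutes {..<k + l}" for \<sigma>
  proof -
    obtain j where j: "\<sigma> j = i" using permutes_surj[OF \<sigma>] by (metis surjD)
    then have jl: "j < k + l"
      using permutes_in_image[OF \<sigma>, of j] i by simp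
    have eq: "\<sigma> j' = i \<longleftrightarrow> j' = j" for j'
      using j permutes_inj[OF \<sigma>] by (auto dest: injD)
    show ?thesis
    proof (cases "j < k")
      case True
      have "a (\<lambda>j'. (v(i := x)) (\<sigma> j')) = a ((\<lambda>j'. v (\<sigma> j'))(j := x))" for x
        by (rule arg_cong[of _ _ a]) (auto simp: fun_eq_iff eq)
      moreover have "b (\<lambda>j'. (v(i := x)) (\<sigma> (k + j'))) = b (\<lambda>j'. v (\<sigma> (k + j')))" for x
        by (rule arg_cong[of _ _ b]) (use True in \<open>auto simp: fun_eq_iff eq\<close>)
      ultimately have "?f = (\<lambda>x. (of_int (sign \<sigma>) * b (\<lambda>j'. v (\<sigma> (k + j')))) *
          a ((\<lambda>j'. v (\<sigma> j'))(j := x)))"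
        by (simp add: mult_ac)
      then show ?thesis
        using linear_compose[OF alt_form_linear[OF a True]
            bounded_linear.linear[OF bounded_linear_mult_right]]
        by (simp add: o_def)
    next
      case False
      then have "b (\<lambda>j'. (v(i := x)) (\<sigma> (k + j'))) = b ((\<lambda>j'. v (\<sigma> (k + j')))(j - k := x))" for x
        by (intro arg_cong[of _ _ b]) (auto simp: fun_eq_iff eq)
      moreover have "a (\<lambda>j'. (v(i := x)) (\<sigma> j')) = a (\<lambda>j'. v (\<sigma> j'))" for x
        by (rule alt_form_local[OF a]) (use False in \<open>auto simp: eq\<close>)
      ultimately have "?f = (\<lambda>x. (of_int (sign \<sigma>) * a (\<lambda>j'. v (\<sigma> j'))) *
          b ((\<lambda>j'. v (\<sigma> (k + j')))(j - k := x)))"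
        by simp
      moreover have "j - k < l" using False jl by simp
      ultimately show ?thesis
        using linear_compose[OF alt_form_linear[OF b] bounded_linear.linear[OF bounded_linear_mult_right]]
        by (simp add: o_def)
    qed
  qed
  have "linear (\<lambda>x. \<Sum>\<sigma> | \<sigma> permutes {..<k + l}.
      of_int (sign \<sigma>) * a (\<lambda>j. (v(i := x)) (\<sigma> j)) * b (\<lambda>j. (v(i := x)) (\<sigma> (k + j))))"
    by (rule linear_compose_sum) (use lin in auto)
  then show "linear (\<lambda>x. wedge_pt k l a b (v(i := x)))"
    unfolding wedge_pt_def
    using linear_compose[OF _ bounded_linear.linear[OF bounded_linear_divide]]
    by (fastforce simp: o_def)
next
  fix v :: "nat \<Rightarrow> 'a" and i j assume ij: "i < j \<and> j < k + l \<and> v i = v j"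
  let ?t = "Transposition.transpose i j" and ?f = "\<lambda>\<sigma>. a (\<lambda>i. v (\<sigma> i)) * b (\<lambda>i. v (\<sigma> (k + i)))"
  let ?S = "\<Sum>\<sigma> | \<sigma> permutes {..<k + l}. of_int (sign \<sigma>) * ?f \<sigma>"
  have t: "?t permutes {..<k + l}" by (rule permutes_swap_id) (use ij in auto)
  have vt: "v (?t x) = v x" for x using ij by (auto simp: Transposition.transpose_def)
  have "?S = (\<Sum>\<sigma> | \<sigma> permutes {..<k + l}. of_int (sign (?t \<circ> \<sigma>)) * ?f (?t \<circ> \<sigma>))"
    by (rule setum_permutations_compose_left[OF t])
  also have "\<dots> = (\<Sum>\<sigma> | \<sigma> permutes {..<k + l}. - (of_int (sign \<sigma>) * ?f \<sigma>))"
  proof (rule sum.cong[OF refl])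
    fix \<sigma> assume "\<sigma> \<in> {\<sigma>. \<sigma> permutes {..<k + l}}"
    then have "permutation \<sigma>" by (auto intro: permutes_imp_permutation[rotated])
    then have "sign (?t \<circ> \<sigma>) = - sign \<sigma>"
      using ij by (simp add: sign_compose permutation_swap_id sign_swap_id)
    then show "of_int (sign (?t \<circ> \<sigma>)) * ?f (?t \<circ> \<sigma>) = - (of_int (sign \<sigma>) * ?f \<sigma>)"
      by (simp add: vt)
  qed
  also have "\<dots> = - ?S" by (simp add: sum_negf)
  finally have "?S = 0" by simp
  then show "wedge_pt k l a b v = 0"
    unfolding wedge_pt_def by (simp add: mult.assoc)
qed

text \<open>
  By graded commutativity the right-bracketed product becomes a left-bracketed one with \<open>a\<close> in the
  last place, and a block exchange of the symmetric triple sum brings \<open>a\<close> back to the front. In this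
  way no permutation of a tail of positions has to be extended to all of them.
\<close>

lemma wedge_pt_assoc:
  assumes a: "alt_form k a" and b: "alt_form l b" and c: "alt_form m c"
  shows "wedge_pt k (l + m) a (wedge_pt l m b c) v = wedge_pt (k + l) m (wedge_pt k l a b) c v"
proof -
  let ?r = "block_swap (l + m) k"
  have "(\<Sum>\<sigma> | \<sigma> permutes {..<(l + m) + k}. of_int (sign \<sigma>) *
          (b (\<lambda>i. v (\<sigma> i)) * c (\<lambda>i. v (\<sigma> (l + i))) * a (\<lambda>i. v (\<sigma> (l + m + i))))) =
        of_int (sign ?r) * (\<Sum>\<sigma> | \<sigma> permutes {..<(l + m) + k}. of_int (sign \<sigma>) *
          (b (\<lambda>i. v ((\<sigma> \<circ> ?r) i)) * c (\<lambda>i. v ((\<sigma> \<circ> ?r) (l + i))) * a (\<lambda>i. v ((\<sigma> \<circ> ?r) (l + m + i)))))"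
    by (rule sum_permutes_compose[OF block_swap_permutes])
  also have "(\<lambda>\<sigma>. b (\<lambda>i. v ((\<sigma> \<circ> ?r) i)) * c (\<lambda>i. v ((\<sigma> \<circ> ?r) (l + i))) * a (\<lambda>i. v ((\<sigma> \<circ> ?r) (l + m +
      i)))) =
      (\<lambda>\<sigma>. a (\<lambda>i. v (\<sigma> i)) * b (\<lambda>i. v (\<sigma> (k + i))) * c (\<lambda>i. v (\<sigma> (k + l + i))))"
  proof
    fix \<sigma>
    have "b (\<lambda>i. v ((\<sigma> \<circ> ?r) i)) = b (\<lambda>i. v (\<sigma> (k + i)))"
      by (rule alt_form_local[OF b]) (simp add: block_swap_def)
    moreover have "c (\<lambda>i. v ((\<sigma> \<circ> ?r) (l + i))) = c (\<lambda>i. v (\<sigma> (k + l + i)))"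
      by (rule alt_form_local[OF c]) (simp add: block_swap_def add.assoc)
    moreover have "a (\<lambda>i. v ((\<sigma> \<circ> ?r) (l + m + i))) = a (\<lambda>i. v (\<sigma> i))"
      by (rule alt_form_local[OF a]) (simp add: block_swap_def)
    ultimately show "b (\<lambda>i. v ((\<sigma> \<circ> ?r) i)) * c (\<lambda>i. v ((\<sigma> \<circ> ?r) (l + i))) * a (\<lambda>i. v ((\<sigma> \<circ> ?r) (l + m +
        i))) =
      a (\<lambda>i. v (\<sigma> i)) * b (\<lambda>i. v (\<sigma> (k + i))) * c (\<lambda>i. v (\<sigma> (k + l + i)))" by simp
  qed
  finally have "wedge_pt (l + m) k (wedge_pt l m b c) a v =
      of_int (sign ?r) * wedge_pt (k + l) m (wedge_pt k l a b) c v"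
    unfolding wedge_pt_triple[OF a] wedge_pt_triple[OF c]
    by (simp add: ac_simps)
  moreover have "wedge_pt k (l + m) a (wedge_pt l m b c) v =
      (- 1) ^ (k * (l + m)) * wedge_pt (l + m) k (wedge_pt l m b c) a v"
    by (rule wedge_pt_commute[OF a wedge_pt_alt_form[OF b c]])
  ultimately show ?thesis
    by (simp add: sign_block_swap mult.commute[of k] flip: power_mult_distrib mult.assoc)
qed


lemma wedge_pt_add_left: "wedge_pt k l (\<lambda>v. a v + b v) c = (\<lambda>v. wedge_pt k l a c v + wedge_pt k l b c v)"
  by (rule ext) (simp add: wedge_pt_def distrib_left distrib_right sum.distrib add_divide_distrib)

lemma wedge_pt_add_right: "wedge_pt k l a (\<lambda>v. b v + c v) = (\<lambda>v. wedge_pt k l a b v + wedge_pt k l a c v)"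
  by (rule ext) (simp add: wedge_pt_def distrib_left distrib_right sum.distrib add_divide_distrib)

lemma wedge_pt_scale_left: "wedge_pt k l (\<lambda>v. z * a v) b = (\<lambda>v. z * wedge_pt k l a b v)"
  by (rule ext) (simp add: wedge_pt_def sum_distrib_left mult_ac)

lemma wedge_pt_scale_right: "wedge_pt k l a (\<lambda>v. z * b v) = (\<lambda>v. z * wedge_pt k l a b v)"
  by (rule ext) (simp add: wedge_pt_def sum_distrib_left mult_ac)

lemma wedge_pt_zero_left: "wedge_pt k l (\<lambda>v. 0) b = (\<lambda>v. 0)"
  by (rule ext) (simp add: wedge_pt_def)

lemma wedge_pt_zero_right: "wedge_pt k l a (\<lambda>v. 0) = (\<lambda>v. 0)"
  by (rule ext) (simp add: wedge_pt_def)

lemma wedge_pt_sum_left: "wedge_pt k l (\<lambda>v. \<Sum>j\<in>J. a j v) b = (\<lambda>v. \<Sum>j\<in>J. wedge_pt k l (a j) b v)"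
  by (induction J rule: infinite_finite_induct)
     (simp_all add: wedge_pt_zero_left wedge_pt_add_left)

lemma wedge_pt_sum_right: "wedge_pt k l a (\<lambda>v. \<Sum>j\<in>J. b j v) = (\<lambda>v. \<Sum>j\<in>J. wedge_pt k l a (b j) v)"
  by (induction J rule: infinite_finite_induct)
     (simp_all add: wedge_pt_zero_right wedge_pt_add_right)

lemma wedge_pt_cnj: "wedge_pt k l (\<lambda>v. cnj (a v)) (\<lambda>v. cnj (b v)) = (\<lambda>v. cnj (wedge_pt k l a b v))"
  by (rule ext) (simp add: wedge_pt_def)

lemma wedge_pt_real:
  assumes "\<And>v. Im (a v) = 0" "\<And>v. Im (b v) = 0"
  shows "Im (wedge_pt k l a b v) = 0"
proof -
  have "(\<lambda>v. cnj (a v)) = a" "(\<lambda>v. cnj (b v)) = b" using assms by (auto simp: complex_eq_iff fun_eq_iff)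
  then have "wedge_pt k l a b v = cnj (wedge_pt k l a b v)"
    using fun_cong[OF wedge_pt_cnj[of k l a b], of v] by (simp only:)
  from arg_cong[OF this, of Im] show ?thesis by simp
qed

lemmas wedge_pt_bilinear = wedge_pt_add_left wedge_pt_add_right wedge_pt_scale_left
  wedge_pt_scale_right wedge_pt_zero_left wedge_pt_zero_right

abbreviation omit_arg :: "nat \<Rightarrow> (nat \<Rightarrow> 'v) \<Rightarrow> nat \<Rightarrow> 'v" where
  "omit_arg i v \<equiv> \<lambda>j. if j < i then v j else v (Suc j)"

text \<open>
  A permutation that fixes \<open>0\<close> acts on the arguments \<open>1, \<dots>, k\<close>, which are the \<open>k\<close> arguments left to
  \<open>b\<close> once the first one has been given to a 1-form.
\<close>

lemma alt_form_permute_tail: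
  assumes b: "alt_form k b" and p: "p permutes {1..<Suc k}"
  shows "b (\<lambda>j. w (p (Suc j))) = of_int (sign p) * b (\<lambda>j. w (Suc j))"
  using finite_atLeastLessThan p
proof (induction arbitrary: w rule: permutes_rev_induct)
  case id
  then show ?case by simp
next
  case (swap i j p)
  have pp: "permutation p" using swap by (auto intro: permutes_imp_permutation[rotated])
  have "(\<lambda>m. w ((p \<circ> Transposition.transpose i j) (Suc m))) =
      (\<lambda>m. w (p (Suc m))) \<circ> Transposition.transpose (i - 1) (j - 1)"
    using swap(1,2) by (auto simp: fun_eq_iff Transposition.transpose_def)
  then have "b (\<lambda>m. w ((p \<circ> Transposition.transpose i j) (Suc m))) = - b (\<lambda>m. w (p (Suc m)))"
    using alt_form_transpose[OF b, of "i - 1" "j - 1" "\<lambda>m. w (p (Suc m))"] swap(1-3) by auto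
  moreover have "sign (p \<circ> Transposition.transpose i j) = - sign p"
    using swap pp by (subst sign_compose) (simp_all add: permutation_swap_id sign_swap_id)
  ultimately show ?case
    using swap by (simp del: o_apply)
qed

text \<open>
  Group the permutations by \<open>i = \<sigma> 0\<close>, writing \<open>\<sigma>\<close> as the transposition of \<open>0\<close> and \<open>i\<close> after a
  permutation of the tail. By alternation the \<open>k!\<close> terms of a group agree, and the transposition
  differs from the cycle \<open>front_cycle i\<close>, which omits argument \<open>i\<close> and keeps the order of the
  others, by a permutation of the tail.
\<close>

lemma wedge_pt_1_left:
  assumes a: "alt_form 1 a" and b: "alt_form k b"
  shows "wedge_pt 1 k a b v = (\<Sum>i\<le>k. (- 1) ^ i * a (\<lambda>_. v i) * b (omit_arg i v))"
proof -
  let ?t = "Transposition.transpose (0::nat)"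
  let ?S = "{1..<Suc k}"
  have ins: "{..<1 + k} = insert 0 ?S" "{..k} = insert 0 ?S" by auto
  have "(\<Sum>\<sigma> | \<sigma> permutes {..<1 + k}. of_int (sign \<sigma>) * a (\<lambda>i. v (\<sigma> i)) * b (\<lambda>i. v (\<sigma> (1 + i)))) =
    (\<Sum>i\<in>insert 0 ?S. \<Sum>q | q permutes ?S. of_int (sign (?t i \<circ> q)) *
      a (\<lambda>j. v ((?t i \<circ> q) j)) * b (\<lambda>j. v ((?t i \<circ> q) (1 + j))))"
    unfolding ins(1) by (rule sum_over_permutations_insert) auto
  also have "\<dots> = (\<Sum>i\<in>insert 0 ?S. \<Sum>q | q permutes ?S. (- 1) ^ i * a (\<lambda>_. v i) * b (omit_arg i v))"
  proof (intro sum.cong[OF refl])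
    fix i q assume i: "i \<in> insert 0 ?S" and "q \<in> {q. q permutes ?S}"
    then have q: "q permutes ?S" by simp
    have q0: "q 0 = 0" using q by (simp add: permutes_not_in)
    have pq: "permutation q" using q by (auto intro: permutes_imp_permutation[rotated])
    have pc: "permutation (front_cycle i)"
      using front_cycle_permutes by (auto intro: permutes_imp_permutation[rotated])
    have "front_cycle i permutes insert 0 ?S"
      using front_cycle_permutes by (rule permutes_subset) (use i in auto)
    moreover have "?t i permutes insert 0 ?S"
      by (rule permutes_swap_id) (use i in auto)
    ultimately have "?t i \<circ> front_cycle i permutes insert 0 ?S"
      by (rule permutes_compose)
    then have r: "?t i \<circ> front_cycle i permutes ?S" (is "?r permutes _")
      by (rule permutes_superset) (auto simp: front_cycle_def)
    have "a (\<lambda>j. v ((?t i \<circ> q) j)) = a (\<lambda>_. v i)"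
      by (rule alt_form_local[OF a]) (simp add: q0)
    moreover have "b (\<lambda>j. v ((?t i \<circ> q) (1 + j))) = of_int (sign q) * b (\<lambda>j. v (?t i (Suc j)))"
      using alt_form_permute_tail[OF b q, of "v \<circ> ?t i"] by simp
    moreover have "b (omit_arg i v) = of_int (sign ?r) * b (\<lambda>j. v (?t i (Suc j)))"
    proof -
      have "omit_arg i v = (\<lambda>j. (v \<circ> ?t i) (?r (Suc j)))"
        by (auto simp: fun_eq_iff front_cycle_def)
      then show ?thesis
        using alt_form_permute_tail[OF b r, of "v \<circ> ?t i"] by simp
    qed
    moreover have "sign ?r = sign (?t i) * (- 1) ^ i" "sign (?t i \<circ> q) = sign (?t i) * sign q"
      using pc pq by (simp_all only: sign_compose permutation_swap_id sign_front_cycle)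
    ultimately show "of_int (sign (?t i \<circ> q)) *
      a (\<lambda>j. v ((?t i \<circ> q) j)) * b (\<lambda>j. v ((?t i \<circ> q) (1 + j))) =
      (- 1) ^ i * a (\<lambda>_. v i) * b (omit_arg i v)"
      by (cases rule: sign_cases[of "?t i"]; cases rule: sign_cases[of q]; simp add: mult.left_commute)
  qed
  also have "\<dots> = fact k * (\<Sum>i\<in>insert 0 ?S. (- 1) ^ i * a (\<lambda>_. v i) * b (omit_arg i v))"
    by (simp add: card_permutations[of _ k] sum_distrib_left algebra_simps)
  finally show ?thesis
    unfolding wedge_pt_def ins(2) by simp
qed

text \<open>
  The family of arguments that evaluates a 2-form at two vectors.
\<close>

abbreviation pair_args :: "'v \<Rightarrow> 'v \<Rightarrow> nat \<Rightarrow> 'v" where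
  "pair_args x y \<equiv> case_nat x (\<lambda>_. y)"

lemma alt_form_2_pair: "alt_form 2 a \<Longrightarrow> a v = a (pair_args (v 0) (v 1))"
  by (rule alt_form_local) (auto simp: less_2_cases_iff)

lemma alt_form_2_flip: "alt_form 2 a \<Longrightarrow> a (pair_args y x) = - a (pair_args x y)"
proof -
  assume a: "alt_form 2 a"
  have "pair_args x y \<circ> Transposition.transpose 0 1 = (\<lambda>i. if i = 0 then y else if i = 1 then x else y)"
    by (auto simp: fun_eq_iff Transposition.transpose_def split: nat.split)
  moreover have "a (\<lambda>i. if i = 0 then y else if i = 1 then x else y) = a (pair_args y x)"
    by (rule alt_form_local[OF a]) (auto simp: less_2_cases_iff)
  ultimately show ?thesis using alt_form_transpose[OF a, of 0 1 "pair_args x y"] by simp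
qed

lemma sum_permutes_4:
  fixes f :: "(nat \<Rightarrow> nat) \<Rightarrow> complex"
  shows "sum f {\<sigma>. \<sigma> permutes {0, 1, 2, 3}} =
    (\<Sum>i\<in>{0, 1, 2, 3}. \<Sum>j\<in>{1, 2, 3}. \<Sum>k\<in>{2, 3}. f (Transposition.transpose 0 i \<circ>
      (Transposition.transpose 1 j \<circ> Transposition.transpose 2 k)))"
proof -
  let ?t = "Transposition.transpose :: nat \<Rightarrow> nat \<Rightarrow> nat \<Rightarrow> nat"
  have e3: "sum f {\<sigma>. \<sigma> permutes {3::nat}} = f id" for f :: "_ \<Rightarrow> complex"
    by (simp only: permutes_sing) simp
  have e2: "sum f {\<sigma>. \<sigma> permutes {2, 3}} = (\<Sum>k\<in>{2, 3}. f (?t 2 k))" for f :: "_ \<Rightarrow> complex"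
    by (subst sum_over_permutations_insert, simp, simp, simp only: e3 o_id)
  have e1: "sum f {\<sigma>. \<sigma> permutes {1, 2, 3}} = (\<Sum>j\<in>{1, 2, 3}. \<Sum>k\<in>{2, 3}. f (?t 1 j \<circ> ?t 2 k))"
    for f :: "_ \<Rightarrow> complex"
    by (subst sum_over_permutations_insert, simp, simp, simp only: e2)
  show ?thesis
    by (subst sum_over_permutations_insert, simp, simp, simp only: e1)
qed

text \<open>
  The 24 terms of the sum, collected with the antisymmetry of both factors.
\<close>

lemma wedge_pt_2_2:
  assumes a: "alt_form 2 a" and b: "alt_form 2 b"
  defines "A \<equiv> \<lambda>x y. a (pair_args x y)" and "B \<equiv> \<lambda>x y. b (pair_args x y)"
  shows "wedge_pt 2 2 a b v =
    A (v 0) (v 1) * B (v 2) (v 3) - A (v 0) (v 2) * B (v 1) (v 3) + A (v 0) (v 3) * B (v 1) (v 2) +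
    A (v 1) (v 2) * B (v 0) (v 3) - A (v 1) (v 3) * B (v 0) (v 2) + A (v 2) (v 3) * B (v 0) (v 1)"
proof -
  have A: "a (\<lambda>i. v (\<sigma> i)) = A (v (\<sigma> 0)) (v (\<sigma> 1))" for \<sigma>
    unfolding A_def by (rule alt_form_2_pair[OF a])
  have B: "b (\<lambda>i. v (\<sigma> (2 + i))) = B (v (\<sigma> 2)) (v (\<sigma> 3))" for \<sigma>
    unfolding B_def using alt_form_2_pair[OF b, of "\<lambda>i. v (\<sigma> (2 + i))"] by (simp add: eval_nat_numeral)
  have S: "{..<2 + 2} = {0, 1, 2, 3::nat}" by auto
  have flip: "A y x = - A x y" "B y x = - B x y" for x y
    unfolding A_def B_def using alt_form_2_flip a b by blast+
  let ?t = "Transposition.transpose :: nat \<Rightarrow> nat \<Rightarrow> nat \<Rightarrow> nat"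
  let ?f = "\<lambda>\<sigma>. A (v (\<sigma> 0)) (v (\<sigma> 1)) * B (v (\<sigma> 2)) (v (\<sigma> 3))"
  have sgn: "sign (?t x y) = (if x = y then 1 else - 1)" for x y
    by (rule sign_swap_id)
  have "(\<Sum>\<sigma> | \<sigma> permutes {0, 1, 2, 3}. of_int (sign \<sigma>) * ?f \<sigma>) =
      (\<Sum>i\<in>{0, 1, 2, 3}. \<Sum>j\<in>{1, 2, 3}. \<Sum>k\<in>{2, 3}.
        of_int (sign (?t 0 i) * sign (?t 1 j) * sign (?t 2 k)) * ?f (?t 0 i \<circ> (?t 1 j \<circ> ?t 2 k)))"
    by (simp only: sum_permutes_4 sign_compose permutation_compose permutation_swap_id mult.assoc)
  also have "\<dots> = 4 * (A (v 0) (v 1) * B (v 2) (v 3) - A (v 0) (v 2) * B (v 1) (v 3) +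
     A (v 0) (v 3) * B (v 1) (v 2) + A (v 1) (v 2) * B (v 0) (v 3) - A (v 1) (v 3) * B (v 0) (v 2) +
     A (v 2) (v 3) * B (v 0) (v 1))"
  proof -
    have sums: "(\<Sum>i\<in>{0, 1, 2, 3}. f i) = f 0 + (f 1 + (f 2 + f (3::nat)))"
      "(\<Sum>i\<in>{1, 2, 3}. f i) = f 1 + (f 2 + f (3::nat))" "(\<Sum>i\<in>{2, 3}. f i) = f 2 + f (3::nat)"
      for f :: "nat \<Rightarrow> complex"
      by simp_all
    have flips: "A (v 1) (v 0) = - A (v 0) (v 1)" "A (v 2) (v 0) = - A (v 0) (v 2)"
      "A (v 3) (v 0) = - A (v 0) (v 3)" "A (v 2) (v 1) = - A (v 1) (v 2)"
      "A (v 3) (v 1) = - A (v 1) (v 3)" "A (v 3) (v 2) = - A (v 2) (v 3)"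
      "B (v 1) (v 0) = - B (v 0) (v 1)" "B (v 2) (v 0) = - B (v 0) (v 2)"
      "B (v 3) (v 0) = - B (v 0) (v 3)" "B (v 2) (v 1) = - B (v 1) (v 2)"
      "B (v 3) (v 1) = - B (v 1) (v 3)" "B (v 3) (v 2) = - B (v 2) (v 3)"
      by (rule flip)+
    show ?thesis
      unfolding sums sgn Transposition.transpose_def o_def
      by (simp only: flips zero_neq_numeral zero_neq_one one_eq_numeral_iff numeral_eq_iff
          num.simps if_True if_False numeral_eq_one_iff numeral_neq_zero one_neq_zero simp_thms refl
          of_int_1 of_int_minus mult_1 of_int_mult mult_minus_left mult_minus_right minus_minus)
         (simp add: algebra_simps)
  qed
  finally show ?thesis
    unfolding wedge_pt_def A B S mult.assoc fact_2 by simp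
qed


section \<open>Calculus of iterated directional derivatives\<close>

lemma differentiable_cong_open:
  assumes "open S" "x \<in> S" "\<And>y. y \<in> S \<Longrightarrow> f y = g y"
  shows "f differentiable (at x) \<longleftrightarrow> g differentiable (at x)"
    and "frechet_derivative f (at x) = frechet_derivative g (at x)"
proof -
  have "(f has_derivative D) (at x) \<longleftrightarrow> (g has_derivative D) (at x)" for D
    using has_derivative_transform_within_open[of f D x UNIV S g]
      has_derivative_transform_within_open[of g D x UNIV S f] assms by auto
  then show "f differentiable (at x) \<longleftrightarrow> g differentiable (at x)"
    and "frechet_derivative f (at x) = frechet_derivative g (at x)"
    by (simp_all add: differentiable_def frechet_derivative_def)
qed

text \<open>
  Openness of \<open>S\<close> lets equality on \<open>S\<close> pass to derivatives at points of \<open>S\<close>; this is what makes the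
  recursive definition stable under replacing a derivative by the formula for it.
\<close>

lemma Ck_on_cong:
  assumes "open S" "\<And>x. x \<in> S \<Longrightarrow> f x = g x"
  shows "Ck_on k S f \<longleftrightarrow> Ck_on k S g"
  using assms(2)
proof (induction k arbitrary: f g)
  case 0
  then show ?case by (simp cong: continuous_on_cong)
next
  case (Suc k)
  have "Ck_on k S (\<lambda>x. frechet_derivative f (at x) v) \<longleftrightarrow> Ck_on k S (\<lambda>x. frechet_derivative g (at x) v)"
      for v
    by (rule Suc.IH) (simp add: differentiable_cong_open(2)[OF assms(1) _ Suc.prems])
  then show ?case
    using differentiable_cong_open(1)[OF assms(1) _ Suc.prems] by simp
qed

lemma smooth_on_cong: "open S \<Longrightarrow> (\<And>x. x \<in> S \<Longrightarrow> f x = g x) \<Longrightarrow> smooth_on S f \<longleftrightarrow> smooth_on S g"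
  unfolding smooth_on_def using Ck_on_cong[of S f g] by simp

lemma Ck_on_Suc_imp: "Ck_on (Suc k) S f \<Longrightarrow> Ck_on k S f"
proof (induction k arbitrary: f)
  case 0
  then show ?case
    by (auto intro!: continuous_at_imp_continuous_on differentiable_imp_continuous_within)
next
  case (Suc k)
  then show ?case by (metis Ck_on.simps(2))
qed

lemma Ck_on_const: "Ck_on k S (\<lambda>x. c)"
  by (induction k arbitrary: c) auto

lemma Ck_on_bounded_linear:
  assumes S: "open S" and L: "bounded_linear L"
  shows "Ck_on k S f \<Longrightarrow> Ck_on k S (\<lambda>x. L (f x))"
proof (induction k arbitrary: f)
  case 0
  then show ?case
    using continuous_on_compose[of S f L] linear_continuous_on[OF L] by (simp add: o_def)
next
  case (Suc k)
  have D: "((\<lambda>x. L (f x)) has_derivative (\<lambda>v. L (frechet_derivative f (at x) v))) (at x)" if "x \<in> S" for x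
    using Suc.prems that
      by (auto intro!: bounded_linear.has_derivative[OF L] simp: frechet_derivative_works)
  have "Ck_on k S (\<lambda>x. frechet_derivative (\<lambda>x. L (f x)) (at x) v)" for v
  proof -
    have "Ck_on k S (\<lambda>x. L (frechet_derivative f (at x) v))"
      using Suc by simp
    then show ?thesis
      by (subst Ck_on_cong[OF S]) (simp_all add: frechet_derivative_at[OF D, symmetric])
  qed
  then show ?case
    using D by (auto simp: differentiable_def)
qed

lemma Ck_on_add:
  assumes S: "open S"
  shows "Ck_on k S f \<Longrightarrow> Ck_on k S g \<Longrightarrow> Ck_on k S (\<lambda>x. f x + g x)"
proof (induction k arbitrary: f g)
  case 0
  then show ?case by (simp add: continuous_on_add)
next
  case (Suc k)
  have D: "((\<lambda>x. f x + g x) has_derivative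
      (\<lambda>v. frechet_derivative f (at x) v + frechet_derivative g (at x) v)) (at x)" if "x \<in> S" for x
    using Suc.prems that by (auto intro!: has_derivative_add simp: frechet_derivative_works)
  have "Ck_on k S (\<lambda>x. frechet_derivative (\<lambda>x. f x + g x) (at x) v)" for v
  proof -
    have "Ck_on k S (\<lambda>x. frechet_derivative f (at x) v + frechet_derivative g (at x) v)"
      using Suc by simp
    then show ?thesis
      by (subst Ck_on_cong[OF S]) (simp_all add: frechet_derivative_at[OF D, symmetric])
  qed
  then show ?case
    using D by (auto simp: differentiable_def)
qed

text \<open>
  Induction on the order for all pairs of functions at once, since the product rule leads to
  products of one factor with a derivative of the other.
\<close>

lemma Ck_on_bounded_bilinear:
  assumes B: "bounded_bilinear B" and S: "open S"
  shows "Ck_on k S f \<Longrightarrow> Ck_on k S g \<Longrightarrow> Ck_on k S (\<lambda>x. B (f x) (g x))"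
proof (induction k arbitrary: f g)
  case 0
  then show ?case by (simp add: bounded_bilinear.continuous_on[OF B])
next
  case (Suc k)
  have D: "((\<lambda>x. B (f x) (g x)) has_derivative
      (\<lambda>v. B (f x) (frechet_derivative g (at x) v) + B (frechet_derivative f (at x) v) (g x))) (at x)"
    if "x \<in> S" for x
    using Suc.prems that by (auto intro!: bounded_bilinear.FDERIV[OF B] simp: frechet_derivative_works)
  have "Ck_on k S (\<lambda>x. frechet_derivative (\<lambda>x. B (f x) (g x)) (at x) v)" for v
  proof -
    have "Ck_on k S (\<lambda>x. B (f x) (frechet_derivative g (at x) v) +
        B (frechet_derivative f (at x) v) (g x))"
      using Suc.prems
        by (intro Ck_on_add[OF S] Suc.IH) (simp_all add: Ck_on_Suc_imp del: Ck_on.simps, simp_all)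
    then show ?thesis
      by (subst Ck_on_cong[OF S]) (simp_all add: frechet_derivative_at[OF D, symmetric])
  qed
  then show ?case
    using D by (auto simp: differentiable_def)
qed

lemma Ck_on_inverse:
  fixes f :: "'v::euclidean_space \<Rightarrow> real"
  assumes S: "open S" and nz: "\<And>x. x \<in> S \<Longrightarrow> f x \<noteq> 0"
  shows "Ck_on k S f \<Longrightarrow> Ck_on k S (\<lambda>x. inverse (f x))"
proof (induction k)
  case 0
  then show ?case using nz by (simp add: continuous_on_inverse)
next
  case (Suc k)
  have D: "((\<lambda>x. inverse (f x)) has_derivative
      (\<lambda>v. - (inverse (f x) * frechet_derivative f (at x) v * inverse (f x)))) (at x)" if "x \<in> S" for x
    using Suc.prems that nz by (intro Deriv.has_derivative_inverse) (auto simp: frechet_derivative_works)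
  have "Ck_on k S (\<lambda>x. frechet_derivative (\<lambda>x. inverse (f x)) (at x) v)" for v
  proof -
    have i: "Ck_on k S (\<lambda>x. inverse (f x))"
      by (rule Suc.IH, rule Ck_on_Suc_imp, rule Suc.prems)
    have "Ck_on k S (\<lambda>x. - (inverse (f x) * frechet_derivative f (at x) v * inverse (f x)))"
      by (intro Ck_on_bounded_linear[OF S bounded_linear_minus[OF bounded_linear_ident]]
          Ck_on_bounded_bilinear[OF bounded_bilinear_mult S] i) (use Suc.prems in simp)
    then show ?thesis
      by (subst Ck_on_cong[OF S]) (simp_all add: frechet_derivative_at[OF D, symmetric])
  qed
  then show ?case
    using D by (auto simp: differentiable_def)
qed

lemma smooth_on_const: "smooth_on S (\<lambda>x. c)"
  by (simp add: smooth_on_def Ck_on_const)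

lemma smooth_on_bounded_linear:
  "open S \<Longrightarrow> bounded_linear L \<Longrightarrow> smooth_on S f \<Longrightarrow> smooth_on S (\<lambda>x. L (f x))"
  by (simp add: smooth_on_def Ck_on_bounded_linear)

lemma smooth_on_add: "open S \<Longrightarrow> smooth_on S f \<Longrightarrow> smooth_on S g \<Longrightarrow> smooth_on S (\<lambda>x. f x + g x)"
  by (simp add: smooth_on_def Ck_on_add)

lemma smooth_on_mult:
  fixes f g :: "'v::euclidean_space \<Rightarrow> 'b::real_normed_algebra"
  shows "open S \<Longrightarrow> smooth_on S f \<Longrightarrow> smooth_on S g \<Longrightarrow> smooth_on S (\<lambda>x. f x * g x)"
  by (simp add: smooth_on_def Ck_on_bounded_bilinear[OF bounded_bilinear_mult])

lemma smooth_on_inverse: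
  fixes f :: "'v::euclidean_space \<Rightarrow> real"
  shows "open S \<Longrightarrow> (\<And>x. x \<in> S \<Longrightarrow> f x \<noteq> 0) \<Longrightarrow> smooth_on S f \<Longrightarrow> smooth_on S (\<lambda>x. inverse (f x))"
  by (simp add: smooth_on_def Ck_on_inverse)

lemma smooth_on_sum:
  "open S \<Longrightarrow> (\<And>i. i \<in> I \<Longrightarrow> smooth_on S (f i)) \<Longrightarrow> smooth_on S (\<lambda>x. \<Sum>i\<in>I. f i x)"
  by (induction I rule: infinite_finite_induct) (simp_all add: smooth_on_const smooth_on_add)

lemma smooth_on_prod:
  fixes f :: "'i \<Rightarrow> 'v::euclidean_space \<Rightarrow> 'b::{real_normed_algebra,comm_ring_1}"
  shows "open S \<Longrightarrow> (\<And>i. i \<in> I \<Longrightarrow> smooth_on S (f i)) \<Longrightarrow> smooth_on S (\<lambda>x. \<Prod>i\<in>I. f i x)"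
  by (induction I rule: infinite_finite_induct) (simp_all add: smooth_on_const smooth_on_mult)

lemma smooth_on_differentiable: "smooth_on S f \<Longrightarrow> x \<in> S \<Longrightarrow> f differentiable (at x)"
  unfolding smooth_on_def by (metis Ck_on.simps(2))

lemma smooth_on_frechet_derivative:
  "smooth_on S f \<Longrightarrow> smooth_on S (\<lambda>x. frechet_derivative f (at x) v)"
  unfolding smooth_on_def by (metis Ck_on.simps(2))

lemma smooth_on_vec:
  assumes S: "open S" and f: "\<And>i. smooth_on S (f i)"
  shows "smooth_on S (\<lambda>x. (\<chi> i. f i x) :: real^'n)"
proof -
  have "(\<lambda>x. (\<chi> i. f i x) :: real^'n) = (\<lambda>x. \<Sum>i\<in>UNIV. f i x *\<^sub>R axis i 1)"
    by (simp add: fun_eq_iff vec_eq_iff axis_def if_distrib cong: if_cong)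
  moreover have "smooth_on S (\<lambda>x. f i x *\<^sub>R (axis i 1 :: real^'n))" for i
    by (rule smooth_on_bounded_linear[OF S bounded_linear_scaleR_left f])
  ultimately show ?thesis by (simp add: smooth_on_sum[OF S])
qed

lemma smooth_on_det:
  fixes G :: "'v::euclidean_space \<Rightarrow> real^'n^'n"
  assumes S: "open S" and G: "\<And>i j. smooth_on S (\<lambda>x. G x $ i $ j)"
  shows "smooth_on S (\<lambda>x. det (G x))"
  unfolding det_def by (intro smooth_on_sum smooth_on_mult smooth_on_prod smooth_on_const S G)

text \<open>
  Cramer's rule expresses the solution by determinants, which are polynomial in the entries.
\<close>

lemma smooth_on_linear_solution:
  fixes G :: "'v::euclidean_space \<Rightarrow> real^'n^'n"
  assumes S: "open S" and G: "\<And>i j. smooth_on S (\<lambda>x. G x $ i $ j)"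
    and b: "\<And>i. smooth_on S (\<lambda>x. b x $ i)"
    and det: "\<And>x. x \<in> S \<Longrightarrow> det (G x) \<noteq> 0" and u: "\<And>x. x \<in> S \<Longrightarrow> G x *v u x = b x"
  shows "smooth_on S u"
proof -
  let ?M = "\<lambda>k x. (\<chi> i j. if j = k then b x $ i else G x $ i $ j) :: real^'n^'n"
  have M: "smooth_on S (\<lambda>x. ?M k x $ i $ j)" for k i j
    using G b by (cases "j = k") simp_all
  have "smooth_on S (\<lambda>x. (\<chi> k. det (?M k x) * inverse (det (G x))) :: real^'n)"
    by (intro smooth_on_vec smooth_on_mult smooth_on_inverse smooth_on_det S G M det)
  then show ?thesis
    by (subst smooth_on_cong[OF S])
       (use cramer[OF det] u in \<open>auto simp: divide_inverse\<close>)
qed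

lemma has_real_derivative_along_line:
  fixes f :: "'v::euclidean_space \<Rightarrow> real"
  assumes f: "f differentiable (at (y + s *\<^sub>R u))"
  shows "((\<lambda>s. f (y + s *\<^sub>R u)) has_real_derivative frechet_derivative f (at (y + s *\<^sub>R u)) u) (at s)"
proof -
  have "(f has_derivative frechet_derivative f (at (y + s *\<^sub>R u))) (at (y + s *\<^sub>R u))"
    using f by (simp add: frechet_derivative_works)
  moreover have "((\<lambda>s. y + s *\<^sub>R u) has_derivative (\<lambda>s. s *\<^sub>R u)) (at s)"
    by (auto intro!: derivative_eq_intros)
  ultimately have "((\<lambda>s. f (y + s *\<^sub>R u)) has_derivative (\<lambda>t. frechet_derivative f (at (y +
      s *\<^sub>R u)) (t *\<^sub>R u))) (at s)"
    by (rule has_derivative_compose[rotated])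
  then show ?thesis
    unfolding has_field_derivative_def
    by (simp add: linear_cmul[OF linear_frechet_derivative[OF f]] mult_commute_abs)
qed

text \<open>
  The mean value theorem, applied first to \<open>s \<mapsto> f(x + s u + h v) - f(x + s u)\<close> and then to the
  derivative along \<open>u\<close>. The left-hand side is symmetric in \<open>u\<close> and \<open>v\<close>, the right-hand side is not.
\<close>

lemma second_difference_mvt:
  fixes f :: "'v::euclidean_space \<Rightarrow> real"
  assumes f: "\<And>x. x \<in> S \<Longrightarrow> f differentiable (at x)"
    and fu: "\<And>x. x \<in> S \<Longrightarrow> (\<lambda>x. frechet_derivative f (at x) u) differentiable (at x)"
    and h: "h > 0" and S: "\<And>s t. 0 \<le> s \<Longrightarrow> s \<le> h \<Longrightarrow> 0 \<le> t \<Longrightarrow> t \<le> h \<Longrightarrow> x + s *\<^sub>R u + t *\<^sub>R v \<in> S"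
  obtains s t where "0 < s" "s < h" "0 < t" "t < h"
    "f (x + h *\<^sub>R u + h *\<^sub>R v) - f (x + h *\<^sub>R u) - f (x + h *\<^sub>R v) + f x =
     h * h * frechet_derivative (\<lambda>x. frechet_derivative f (at x) u) (at (x + s *\<^sub>R u + t *\<^sub>R v)) v"
proof -
  define D where "D y = frechet_derivative f (at y) u" for y
  have der: "((\<lambda>s. f (y + s *\<^sub>R u)) has_real_derivative D (y + s *\<^sub>R u)) (at s)"
    if "y + s *\<^sub>R u \<in> S" for y s
    unfolding D_def by (rule has_real_derivative_along_line[OF f[OF that]])
  have der2: "((\<lambda>t. D (y + t *\<^sub>R v)) has_real_derivative frechet_derivative D (at (y + t *\<^sub>R v)) v)
      (at t)"
    if "y + t *\<^sub>R v \<in> S" for y t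
    using fu[OF that] by (intro has_real_derivative_along_line) (simp add: D_def[abs_def])
  have S': "x + h *\<^sub>R v + s *\<^sub>R u \<in> S" "x + s *\<^sub>R u \<in> S" if "0 \<le> s" "s \<le> h" for s
    using S[of s h] S[of s 0] that h by (simp_all add: add_ac)
  have "\<exists>s. 0 < s \<and> s < h \<and>
      (f (x + h *\<^sub>R v + h *\<^sub>R u) - f (x + h *\<^sub>R u)) - (f (x + h *\<^sub>R v + 0 *\<^sub>R u) - f (x + 0 *\<^sub>R u)) =
      (h - 0) * (D (x + h *\<^sub>R v + s *\<^sub>R u) - D (x + s *\<^sub>R u))"
    by (rule MVT2[OF h]) (intro DERIV_diff der S'; simp)
  then obtain s where s: "0 < s" "s < h"
    and eq1: "(f (x + h *\<^sub>R v + h *\<^sub>R u) - f (x + h *\<^sub>R u)) - (f (x + h *\<^sub>R v) - f x) =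
      h * (D (x + h *\<^sub>R v + s *\<^sub>R u) - D (x + s *\<^sub>R u))"
    by auto
  have "\<exists>t. 0 < t \<and> t < h \<and> D (x + s *\<^sub>R u + h *\<^sub>R v) - D (x + s *\<^sub>R u + 0 *\<^sub>R v) =
      (h - 0) * frechet_derivative D (at (x + s *\<^sub>R u + t *\<^sub>R v)) v"
    by (rule MVT2[OF h]) (intro der2 S; use s in simp)
  then obtain t where t: "0 < t" "t < h"
    and eq2: "D (x + s *\<^sub>R u + h *\<^sub>R v) - D (x + s *\<^sub>R u) =
        h * frechet_derivative D (at (x + s *\<^sub>R u + t *\<^sub>R v)) v"
    by auto
  show ?thesis
    by (rule that[OF s t]) (use eq1 eq2 in \<open>simp add: D_def[abs_def] add_ac algebra_simps\<close>)
qed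

text \<open>
  Both mixed derivatives, taken at points close to \<open>x\<close>, equal the same second difference divided by
  \<open>h\<^sup>2\<close>. By continuity they agree at \<open>x\<close>.
\<close>

lemma symmetric_second_derivative_real:
  fixes f :: "'v::euclidean_space \<Rightarrow> real"
  assumes S: "open S" "x \<in> S" and f: "Ck_on 2 S f"
  shows "frechet_derivative (\<lambda>x. frechet_derivative f (at x) u) (at x) v =
         frechet_derivative (\<lambda>x. frechet_derivative f (at x) v) (at x) u"
proof (rule ccontr)
  define B where "B u v y = frechet_derivative (\<lambda>x. frechet_derivative f (at x) u) (at y) v" for u v y
  have fd: "f differentiable (at y)" and fd2: "(\<lambda>x. frechet_derivative f (at x) w) differentiable (at y)"
    if "y \<in> S" for y w
    using f that by (auto simp: numeral_2_eq_2)
  have cB: "isCont (B u v) x" for u v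
    using f S by (auto simp: numeral_2_eq_2 B_def[abs_def] continuous_on_eq_continuous_at)
  assume "\<not> ?thesis"
  then have e: "\<bar>B u v x - B v u x\<bar> / 2 > 0" (is "?e > 0") by (simp add: B_def)
  obtain d1 where d1: "d1 > 0" "\<And>y. dist y x < d1 \<Longrightarrow> dist (B u v y) (B u v x) < ?e"
    using cB[of u v] e unfolding continuous_at_eps_delta by (metis dist_commute)
  obtain d2 where d2: "d2 > 0" "\<And>y. dist y x < d2 \<Longrightarrow> dist (B v u y) (B v u x) < ?e"
    using cB[of v u] e unfolding continuous_at_eps_delta by (metis dist_commute)
  obtain d3 where d3: "d3 > 0" "ball x d3 \<subseteq> S" using S open_contains_ball by blast
  define d where "d = min d1 (min d2 d3)"
  have d: "d > 0" using d1 d2 d3 by (simp add: d_def)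
  \<comment> \<open>The parallelogram with sides \<open>h u\<close> and \<open>h v\<close> has to lie in the ball of radius \<open>d\<close> around \<open>x\<close>; the
  summand \<open>1\<close> covers \<open>u = v = 0\<close>.\<close>
  define h where "h = d / (2 * (norm u + norm v + 1))"
  have n: "norm u + norm v + 1 > 0" by (simp add: add_nonneg_pos)
  have h: "h > 0" using d n by (simp add: h_def)
  have close: "dist (x + s *\<^sub>R p + t *\<^sub>R q) x < d"
    if "0 \<le> s" "s \<le> h" "0 \<le> t" "t \<le> h" "norm p + norm q = norm u + norm v" for s t p q
  proof -
    have "dist (x + s *\<^sub>R p + t *\<^sub>R q) x \<le> norm (s *\<^sub>R p) + norm (t *\<^sub>R q)"
      by (simp add: dist_norm add.assoc norm_triangle_ineq del: norm_scaleR)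
    also have "\<dots> \<le> h * norm p + h * norm q"
      using that by (intro add_mono) (auto intro: mult_right_mono)
    also have "\<dots> = h * (norm u + norm v)" using that(5) by (simp flip: distrib_left)
    also have "\<dots> < h * (2 * (norm u + norm v + 1))"
      using h by (intro mult_strict_left_mono) (auto intro!: add_nonneg_pos)
    also have "\<dots> = d" using n by (simp add: h_def)
    finally show ?thesis .
  qed
  have inS: "y \<in> S" if "dist y x < d" for y
    using that d3(2) by (auto simp: d_def dist_commute)
  obtain s1 t1 where 1: "0 < s1" "s1 < h" "0 < t1" "t1 < h"
    "f (x + h *\<^sub>R u + h *\<^sub>R v) - f (x + h *\<^sub>R u) - f (x + h *\<^sub>R v) + f x = h * h * B u v (x + s1 *\<^sub>R u +
      t1 *\<^sub>R v)"
    unfolding B_def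
    by (rule second_difference_mvt[of S f u h x v]) (use fd fd2 h in \<open>auto intro!: inS close\<close>)
  obtain s2 t2 where 2: "0 < s2" "s2 < h" "0 < t2" "t2 < h"
    "f (x + h *\<^sub>R v + h *\<^sub>R u) - f (x + h *\<^sub>R v) - f (x + h *\<^sub>R u) + f x = h * h * B v u (x + s2 *\<^sub>R v +
      t2 *\<^sub>R u)"
    unfolding B_def
    by (rule second_difference_mvt[of S f v h x u]) (use fd fd2 h in \<open>auto intro!: inS close\<close>)
  have "h * h * B u v (x + s1 *\<^sub>R u + t1 *\<^sub>R v) = h * h * B v u (x + s2 *\<^sub>R v + t2 *\<^sub>R u)"
    unfolding 1(5)[symmetric] 2(5)[symmetric] by (simp add: add_ac)
  then have "B u v (x + s1 *\<^sub>R u + t1 *\<^sub>R v) = B v u (x + s2 *\<^sub>R v + t2 *\<^sub>R u)"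
    using h by simp
  moreover have "dist (B u v (x + s1 *\<^sub>R u + t1 *\<^sub>R v)) (B u v x) < ?e"
    by (rule d1(2), rule less_le_trans[OF close]) (use 1 in \<open>auto simp: d_def\<close>)
  moreover have "dist (B v u (x + s2 *\<^sub>R v + t2 *\<^sub>R u)) (B v u x) < ?e"
    by (rule d2(2), rule less_le_trans[OF close]) (use 2 in \<open>auto simp: d_def\<close>)
  ultimately show False
    by (simp add: dist_real_def abs_if split: if_splits)
qed

lemma symmetric_second_derivative:
  fixes f :: "'v::euclidean_space \<Rightarrow> 'b::euclidean_space"
  assumes S: "open S" "x \<in> S" and f: "Ck_on 2 S f"
  shows "frechet_derivative (\<lambda>x. frechet_derivative f (at x) u) (at x) v =
         frechet_derivative (\<lambda>x. frechet_derivative f (at x) v) (at x) u"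
proof (rule euclidean_eqI)
  fix b :: 'b assume "b \<in> Basis"
  let ?g = "\<lambda>x. f x \<bullet> b"
  have fd: "f differentiable (at y)" and fd2: "(\<lambda>x. frechet_derivative f (at x) w) differentiable (at y)"
    if "y \<in> S" for y w
    using f that by (auto simp: numeral_2_eq_2)
  have inner: "frechet_derivative (\<lambda>x. g x \<bullet> b) (at y) w = frechet_derivative g (at y) w \<bullet> b"
    if "g differentiable (at y)" for g :: "'v \<Rightarrow> 'b" and y w
  proof -
    have "((\<lambda>x. g x \<bullet> b) has_derivative (\<lambda>w. frechet_derivative g (at y) w \<bullet> b)) (at y)"
      using that by (intro has_derivative_inner_left) (simp add: frechet_derivative_works)
    then show ?thesis by (simp add: frechet_derivative_at[symmetric])
  qed
  have g2: "frechet_derivative (\<lambda>x. frechet_derivative ?g (at x) u) (at x) v =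
      frechet_derivative (\<lambda>x. frechet_derivative f (at x) u) (at x) v \<bullet> b" for u v
  proof -
    have "frechet_derivative (\<lambda>x. frechet_derivative ?g (at x) u) (at x) =
        frechet_derivative (\<lambda>x. frechet_derivative f (at x) u \<bullet> b) (at x)"
      by (rule differentiable_cong_open(2)[OF S]) (simp add: inner fd)
    then show ?thesis by (simp add: inner fd2[OF S(2)])
  qed
  have "Ck_on 2 S ?g"
    by (rule Ck_on_bounded_linear[OF S(1) bounded_linear_inner_left f])
  from symmetric_second_derivative_real[OF S this, of u v]
  show "frechet_derivative (\<lambda>x. frechet_derivative f (at x) u) (at x) v \<bullet> b =
        frechet_derivative (\<lambda>x. frechet_derivative f (at x) v) (at x) u \<bullet> b"
    by (simp add: g2)
qed


lemma alt_form_add: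
  assumes a: "alt_form k a" and b: "alt_form k b"
  shows "alt_form k (\<lambda>v. a v + b v)"
  unfolding alt_form_def
proof (intro conjI allI impI)
  show "a v + b v = a w + b w" if "\<forall>i<k. v i = w i" for v w
    using that alt_form_local[OF a, of v w] alt_form_local[OF b, of v w] by simp
  show "linear (\<lambda>x. a (v(i := x)) + b (v(i := x)))" if "i < k" for v i
    using that by (intro linear_compose_add alt_form_linear[OF a] alt_form_linear[OF b])
  show "a v + b v = 0" if "i < j \<and> j < k \<and> v i = v j" for v i j
    using that alt_form_repeat[OF a, of i j v] alt_form_repeat[OF b, of i j v] by simp
qed

lemma alt_form_bounded_linear:
  assumes f: "bounded_linear f" and a: "alt_form k a"
  shows "alt_form k (\<lambda>v. f (a v))"
  unfolding alt_form_def
proof (intro conjI allI impI)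
  show "f (a v) = f (a w)" if "\<forall>i<k. v i = w i" for v w
    using that alt_form_local[OF a, of v w] by simp
  show "linear (\<lambda>x. f (a (v(i := x))))" if "i < k" for v i
    using linear_compose[OF alt_form_linear[OF a that] bounded_linear.linear[OF f]] by (simp add: o_def)
  show "f (a v) = 0" if "i < j \<and> j < k \<and> v i = v j" for v i j
    using that alt_form_repeat[OF a, of i j v] by (simp add: linear_0[OF bounded_linear.linear[OF f]])
qed

lemma alt_form_zero: "alt_form k (\<lambda>v. 0)"
  unfolding alt_form_def by (auto intro: linear_zero)

lemma alt_form_sum: "(\<And>j. j \<in> J \<Longrightarrow> alt_form k (a j)) \<Longrightarrow> alt_form k (\<lambda>v. \<Sum>j\<in>J. a j v)"
  by (induction J rule: infinite_finite_induct) (auto intro: alt_form_add alt_form_zero)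

lemma alt_form_2_linear:
  assumes "alt_form 2 a"
  shows "linear (\<lambda>x. a (pair_args x y))" "linear (\<lambda>y. a (pair_args x y))"
proof -
  have "linear (\<lambda>z. a ((pair_args x y)(0 := z)))" "linear (\<lambda>z. a ((pair_args x y)(1 := z)))" for x y
    using assms by (auto intro!: alt_form_linear)
  moreover have "a ((pair_args x y)(0 := z)) = a (pair_args z y)" for x y z
    by (rule alt_form_local[OF assms]) (auto simp: less_2_cases_iff)
  moreover have "a ((pair_args x y)(1 := z)) = a (pair_args x z)" for x y z
    by (rule alt_form_local[OF assms]) (auto simp: less_2_cases_iff)
  ultimately show "linear (\<lambda>x. a (pair_args x y))" "linear (\<lambda>y. a (pair_args x y))" by simp_all
qed

lemma alt_form_2_expand:
  fixes a :: "'v::euclidean_space ptform"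
  assumes a: "alt_form 2 a"
  shows "a (pair_args x y) = (\<Sum>i\<in>Basis. \<Sum>j\<in>Basis. ((x \<bullet> i) * (y \<bullet> j)) *\<^sub>R a (pair_args i j))"
proof -
  have "a (pair_args (\<Sum>i\<in>Basis. (x \<bullet> i) *\<^sub>R i) y) = (\<Sum>i\<in>Basis. (x \<bullet> i) *\<^sub>R a (pair_args i y))"
    by (simp only: linear_sum[OF alt_form_2_linear(1)[OF a]] linear_cmul[OF alt_form_2_linear(1)[OF a]])
  moreover have "a (pair_args i y) = (\<Sum>j\<in>Basis. (y \<bullet> j) *\<^sub>R a (pair_args i j))" for i
  proof -
    have "a (pair_args i (\<Sum>j\<in>Basis. (y \<bullet> j) *\<^sub>R j)) = (\<Sum>j\<in>Basis. (y \<bullet> j) *\<^sub>R a (pair_args i j))"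
      by (simp only: linear_sum[OF alt_form_2_linear(2)[OF a]] linear_cmul[OF alt_form_2_linear(2)[OF a]])
    then show ?thesis by (simp only: euclidean_representation)
  qed
  ultimately show ?thesis
    by (simp only: euclidean_representation scaleR_sum_right scaleR_scaleR)
qed

section \<open>Derivatives of families of alternating forms\<close>

lemma frechet_derivative_bounded_linear:
  assumes "bounded_linear L" "f differentiable (at x)"
  shows "frechet_derivative (\<lambda>x. L (f x)) (at x) u = L (frechet_derivative f (at x) u)"
proof -
  have "((\<lambda>x. L (f x)) has_derivative (\<lambda>u. L (frechet_derivative f (at x) u))) (at x)"
    using assms by (intro bounded_linear.has_derivative[OF assms(1)]) (simp add: frechet_derivative_works)
  then show ?thesis by (simp add: frechet_derivative_at[symmetric])
qed

lemma frechet_derivative_add: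
  assumes "f differentiable (at x)" "g differentiable (at x)"
  shows "frechet_derivative (\<lambda>x. f x + g x) (at x) u =
    frechet_derivative f (at x) u + frechet_derivative g (at x) u"
proof -
  have "((\<lambda>x. f x + g x) has_derivative
      (\<lambda>u. frechet_derivative f (at x) u + frechet_derivative g (at x) u)) (at x)"
    using assms by (intro has_derivative_add) (simp_all add: frechet_derivative_works)
  then show ?thesis by (simp add: frechet_derivative_at[symmetric])
qed

lemma alt_form_frechet_derivative:
  fixes b :: "'w::real_normed_vector \<Rightarrow> 'v::real_vector ptform"
  assumes S: "open S" "x \<in> S" and b: "\<And>y. y \<in> S \<Longrightarrow> alt_form k (b y)"
    and d: "\<And>w. (\<lambda>y. b y w) differentiable (at x)"
  shows "alt_form k (\<lambda>w. frechet_derivative (\<lambda>y. b y w) (at x) u)"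
  unfolding alt_form_def
proof (intro conjI allI impI)
  fix v w :: "nat \<Rightarrow> 'v" assume "\<forall>i<k. v i = w i"
  then show "frechet_derivative (\<lambda>y. b y v) (at x) u = frechet_derivative (\<lambda>y. b y w) (at x) u"
    by (intro fun_cong[OF differentiable_cong_open(2)[OF S]]) (auto intro: alt_form_local[OF b])
next
  fix v :: "nat \<Rightarrow> 'v" and i assume i: "i < k"
  show "linear (\<lambda>z. frechet_derivative (\<lambda>y. b y (v(i := z))) (at x) u)"
  proof (rule linearI)
    fix z z' :: 'v and r :: real
    have "frechet_derivative (\<lambda>y. b y (v(i := z + z'))) (at x) u =
          frechet_derivative (\<lambda>y. b y (v(i := z)) + b y (v(i := z'))) (at x) u"
      by (intro fun_cong[OF differentiable_cong_open(2)[OF S]])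
         (simp add: linear_add[OF alt_form_linear[OF b i]])
    then show "frechet_derivative (\<lambda>y. b y (v(i := z + z'))) (at x) u =
          frechet_derivative (\<lambda>y. b y (v(i := z))) (at x) u +
          frechet_derivative (\<lambda>y. b y (v(i := z'))) (at x) u"
      by (simp add: frechet_derivative_add d)
    have "frechet_derivative (\<lambda>y. b y (v(i := r *\<^sub>R z))) (at x) u =
          frechet_derivative (\<lambda>y. r *\<^sub>R b y (v(i := z))) (at x) u"
      by (intro fun_cong[OF differentiable_cong_open(2)[OF S]])
         (simp add: linear_cmul[OF alt_form_linear[OF b i]])
    then show "frechet_derivative (\<lambda>y. b y (v(i := r *\<^sub>R z))) (at x) u =
          r *\<^sub>R frechet_derivative (\<lambda>y. b y (v(i := z))) (at x) u"
      by (simp add: frechet_derivative_bounded_linear[OF bounded_linear_scaleR_right] d)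
  qed
next
  fix v :: "nat \<Rightarrow> 'v" and i j assume ij: "i < j \<and> j < k \<and> v i = v j"
  have "frechet_derivative (\<lambda>y. b y v) (at x) = frechet_derivative (\<lambda>y. 0) (at x)"
    by (rule differentiable_cong_open(2)[OF S]) (use alt_form_repeat[OF b, of _ i j v] ij in auto)
  then show "frechet_derivative (\<lambda>y. b y v) (at x) u = 0" by simp
qed

lemma frechet_derivative_wedge_pt:
  assumes a: "\<And>w. (\<lambda>y. a y w) differentiable (at x)" and b: "\<And>w. (\<lambda>y. b y w) differentiable (at x)"
  shows "frechet_derivative (\<lambda>y. wedge_pt k l (a y) (b y) w) (at x) u =
    wedge_pt k l (\<lambda>w. frechet_derivative (\<lambda>y. a y w) (at x) u) (b x) w +
    wedge_pt k l (a x) (\<lambda>w. frechet_derivative (\<lambda>y. b y w) (at x) u) w"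
proof -
  have "((\<lambda>y. wedge_pt k l (a y) (b y) w) has_derivative
     (\<lambda>u. wedge_pt k l (\<lambda>w. frechet_derivative (\<lambda>y. a y w) (at x) u) (b x) w +
       wedge_pt k l (a x) (\<lambda>w. frechet_derivative (\<lambda>y. b y w) (at x) u) w)) (at x)"
    (is "(_ has_derivative ?D) _")
  proof -
    have "((\<lambda>y. (\<Sum>\<sigma> | \<sigma> permutes {..<k + l}. of_int (sign \<sigma>) * a y (\<lambda>i. w (\<sigma> i)) * b y (\<lambda>i. w (\<sigma> (k +
        i)))) /
          (fact k * fact l)) has_derivative
        (\<lambda>u. (\<Sum>\<sigma> | \<sigma> permutes {..<k + l}.
          of_int (sign \<sigma>) * a x (\<lambda>i. w (\<sigma> i)) * frechet_derivative (\<lambda>y. b y (\<lambda>i. w (\<sigma> (k + i)))) (at x)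
          u +
          of_int (sign \<sigma>) * frechet_derivative (\<lambda>y. a y (\<lambda>i. w (\<sigma> i))) (at x) u * b x (\<lambda>i. w (\<sigma> (k +
          i)))) /
          (fact k * fact l))) (at x)"
      using a b
      by (intro bounded_linear.has_derivative[OF bounded_linear_divide] has_derivative_sum
          has_derivative_mult
          bounded_linear.has_derivative[OF bounded_linear_mult_right])
         (simp_all add: frechet_derivative_works)
    moreover have "(\<lambda>u. (\<Sum>\<sigma> | \<sigma> permutes {..<k + l}.
          of_int (sign \<sigma>) * a x (\<lambda>i. w (\<sigma> i)) * frechet_derivative (\<lambda>y. b y (\<lambda>i. w (\<sigma> (k + i)))) (at x)
          u +
          of_int (sign \<sigma>) * frechet_derivative (\<lambda>y. a y (\<lambda>i. w (\<sigma> i))) (at x) u * b x (\<lambda>i. w (\<sigma> (k +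
          i)))) /
          (fact k * fact l)) = ?D"
      by (simp add: wedge_pt_def sum.distrib add_divide_distrib add.commute)
    ultimately show ?thesis unfolding wedge_pt_def by simp
  qed
  then show ?thesis by (simp add: frechet_derivative_at[symmetric])
qed

text \<open>
  Product rule for a 2-form whose base point and both arguments move. Since a form is only known to
  be differentiable at constant arguments, it is first expanded in a basis.
\<close>

lemma has_derivative_alt_form_2:
  fixes b :: "'v::euclidean_space \<Rightarrow> 'v ptform" and T :: "'w::euclidean_space \<Rightarrow> 'v"
  assumes S: "open S" "x \<in> S" "\<And>y. y \<in> S \<Longrightarrow> T y \<in> S'" and S': "open S'"
    and b: "\<And>y. y \<in> S' \<Longrightarrow> alt_form 2 (b y)"
    and d: "\<And>w. (\<lambda>y. b y w) differentiable (at (T x))"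
    and T: "(T has_derivative T') (at x)" and X: "(X has_derivative X') (at x)"
        and Y: "(Y has_derivative Y') (at x)"
  shows "((\<lambda>y. b (T y) (pair_args (X y) (Y y))) has_derivative
    (\<lambda>u. frechet_derivative (\<lambda>y. b y (pair_args (X x) (Y x))) (at (T x)) (T' u) +
         b (T x) (pair_args (X' u) (Y x)) + b (T x) (pair_args (X x) (Y' u)))) (at x)"
proof -
  let ?D = "\<lambda>w u. frechet_derivative (\<lambda>y. b y w) (at (T x)) u"
  have Tx: "T x \<in> S'" using S by simp
  have D2: "alt_form 2 (\<lambda>w. ?D w u)" for u
    by (rule alt_form_frechet_derivative[OF S' Tx b d])
  have bT: "((\<lambda>y. b (T y) w) has_derivative (\<lambda>u. ?D w (T' u))) (at x)" for w
    using d by (intro has_derivative_compose[OF T]) (simp add: frechet_derivative_works)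
  have "((\<lambda>y. \<Sum>i\<in>Basis. \<Sum>j\<in>Basis. ((X y \<bullet> i) * (Y y \<bullet> j)) *\<^sub>R b (T y) (pair_args i j)) has_derivative
      (\<lambda>u. \<Sum>i\<in>Basis. \<Sum>j\<in>Basis. ((X x \<bullet> i) * (Y x \<bullet> j)) *\<^sub>R ?D (pair_args i j) (T' u) +
        ((X x \<bullet> i) * (Y' u \<bullet> j) + (X' u \<bullet> i) * (Y x \<bullet> j)) *\<^sub>R b (T x) (pair_args i j))) (at x)"
    by (intro has_derivative_sum has_derivative_scaleR has_derivative_mult has_derivative_inner_left X Y
        bT)
  moreover have "(\<lambda>u. \<Sum>i\<in>Basis. \<Sum>j\<in>Basis. ((X x \<bullet> i) * (Y x \<bullet> j)) *\<^sub>R ?D (pair_args i j) (T' u) +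
        ((X x \<bullet> i) * (Y' u \<bullet> j) + (X' u \<bullet> i) * (Y x \<bullet> j)) *\<^sub>R b (T x) (pair_args i j)) =
      (\<lambda>u. ?D (pair_args (X x) (Y x)) (T' u) +
         b (T x) (pair_args (X' u) (Y x)) + b (T x) (pair_args (X x) (Y' u)))"
  proof
    fix u
    show "(\<Sum>i\<in>Basis. \<Sum>j\<in>Basis. ((X x \<bullet> i) * (Y x \<bullet> j)) *\<^sub>R ?D (pair_args i j) (T' u) +
        ((X x \<bullet> i) * (Y' u \<bullet> j) + (X' u \<bullet> i) * (Y x \<bullet> j)) *\<^sub>R b (T x) (pair_args i j)) =
      ?D (pair_args (X x) (Y x)) (T' u) +
         b (T x) (pair_args (X' u) (Y x)) + b (T x) (pair_args (X x) (Y' u))"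
      unfolding alt_form_2_expand[OF D2, of "X x" "Y x"] alt_form_2_expand[OF b[OF Tx], of "X' u" "Y x"]
        alt_form_2_expand[OF b[OF Tx], of "X x" "Y' u"]
      by (simp add: sum.distrib scaleR_add_left add_ac)
  qed
  ultimately have "((\<lambda>y. \<Sum>i\<in>Basis. \<Sum>j\<in>Basis. ((X y \<bullet> i) * (Y y \<bullet> j)) *\<^sub>R b (T y) (pair_args i j))
      has_derivative
      (\<lambda>u. ?D (pair_args (X x) (Y x)) (T' u) +
         b (T x) (pair_args (X' u) (Y x)) + b (T x) (pair_args (X x) (Y' u)))) (at x)" by simp
  then show ?thesis
    by (rule has_derivative_transform_within_open[OF _ S(1,2)]) (rule alt_form_2_expand[OF b[OF S(3)],
        symmetric])
qed

section \<open>Differential forms on a manifold\<close>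

locale manifold6 =
  fixes X :: "'a topology" and A :: "'a chart set"
  assumes smooth_manifold6: "smooth_manifold6 X A"
begin

lemma is_chart: "c \<in> A \<Longrightarrow> is_chart X c"
  using smooth_manifold6 by (simp add: smooth_manifold6_def)

lemma open_chart_image: "c \<in> A \<Longrightarrow> open (chart_map c ` chart_dom c)"
  using is_chart by (simp add: is_chart_def)

lemma inj_on_chart: "c \<in> A \<Longrightarrow> inj_on (chart_map c) (chart_dom c)"
proof -
  assume c: "c \<in> A"
  then have "chart_dom c \<subseteq> topspace X"
    using is_chart openin_subset unfolding is_chart_def by blast
  moreover have "inj_on (chart_map c) (topspace (subtopology X (chart_dom c)))"
    using is_chart[OF c] unfolding is_chart_def by (blast intro: homeomorphic_imp_injective_map)
  ultimately show ?thesis by (simp add: topspace_subtopology Int_absorb1)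
qed

lemma chart_inv_chart_map [simp]: "c \<in> A \<Longrightarrow> p \<in> chart_dom c \<Longrightarrow> chart_inv c (chart_map c p) = p"
  by (simp add: chart_inv_def inj_on_chart inv_into_f_f)

lemma chart_map_chart_inv [simp]: "x \<in> chart_map c ` chart_dom c \<Longrightarrow> chart_map c (chart_inv c x) = x"
  by (simp add: chart_inv_def f_inv_into_f)

lemma chart_inv_in_dom [simp]: "x \<in> chart_map c ` chart_dom c \<Longrightarrow> chart_inv c x \<in> chart_dom c"
  by (simp add: chart_inv_def inv_into_into)

lemma open_overlap:
  assumes c: "c \<in> A" and c': "c' \<in> A"
  shows "open (chart_map c ` (chart_dom c \<inter> chart_dom c'))"
proof -
  have "openin X (chart_dom c \<inter> chart_dom c')"
    using is_chart[OF c] is_chart[OF c'] unfolding is_chart_def by blast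
  then have "openin (subtopology X (chart_dom c)) (chart_dom c \<inter> chart_dom c')"
    unfolding openin_subtopology by blast
  moreover have "open_map (subtopology X (chart_dom c)) (top_of_set (chart_map c ` chart_dom c))
      (chart_map c)"
    using is_chart[OF c] unfolding is_chart_def by (blast intro: homeomorphic_imp_open_map)
  ultimately have "openin (top_of_set (chart_map c ` chart_dom c))
      (chart_map c ` (chart_dom c \<inter> chart_dom c'))"
    unfolding open_map_def by blast
  then show ?thesis
    using open_chart_image[OF c] openin_open_trans by blast
qed

lemma smooth_on_transition:
  "c \<in> A \<Longrightarrow> c' \<in> A \<Longrightarrow> smooth_on (chart_map c ` (chart_dom c \<inter> chart_dom c')) (transition c c')"
  using smooth_manifold6 by (simp add: smooth_manifold6_def)

lemma linear_jacobian:
  assumes "c \<in> A" "c' \<in> A" "p \<in> chart_dom c" "p \<in> chart_dom c'"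
  shows "linear (jacobian c c' p)"
  unfolding jacobian_def
  by (rule linear_frechet_derivative, rule smooth_on_differentiable[OF smooth_on_transition])
      (use assms in auto)

lemma smooth_rep_const: "smooth_rep c (\<lambda>p. z)"
  by (simp add: smooth_rep_def smooth_on_const)

lemma smooth_rep_add: "c \<in> A \<Longrightarrow> smooth_rep c f \<Longrightarrow> smooth_rep c g \<Longrightarrow> smooth_rep c (\<lambda>p. f p + g p)"
  unfolding smooth_rep_def by (intro smooth_on_add open_chart_image)

lemma smooth_rep_mult:
  fixes f g :: "'a \<Rightarrow> 'b::real_normed_algebra"
  shows "c \<in> A \<Longrightarrow> smooth_rep c f \<Longrightarrow> smooth_rep c g \<Longrightarrow> smooth_rep c (\<lambda>p. f p * g p)"
  unfolding smooth_rep_def by (intro smooth_on_mult open_chart_image)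

lemma smooth_rep_sum:
  "c \<in> A \<Longrightarrow> (\<And>i. i \<in> I \<Longrightarrow> smooth_rep c (f i)) \<Longrightarrow> smooth_rep c (\<lambda>p. \<Sum>i\<in>I. f i p)"
  unfolding smooth_rep_def by (intro smooth_on_sum open_chart_image)

lemma smooth_rep_bounded_linear:
  "c \<in> A \<Longrightarrow> bounded_linear L \<Longrightarrow> smooth_rep c f \<Longrightarrow> smooth_rep c (\<lambda>p. L (f p))"
  unfolding smooth_rep_def by (rule smooth_on_bounded_linear[OF open_chart_image])

lemma diff_form_alt: "diff_form A k a \<Longrightarrow> c \<in> A \<Longrightarrow> p \<in> chart_dom c \<Longrightarrow> alt_form k (a c p)"
  by (simp add: diff_form_def)

lemma diff_form_smooth: "diff_form A k a \<Longrightarrow> c \<in> A \<Longrightarrow> smooth_rep c (\<lambda>p. a c p v)"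
  by (simp add: diff_form_def)

lemma diff_form_transform:
  "diff_form A k a \<Longrightarrow> c \<in> A \<Longrightarrow> c' \<in> A \<Longrightarrow> p \<in> chart_dom c \<Longrightarrow> p \<in> chart_dom c' \<Longrightarrow>
   a c p v = a c' p (\<lambda>i. jacobian c c' p (v i))"
  unfolding diff_form_def by blast

lemma diff_formI:
  assumes "\<And>c p. c \<in> A \<Longrightarrow> p \<in> chart_dom c \<Longrightarrow> alt_form k (a c p)"
    and "\<And>c v. c \<in> A \<Longrightarrow> smooth_rep c (\<lambda>p. a c p v)"
    and "\<And>c c' p v. c \<in> A \<Longrightarrow> c' \<in> A \<Longrightarrow> p \<in> chart_dom c \<Longrightarrow> p \<in> chart_dom c' \<Longrightarrow>
      a c p v = a c' p (\<lambda>i. jacobian c c' p (v i))"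
  shows "diff_form A k a"
  unfolding diff_form_def using assms by blast

lemma diff_form_add:
  assumes a: "diff_form A k a" and b: "diff_form A k b"
  shows "diff_form A k (a \<oplus>\<^sub>F b)"
  unfolding add_form_def
proof (rule diff_formI)
  show "alt_form k (\<lambda>v. a c p v + b c p v)" if "c \<in> A" "p \<in> chart_dom c" for c p
    by (rule alt_form_add[OF diff_form_alt[OF a that] diff_form_alt[OF b that]])
  show "smooth_rep c (\<lambda>p. a c p v + b c p v)" if "c \<in> A" for c v
    by (rule smooth_rep_add[OF that diff_form_smooth[OF a that] diff_form_smooth[OF b that]])
  show "a c p v + b c p v = a c' p (\<lambda>i. jacobian c c' p (v i)) + b c' p (\<lambda>i. jacobian c c' p (v i))"
    if "c \<in> A" "c' \<in> A" "p \<in> chart_dom c" "p \<in> chart_dom c'" for c c' p v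
    by (rule arg_cong2[OF diff_form_transform[OF a that] diff_form_transform[OF b that]])
qed

text \<open>
  Real-linear maps of the values cover complex scaling, conjugation, real and imaginary part at
  once.
\<close>

lemma diff_form_bounded_linear:
  assumes f: "bounded_linear f" and a: "diff_form A k a"
  shows "diff_form A k (\<lambda>c p v. f (a c p v))"
proof (rule diff_formI)
  show "alt_form k (\<lambda>v. f (a c p v))" if "c \<in> A" "p \<in> chart_dom c" for c p
    by (rule alt_form_bounded_linear[OF f diff_form_alt[OF a that]])
  show "smooth_rep c (\<lambda>p. f (a c p v))" if "c \<in> A" for c v
    by (rule smooth_rep_bounded_linear[OF that f diff_form_smooth[OF a that]])
  show "f (a c p v) = f (a c' p (\<lambda>i. jacobian c c' p (v i)))"
    if "c \<in> A" "c' \<in> A" "p \<in> chart_dom c" "p \<in> chart_dom c'" for c c' p v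
    using diff_form_transform[OF a that] by simp
qed

lemma diff_form_scale: "diff_form A k a \<Longrightarrow> diff_form A k (z \<odot>\<^sub>F a)"
  unfolding scale_form_def by (rule diff_form_bounded_linear[OF bounded_linear_mult_right])

lemma diff_form_cnj: "diff_form A k a \<Longrightarrow> diff_form A k (cnj_form a)"
  unfolding cnj_form_def by (rule diff_form_bounded_linear[OF bounded_linear_cnj])

lemma bounded_linear_of_real_Re: "bounded_linear (\<lambda>z. complex_of_real (Re z))"
  by (rule bounded_linear_compose[OF bounded_linear_of_real bounded_linear_Re])

lemma bounded_linear_of_real_Im: "bounded_linear (\<lambda>z. complex_of_real (Im z))"
  by (rule bounded_linear_compose[OF bounded_linear_of_real bounded_linear_Im])

lemma diff_form_Re: "diff_form A k a \<Longrightarrow> diff_form A k (Re_form a)"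
  unfolding Re_form_def by (rule diff_form_bounded_linear[OF bounded_linear_of_real_Re])

lemma diff_form_Im: "diff_form A k a \<Longrightarrow> diff_form A k (Im_form a)"
  unfolding Im_form_def by (rule diff_form_bounded_linear[OF bounded_linear_of_real_Im])

lemma diff_form_wedge:
  assumes a: "diff_form A k a" and b: "diff_form A l b"
  shows "diff_form A (k + l) (wedge k l a b)"
proof (rule diff_formI)
  fix c p assume "c \<in> A" "p \<in> chart_dom c"
  then show "alt_form (k + l) (wedge k l a b c p)"
    unfolding wedge_def using a b by (intro wedge_pt_alt_form diff_form_alt)
next
  fix c v assume c: "c \<in> A"
  show "smooth_rep c (\<lambda>p. wedge k l a b c p v)"
    unfolding wedge_def wedge_pt_def divide_inverse
    by (rule smooth_rep_mult smooth_rep_sum smooth_rep_const c diff_form_smooth[OF a c]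
        diff_form_smooth[OF b c])+
next
  fix c c' p v assume c: "c \<in> A" "c' \<in> A" "p \<in> chart_dom c" "p \<in> chart_dom c'"
  show "wedge k l a b c p v = wedge k l a b c' p (\<lambda>i. jacobian c c' p (v i))"
    unfolding wedge_def wedge_pt_def
    by (simp only: diff_form_transform[OF a c] diff_form_transform[OF b c])
qed


section \<open>The exterior derivative\<close>

lemma ext_d_cong:
  assumes ab: "eq_on A a b"
  shows "eq_on A (ext_d k a) (ext_d k b)"
  unfolding eq_on_def
proof (intro ballI)
  fix c p assume c: "c \<in> A" and p: "p \<in> chart_dom c"
  have "frechet_derivative (\<lambda>x. a c (chart_inv c x) w) (at (chart_map c p)) =
        frechet_derivative (\<lambda>x. b c (chart_inv c x) w) (at (chart_map c p))" for w
    by (rule differentiable_cong_open(2)[OF open_chart_image[OF c]]) (use ab c p in \<open>auto simp: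
        eq_on_def\<close>)
  then show "ext_d k a c p = ext_d k b c p" by (simp add: ext_d_def)
qed

lemma diff_form_differentiable:
  assumes "diff_form A k a" "c \<in> A" "p \<in> chart_dom c"
  shows "(\<lambda>x. a c (chart_inv c x) w) differentiable (at (chart_map c p))"
  using diff_form_smooth[OF assms(1,2), of w] assms(3)
  by (auto simp: smooth_rep_def intro: smooth_on_differentiable)

lemma ext_d_bounded_linear:
  assumes "bounded_linear f" "diff_form A k a"
  shows "eq_on A (ext_d k (\<lambda>c p v. f (a c p v))) (\<lambda>c p v. f (ext_d k a c p v))"
proof -
  interpret f: bounded_linear f by fact
  have "f ((- 1) ^ i * z) = (- 1) ^ i * f z" for i z
    by (cases "even i") (simp_all add: linear_neg[OF bounded_linear.linear[OF assms(1)]])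
  then show ?thesis
    using assms by (simp add: eq_on_def ext_d_def f.sum diff_form_differentiable
        frechet_derivative_bounded_linear[OF assms(1)])
qed

lemma ext_d_add:
  assumes "diff_form A k a" "diff_form A k b"
  shows "eq_on A (ext_d k (a \<oplus>\<^sub>F b)) (ext_d k a \<oplus>\<^sub>F ext_d k b)"
  using assms
    by (simp add: eq_on_def ext_d_def add_form_def frechet_derivative_add diff_form_differentiable
      distrib_left sum.distrib)

lemma ext_d_scale: "diff_form A k a \<Longrightarrow> eq_on A (ext_d k (z \<odot>\<^sub>F a)) (z \<odot>\<^sub>F ext_d k a)"
  unfolding scale_form_def by (rule ext_d_bounded_linear[OF bounded_linear_mult_right])

text \<open>
  The derivative of the coordinate representative in a fixed chart. It is not a tensor, but at each
  point it is again an alternating form, which is all that the Leibniz rule needs.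
\<close>

definition partial :: "'a form \<Rightarrow> 'a chart \<Rightarrow> 'a \<Rightarrow> real^6 \<Rightarrow> (real^6) ptform" where
  "partial a c p u w = frechet_derivative (\<lambda>x. a c (chart_inv c x) w) (at (chart_map c p)) u"

definition covector :: "real^6 \<Rightarrow> (real^6) ptform" where
  "covector e v = complex_of_real (v 0 \<bullet> e)"

lemma alt_form_covector: "alt_form 1 (covector e)"
  unfolding alt_form_def covector_def by (auto intro!: linearI simp: inner_add_left
      scaleR_conv_of_real[where 'a = complex])

lemma alt_form_partial:
  assumes a: "diff_form A k a" and c: "c \<in> A" "p \<in> chart_dom c"
  shows "alt_form k (partial a c p u)"
  unfolding partial_def[abs_def]
  by (rule alt_form_frechet_derivative[OF open_chart_image[OF c(1)]])
     (use c diff_form_alt[OF a] diff_form_differentiable[OF a c] in auto)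

text \<open>
  The alternating sum that defines \<open>d\<close> is the expansion of a wedge product with a 1-form. Thus \<open>d\<close>
  is \<open>\<Sum> e \<and> \<partial>\<^sub>e\<close>, and its properties reduce to those of the wedge product.
\<close>

lemma ext_d_eq_sum_wedge:
  assumes a: "diff_form A k a" and c: "c \<in> A" "p \<in> chart_dom c"
  shows "ext_d k a c p = (\<lambda>v. \<Sum>e\<in>Basis. wedge_pt 1 k (covector e) (partial a c p e) v)"
proof
  fix v
  have lin: "linear (\<lambda>u. partial a c p u w)" for w
    unfolding partial_def by (rule linear_frechet_derivative[OF diff_form_differentiable[OF a c]])
  have exp: "partial a c p u w = (\<Sum>e\<in>Basis. complex_of_real (u \<bullet> e) * partial a c p e w)" for u w
  proof -
    have "partial a c p u w = partial a c p (\<Sum>e\<in>Basis. (u \<bullet> e) *\<^sub>R e) w"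
      by (simp add: euclidean_representation)
    then show ?thesis
      by (simp add: linear_sum[OF lin] linear_cmul[OF lin] scaleR_conv_of_real[where 'a = complex])
  qed
  have "ext_d k a c p v = (\<Sum>i\<le>k. (- 1) ^ i * partial a c p (v i) (omit_arg i v))"
    by (simp add: ext_d_def partial_def)
  also have "\<dots> = (\<Sum>i\<le>k. \<Sum>e\<in>Basis. (- 1) ^ i * covector e (\<lambda>_. v i) * partial a c p e (omit_arg i v))"
    by (subst exp) (simp add: sum_distrib_left covector_def mult.assoc)
  also have "\<dots> = (\<Sum>e\<in>Basis. wedge_pt 1 k (covector e) (partial a c p e) v)"
    unfolding wedge_pt_1_left[OF alt_form_covector alt_form_partial[OF a c]] by (rule sum.swap)
  finally show "ext_d k a c p v = (\<Sum>e\<in>Basis. wedge_pt 1 k (covector e) (partial a c p e) v)" .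
qed

lemma alt_form_ext_d:
  assumes a: "diff_form A k a" and c: "c \<in> A" "p \<in> chart_dom c"
  shows "alt_form (Suc k) (ext_d k a c p)"
  unfolding ext_d_eq_sum_wedge[OF assms] plus_1_eq_Suc[symmetric]
  by (rule alt_form_sum[OF wedge_pt_alt_form[OF alt_form_covector alt_form_partial[OF assms]]])

text \<open>
  Apply \<open>\<Sum> e \<and> \<partial>\<^sub>e\<close> to the product: \<open>\<partial>\<^sub>e\<close> obeys the product rule, and moving \<open>e\<close> past the \<open>k\<close>-form \<open>a\<close>
  costs \<open>(- 1) ^ k\<close>.
\<close>

lemma ext_d_wedge:
  assumes a: "diff_form A k a" and b: "diff_form A l b"
  shows "eq_on A (ext_d (k + l) (wedge k l a b))
    (wedge (Suc k) l (ext_d k a) b \<oplus>\<^sub>F (- 1) ^ k \<odot>\<^sub>F wedge k (Suc l) a (ext_d l b))"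
  unfolding eq_on_def
proof (intro ballI)
  fix c p assume c: "c \<in> A" "p \<in> chart_dom c"
  let ?a = "a c p" and ?b = "b c p" and ?da = "partial a c p" and ?db = "partial b c p"
  note alts =
      diff_form_alt[OF a c] diff_form_alt[OF b c] alt_form_partial[OF a c] alt_form_partial[OF b c]
    alt_form_covector
  have part: "partial (wedge k l a b) c p e = (\<lambda>w. wedge_pt k l (?da e) ?b w +
      wedge_pt k l ?a (?db e) w)" for e
    using c frechet_derivative_wedge_pt[where a = "\<lambda>y. a c (chart_inv c y)" and b =
        "\<lambda>y. b c (chart_inv c y)",
        OF diff_form_differentiable[OF a c] diff_form_differentiable[OF b c]]
    by (simp add: partial_def[abs_def] wedge_def)
  have first: "wedge_pt 1 (k + l) (covector e) (wedge_pt k l (?da e) ?b) =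
      wedge_pt (Suc k) l (wedge_pt 1 k (covector e) (?da e)) ?b" for e
    using wedge_pt_assoc[OF alts(5,3,2)] by (simp add: fun_eq_iff)
  have second: "wedge_pt 1 (k + l) (covector e) (wedge_pt k l ?a (?db e)) =
      (\<lambda>v. (- 1) ^ k * wedge_pt k (Suc l) ?a (wedge_pt 1 l (covector e) (?db e)) v)" for e
  proof
    fix v
    have "wedge_pt 1 (k + l) (covector e) (wedge_pt k l ?a (?db e)) v =
        wedge_pt (1 + k) l (wedge_pt 1 k (covector e) ?a) (?db e) v"
      by (rule wedge_pt_assoc[OF alts(5,1,4)])
    also have "wedge_pt 1 k (covector e) ?a = (\<lambda>v. (- 1) ^ k * wedge_pt k 1 ?a (covector e) v)"
      using wedge_pt_commute[OF alts(5,1)] by (simp add: fun_eq_iff)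
    also have "wedge_pt (1 + k) l (\<lambda>v. (- 1) ^ k * wedge_pt k 1 ?a (covector e) v) (?db e) v =
        (- 1) ^ k * wedge_pt k (1 + l) ?a (wedge_pt 1 l (covector e) (?db e)) v"
      using wedge_pt_assoc[OF alts(1,5,4), where v = v] by (simp add: wedge_pt_scale_left)
    finally show "wedge_pt 1 (k + l) (covector e) (wedge_pt k l ?a (?db e)) v =
        (- 1) ^ k * wedge_pt k (Suc l) ?a (wedge_pt 1 l (covector e) (?db e)) v" by simp
  qed
  have "ext_d (k + l) (wedge k l a b) c p =
      (\<lambda>v. \<Sum>e\<in>Basis. wedge_pt (Suc k) l (wedge_pt 1 k (covector e) (?da e)) ?b v +
         (- 1) ^ k * wedge_pt k (Suc l) ?a (wedge_pt 1 l (covector e) (?db e)) v)"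
    unfolding ext_d_eq_sum_wedge[OF diff_form_wedge[OF a b] c] part wedge_pt_add_right first second ..
  also have "\<dots> = (\<lambda>v. wedge_pt (Suc k) l (ext_d k a c p) ?b v +
      (- 1) ^ k * wedge_pt k (Suc l) ?a (ext_d l b c p) v)"
    unfolding ext_d_eq_sum_wedge[OF a c] ext_d_eq_sum_wedge[OF b c] wedge_pt_sum_left wedge_pt_sum_right
    by (simp add: sum.distrib sum_distrib_left)
  finally show "ext_d (k + l) (wedge k l a b) c p =
      (wedge (Suc k) l (ext_d k a) b \<oplus>\<^sub>F (- 1) ^ k \<odot>\<^sub>F wedge k (Suc l) a (ext_d l b)) c p"
    by (simp add: add_form_def scale_form_def wedge_def)
qed

lemma transition_image: 
  assumes c: "c \<in> A" "c' \<in> A" and x: "x \<in> chart_map c ` (chart_dom c \<inter> chart_dom c')"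
  shows "chart_inv c x \<in> chart_dom c \<inter> chart_dom c'" "chart_map c (chart_inv c x) = x"
    "chart_map c' (chart_inv c x) = transition c c' x" "chart_inv c' (transition c c' x) = chart_inv c x"
    "transition c c' x \<in> chart_map c' ` chart_dom c'"
  using assms by (auto simp: transition_def)

text \<open>
  Differentiating the transformation law gives the tensorial term and two terms with the second
  derivative \<open>H\<close> of the transition map.
\<close>

lemma partial_transform:
  assumes a: "diff_form A 2 a" and c: "c \<in> A" "c' \<in> A" and p: "p \<in> chart_dom c" "p \<in> chart_dom c'"
  defines "J \<equiv> jacobian c c' p"
    and "H \<equiv> \<lambda>u w. frechet_derivative (\<lambda>x. frechet_derivative (transition c c') (at x) w)
        (at (chart_map c p)) u"
  shows "partial a c p u (pair_args v w) = partial a c' p (J u) (pair_args (J v) (J w)) +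
    a c' p (pair_args (H u v) (J w)) + a c' p (pair_args (J v) (H u w))"
proof -
  let ?T = "transition c c'" and ?x = "chart_map c p" and ?S =
      "chart_map c ` (chart_dom c \<inter> chart_dom c')"
  let ?S' = "chart_map c' ` chart_dom c'"
  have x: "?x \<in> ?S" using p by auto
  have Tx: "?T ?x = chart_map c' p" using c p by (simp add: transition_def)
  note sT = smooth_on_transition[OF c]
  have DT: "(?T has_derivative J) (at ?x)"
    unfolding J_def jacobian_def frechet_derivative_works[symmetric]
      by (rule smooth_on_differentiable[OF sT x])
  have DDT: "((\<lambda>x. frechet_derivative ?T (at x) w) has_derivative (\<lambda>u. H u w)) (at ?x)" for w
    unfolding H_def frechet_derivative_works[symmetric]
    by (rule smooth_on_differentiable[OF smooth_on_frechet_derivative[OF sT] x])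
  have JJ: "frechet_derivative ?T (at ?x) = J" by (simp add: J_def jacobian_def)
  have "((\<lambda>x. a c' (chart_inv c' (?T x)) (pair_args (frechet_derivative ?T (at x) v)
      (frechet_derivative ?T (at x) w)))
      has_derivative (\<lambda>u. partial a c' p (J u) (pair_args (J v) (J w)) +
        a c' p (pair_args (H u v) (J w)) + a c' p (pair_args (J v) (H u w)))) (at ?x)"
    (is "(?f has_derivative ?D) _")
    using has_derivative_alt_form_2[OF open_overlap[OF c] x _ open_chart_image[OF c(2)],
        of ?T "\<lambda>y. a c' (chart_inv c' y)",
        OF _ _ _ DT DDT[of v] DDT[of w]]
      transition_image(5)[OF c] diff_form_alt[OF a c(2)] diff_form_differentiable[OF a c(2) p(2)]
    by (simp add: Tx JJ partial_def c p)
  moreover have "frechet_derivative (\<lambda>x. a c (chart_inv c x) (pair_args v w)) (at ?x) =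
      frechet_derivative ?f (at ?x)"
  proof (rule differentiable_cong_open(2)[OF open_overlap[OF c] x])
    fix y assume y: "y \<in> ?S"
    note t = transition_image[OF c y]
    have "a c (chart_inv c y) (pair_args v w) =
        a c' (chart_inv c y) (\<lambda>i. jacobian c c' (chart_inv c y) (pair_args v w i))"
      using t by (intro diff_form_transform[OF a c]) auto
    also have "(\<lambda>i. jacobian c c' (chart_inv c y) (pair_args v w i)) =
        pair_args (frechet_derivative ?T (at y) v) (frechet_derivative ?T (at y) w)"
      using t by (auto simp: jacobian_def fun_eq_iff split: nat.split)
    finally show "a c (chart_inv c y) (pair_args v w) = ?f y" using t by simp
  qed
  ultimately show ?thesis
    by (simp add: partial_def frechet_derivative_at[symmetric])
qed

text \<open>
  In the alternating sum over \<open>partial_transform\<close> the terms with the second derivative \<open>H\<close> of the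
  transition map cancel in pairs, because \<open>H\<close> is symmetric and the form is alternating.
\<close>

lemma diff_form_ext_d_2:
  assumes a: "diff_form A 2 a"
  shows "diff_form A 3 (ext_d 2 a)"
proof (rule diff_formI)
  fix c p assume c: "c \<in> A" "p \<in> chart_dom c"
  show "alt_form 3 (ext_d 2 a c p)"
    using alt_form_ext_d[OF a c] by (simp add: numeral_3_eq_3)
next
  fix c v assume c: "c \<in> A"
  show "smooth_rep c (\<lambda>p. ext_d 2 a c p v)"
    unfolding ext_d_def
  proof (intro smooth_rep_sum smooth_rep_mult smooth_rep_const c)
    fix i
    let ?f = "\<lambda>x. a c (chart_inv c x) (omit_arg i v)"
    have "smooth_on (chart_map c ` chart_dom c) (\<lambda>x. frechet_derivative ?f (at x) (v i))"
      using diff_form_smooth[OF a c] by (intro smooth_on_frechet_derivative) (simp add: smooth_rep_def)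
    then show "smooth_rep c (\<lambda>p. frechet_derivative ?f (at (chart_map c p)) (v i))"
      unfolding smooth_rep_def by (subst smooth_on_cong[OF open_chart_image[OF c]]) auto
  qed
next
  fix c c' p v assume c: "c \<in> A" "c' \<in> A" and p: "p \<in> chart_dom c" "p \<in> chart_dom c'"
  define J where "J = jacobian c c' p"
  define H where "H u w =
  frechet_derivative (\<lambda>x. frechet_derivative (transition c c') (at x) w) (at (chart_map c p)) u" for u w
  have H: "H u w = H w u" for u w
    unfolding H_def
    by (rule symmetric_second_derivative[OF open_overlap[OF c]])
       (use p smooth_on_transition[OF c] in \<open>auto simp: smooth_on_def\<close>)
  have ext: "ext_d 2 a c p v = partial a c p (v 0) (pair_args (v 1) (v 2)) -
      partial a c p (v 1) (pair_args (v 0) (v 2)) +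
      partial a c p (v 2) (pair_args (v 0) (v 1))" if c: "c \<in> A" "p \<in> chart_dom c" for c v
  proof -
    have P: "partial a c p u (omit_arg i v) =
        partial a c p u (pair_args (omit_arg i v 0) (omit_arg i v 1))" for u i
      by (rule alt_form_2_pair[OF alt_form_partial[OF a c]])
    have "ext_d 2 a c p v = (\<Sum>i\<le>2. (- 1) ^ i * partial a c p (v i) (omit_arg i v))"
      by (simp add: ext_d_def partial_def)
    then show ?thesis unfolding P by (simp add: numeral_2_eq_2)
  qed
  note tr = partial_transform[OF a c p, folded J_def H_def]
  let ?B = "\<lambda>x y. a c' p (pair_args x y)"
  have flip: "?B y x = - ?B x y" for x y by (rule alt_form_2_flip[OF diff_form_alt[OF a c(2) p(2)]])
  show "ext_d 2 a c p v = ext_d 2 a c' p (\<lambda>i. jacobian c c' p (v i))"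
    unfolding ext[OF c(1) p(1)] ext[OF c(2) p(2)] tr J_def[symmetric]
    using H[of "v 1" "v 0"] H[of "v 2" "v 0"] H[of "v 2" "v 1"] flip[of "J (v 1)" "H (v 0) (v 2)"]
      flip[of "J (v 0)" "H (v 1) (v 2)"] flip[of "J (v 2)" "H (v 0) (v 1)"]
    by simp
qed

end


section \<open>Linear algebra of an inner product\<close>

lemma linear_functional_expand:
  fixes f :: "'v::euclidean_space \<Rightarrow> real"
  assumes "linear f"
  shows "f y = (\<Sum>i\<in>Basis. (y \<bullet> i) * f i)"
proof -
  have "f y = f (\<Sum>i\<in>Basis. (y \<bullet> i) *\<^sub>R i)" by (simp add: euclidean_representation)
  also have "\<dots> = (\<Sum>i\<in>Basis. (y \<bullet> i) * f i)"
    by (simp only: linear_sum[OF assms] linear_cmul[OF assms] real_scaleR_def)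
  finally show ?thesis .
qed

locale inner_product_at =
  fixes g :: "'v::euclidean_space \<Rightarrow> 'v \<Rightarrow> real"
  assumes bil: "bilinear g" and sym: "g x y = g y x" and pos: "x \<noteq> 0 \<Longrightarrow> g x x > 0"
begin

lemma g_linear: "linear (\<lambda>x. g x y)" "linear (\<lambda>y. g x y)"
  using bil by (auto simp: bilinear_def)

lemmas g_left = linear_add[OF g_linear(1)] linear_diff[OF g_linear(1)] linear_neg[OF g_linear(1)]
  linear_cmul[OF g_linear(1)] linear_0[OF g_linear(1)]
lemmas g_right = linear_add[OF g_linear(2)] linear_diff[OF g_linear(2)] linear_neg[OF g_linear(2)]
  linear_cmul[OF g_linear(2)] linear_0[OF g_linear(2)]

lemma g_eq: "(\<And>y. g x y = g x' y) \<Longrightarrow> x = x'"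
  using pos[of "x - x'"] by (auto simp: g_left)

lemma sharp_eqI: "(\<And>y. g x y = a y) \<Longrightarrow> sharp g a = x"
  unfolding sharp_def by (rule the_equality) (auto intro: g_eq)

text \<open>
  Positivity makes \<open>x \<mapsto> g x\<close> injective, hence by dimension surjective onto the linear forms, which are
  identified here with vectors through the standard basis.
\<close>

lemma sharp_works:
  assumes a: "linear a"
  shows "g (sharp g a) y = a y"
proof -
  let ?\<phi> = "\<lambda>x. \<Sum>i\<in>Basis. g x i *\<^sub>R i"
  note expand = linear_functional_expand
  have \<phi>: "?\<phi> x \<bullet> i = g x i" if "i \<in> Basis" for x i
    using that by (simp add: inner_sum_left inner_Basis if_distrib cong: if_cong)
  have "linear ?\<phi>"
    by (rule linearI) (simp_all add: g_left scaleR_add_left sum.distrib scaleR_sum_right)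
  moreover have "inj ?\<phi>"
  proof (rule injI)
    fix x x' assume "?\<phi> x = ?\<phi> x'"
    then have eq: "g x i = g x' i" if "i \<in> Basis" for i
      using \<phi>[OF that, of x] \<phi>[OF that, of x'] by simp
    have "g x y = g x' y" for y
      unfolding expand[OF g_linear(2), of x y] expand[OF g_linear(2), of x' y]
      by (rule sum.cong) (simp_all add: eq)
    then show "x = x'" by (rule g_eq)
  qed
  ultimately have "surj ?\<phi>" by (rule linear_injective_imp_surjective) simp
  from surjD[OF this, of "\<Sum>i\<in>Basis. a i *\<^sub>R i"]
  obtain x where x: "?\<phi> x = (\<Sum>i\<in>Basis. a i *\<^sub>R i)" by (elim exE) (rule that, rule HOL.sym)
  have eq: "g x i = a i" if "i \<in> Basis" for i
    using \<phi>[OF that, of x] that unfolding x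
      by (simp add: inner_sum_left inner_Basis if_distrib cong: if_cong)
  have "g x y = a y" for y
    unfolding expand[OF g_linear(2), of x y] expand[OF a, of y]
    by (rule sum.cong) (simp_all add: eq)
  moreover from this have "sharp g a = x" by (rule sharp_eqI)
  ultimately show ?thesis by simp
qed

lemma linear_sharp:
  assumes "bilinear B"
  shows "linear (\<lambda>x. sharp g (B x))"
proof -
  note B = assms[unfolded bilinear_def, THEN conjunct1, rule_format]
    assms[unfolded bilinear_def, THEN conjunct2, rule_format]
  show ?thesis
  proof (rule linearI; rule sharp_eqI)
    show "g (sharp g (B x) + sharp g (B x')) y = B (x + x') y" for x x' y
      unfolding g_left sharp_works[OF B(1)] by (rule linear_add[OF B(2), symmetric])
    show "g (r *\<^sub>R sharp g (B x)) y = B (r *\<^sub>R x) y" for r x y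
      unfolding g_left sharp_works[OF B(1)] by (rule linear_cmul[OF B(2), symmetric])
  qed
qed

end

text \<open>
  Each functional is the Euclidean product with some vector, and four vectors do not span a space of
  dimension greater than four.
\<close>

lemma common_kernel_4:
  fixes p q r s :: "'v::euclidean_space \<Rightarrow> real"
  assumes dim: "DIM('v) > 4" and lin: "linear p" "linear q" "linear r" "linear s"
  obtains y where "y \<noteq> 0" "p y = 0" "q y = 0" "r y = 0" "s y = 0"
proof -
  define d where "d f = (\<Sum>i\<in>Basis. f i *\<^sub>R i)" for f :: "'v \<Rightarrow> real"
  have d: "f y = y \<bullet> d f" if "linear f" for f y
    using linear_functional_expand[OF that, of y] by (simp add: d_def inner_sum_right mult.commute)
  have "dim {d p, d q, d r, d s} \<le> card {d p, d q, d r, d s}"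
    by (rule dim_le_card) (auto intro: span_base)
  also have "\<dots> \<le> 4" by (simp add: card_insert_if)
  finally obtain y where "y \<noteq> 0" and y: "\<And>x. x \<in> span {d p, d q, d r, d s} \<Longrightarrow> orthogonal y x"
    using dim orthogonal_to_subspace_exists[of "{d p, d q, d r, d s}"] by auto
  moreover have "y \<bullet> x = 0" if "x \<in> {d p, d q, d r, d s}" for x
    using y[OF span_base[OF that]] by (simp only: orthogonal_def)
  ultimately show ?thesis
    by (intro that[of y]) (simp_all add: d lin)
qed


section \<open>SU(2) structures at a point\<close>

text \<open>
  The conditions of an \<open>SU(2)\<close> structure at a single point, in the order of the definition on a
  manifold. Only the smoothness and the transformation behaviour of the fields are left out.
\<close>

definition SU2_at ::
  "('v::euclidean_space \<Rightarrow> 'v) \<Rightarrow> ('v \<Rightarrow> 'v \<Rightarrow> real) \<Rightarrow> 'v ptform \<Rightarrow> 'v ptform \<Rightarrow> 'v ptform \<Rightarrow> bool" where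
  "SU2_at J g \<alpha> \<omega> \<Omega> \<longleftrightarrow>
     bilinear g \<and> (\<forall>x y. g x y = g y x) \<and> (\<forall>x. x \<noteq> 0 \<longrightarrow> g x x > 0) \<and>
     linear J \<and> (\<forall>x. J (J x) = - x) \<and> (\<forall>x y. g (J x) (J y) = g x y) \<and>
     alt_form 1 \<alpha> \<and> (\<forall>v. \<forall>j<1. \<alpha> v + \<i> * \<alpha> (v(j := J (v j))) = 0) \<and>
     (\<forall>v. \<alpha> (case_nat (sharp g (\<lambda>y. Re (cnj (\<alpha> (\<lambda>_. y))))) v) +
       \<i> * \<alpha> (case_nat (sharp g (\<lambda>y. Im (cnj (\<alpha> (\<lambda>_. y))))) v) = 2) \<and>
     alt_form 2 \<omega> \<and> (\<forall>v. \<omega> v \<in> \<real>) \<and>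
     alt_form 2 \<Omega> \<and> (\<forall>v. \<forall>j<2. \<Omega> v + \<i> * \<Omega> (v(j := J (v j))) = 0) \<and>
     wedge_pt 2 2 \<omega> \<omega> = (\<lambda>v. 1 / 2 * wedge_pt 2 2 \<Omega> (\<lambda>v. cnj (\<Omega> v)) v) \<and>
     (\<exists>v. wedge_pt 2 2 \<omega> \<omega> v \<noteq> 0) \<and>
     wedge_pt 2 2 \<omega> \<Omega> = (\<lambda>v. 0) \<and>
     wedge_pt 2 2 \<Omega> \<Omega> = (\<lambda>v. 0) \<and>
     (\<forall>v. \<Omega> (case_nat (sharp g (\<lambda>y. Re (\<alpha> (\<lambda>_. y)))) v) +
       \<i> * \<Omega> (case_nat (sharp g (\<lambda>y. Im (\<alpha> (\<lambda>_. y)))) v) = 0) \<and>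
     (\<forall>v. \<omega> (case_nat (sharp g (\<lambda>y. Re (\<alpha> (\<lambda>_. y)))) v) +
       \<i> * \<omega> (case_nat (sharp g (\<lambda>y. Im (\<alpha> (\<lambda>_. y)))) v) = 0) \<and>
     (\<forall>v. \<omega> v + \<i> / 2 * wedge_pt 1 1 \<alpha> (\<lambda>v. cnj (\<alpha> v)) v = complex_of_real (g (J (v 0)) (v 1)))"

lemma wedge_pt_1_1:
  assumes a: "alt_form 1 a" and b: "alt_form 1 b"
  shows "wedge_pt 1 1 a b v = a (\<lambda>_. v 0) * b (\<lambda>_. v 1) - a (\<lambda>_. v 1) * b (\<lambda>_. v 0)"
proof -
  have "b (omit_arg i v) = b (\<lambda>_. omit_arg i v 0)" for i
    by (rule alt_form_local[OF b]) simp
  then show ?thesis unfolding wedge_pt_1_left[OF a b] by simp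
qed

text \<open>
  The dimension enters only in \<open>orthogonal_exists\<close>: there has to be room for a vector orthogonal to
  the span of \<open>e\<close>, \<open>f\<close>, \<open>x\<close> and \<open>J x\<close>.
\<close>

locale SU2_point =
  fixes J :: "'v::euclidean_space \<Rightarrow> 'v" and g and \<alpha> \<omega> \<Omega>
  assumes SU2: "SU2_at J g \<alpha> \<omega> \<Omega>" and dim: "DIM('v) > 4"
begin

lemma conditions:
  "bilinear g" "\<forall>x y. g x y = g y x" "\<forall>x. x \<noteq> 0 \<longrightarrow> g x x > 0"
  "linear J" "\<forall>x. J (J x) = - x" "\<forall>x y. g (J x) (J y) = g x y"
  "alt_form 1 \<alpha>" "\<forall>v. \<forall>j<1. \<alpha> v + \<i> * \<alpha> (v(j := J (v j))) = 0"
  "\<forall>v. \<alpha> (case_nat (sharp g (\<lambda>y. Re (cnj (\<alpha> (\<lambda>_. y))))) v) +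
     \<i> * \<alpha> (case_nat (sharp g (\<lambda>y. Im (cnj (\<alpha> (\<lambda>_. y))))) v) = 2"
  "alt_form 2 \<omega>" "alt_form 2 \<Omega>" "\<forall>v. \<forall>j<2. \<Omega> v + \<i> * \<Omega> (v(j := J (v j))) = 0"
  "wedge_pt 2 2 \<omega> \<omega> = (\<lambda>v. 1 / 2 * wedge_pt 2 2 \<Omega> (\<lambda>v. cnj (\<Omega> v)) v)"
  "\<exists>v. wedge_pt 2 2 \<omega> \<omega> v \<noteq> 0"
  "wedge_pt 2 2 \<omega> \<Omega> = (\<lambda>v. 0)" "wedge_pt 2 2 \<Omega> \<Omega> = (\<lambda>v. 0)"
  "\<forall>v. \<omega> v + \<i> / 2 * wedge_pt 1 1 \<alpha> (\<lambda>v. cnj (\<alpha> v)) v = complex_of_real (g (J (v 0)) (v 1))"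
  "\<forall>v. \<omega> v \<in> \<real>"
  "\<forall>v. \<Omega> (case_nat (sharp g (\<lambda>y. Re (\<alpha> (\<lambda>_. y)))) v) +
     \<i> * \<Omega> (case_nat (sharp g (\<lambda>y. Im (\<alpha> (\<lambda>_. y)))) v) = 0"
  "\<forall>v. \<omega> (case_nat (sharp g (\<lambda>y. Re (\<alpha> (\<lambda>_. y)))) v) +
     \<i> * \<omega> (case_nat (sharp g (\<lambda>y. Im (\<alpha> (\<lambda>_. y)))) v) = 0"
  using SU2 unfolding SU2_at_def by - (elim conjE, assumption)+

sublocale inner_product_at g
  by unfold_locales (fact conditions(1), rule conditions(2)[rule_format], rule conditions(3)[rule_format])

lemmas J = conditions(4) conditions(5,6)[rule_format]
lemmas alt = conditions(7,10,11)
lemmas wedges = conditions(13-16)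
lemmas fundamental = conditions(17)[rule_format]

text \<open>
  Here \<open>\<alpha> = a + i b\<close> has the dual frame \<open>e\<close>, \<open>f\<close>; \<open>h\<close> is the metric on the orthogonal 4-plane,
  extended by zero to \<open>e\<close> and \<open>f\<close>; \<open>R\<close> and \<open>I\<close> are the real and imaginary parts of \<open>\<Omega>\<close>; and \<open>K\<close> is
  the endomorphism with \<open>g(K x, y) = R(x, y)\<close>. On the 4-plane \<open>J\<close>, \<open>K\<close> and \<open>J K\<close> turn out to be the
  three complex structures of a hyperkaehler triple.
\<close>

definition a where "a x = Re (\<alpha> (\<lambda>_. x))"
definition b where "b x = Im (\<alpha> (\<lambda>_. x))"
definition e where "e = sharp g a"
definition f where "f = sharp g b"
definition h where "h x y = g x y - a x * a y - b x * b y"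
definition R where "R x y = Re (\<Omega> (pair_args x y))"
definition I where "I x y = Im (\<Omega> (pair_args x y))"
definition K where "K x = sharp g (R x)"

lemma linear_alpha: "linear (\<lambda>x. \<alpha> (\<lambda>_. x))"
proof -
  have "(\<lambda>x. \<alpha> (\<lambda>_. x)) = (\<lambda>x. \<alpha> ((\<lambda>_. 0)(0 := x)))"
    by (intro ext alt_form_local[OF alt(1)]) simp
  then show ?thesis using alt_form_linear[OF alt(1), of 0 "\<lambda>_. 0"] by (simp only: less_one)
qed

lemma linear_ab: "linear a" "linear b"
  unfolding a_def[abs_def] b_def[abs_def]
  using linear_compose[OF linear_alpha bounded_linear.linear[OF bounded_linear_Re]]
    linear_compose[OF linear_alpha bounded_linear.linear[OF bounded_linear_Im]] by (simp_all add: o_def)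

lemma alpha_eq: "\<alpha> v = Complex (a (v 0)) (b (v 0))"
proof -
  have "\<alpha> v = \<alpha> (\<lambda>_. v 0)" by (rule alt_form_local[OF alt(1)]) simp
  then show ?thesis by (simp add: a_def b_def complex_eq_iff)
qed

lemma ge: "g e y = a y" and gf: "g f y = b y"
  unfolding e_def f_def using linear_ab by (simp_all add: sharp_works)

lemma aJ: "a (J x) = - b x" and bJ: "b (J x) = a x"
proof -
  have "\<alpha> v + \<i> * \<alpha> (v(0 := J (v 0))) = 0" for v
    using conditions(8) by simp
  from this[of "\<lambda>_. x"] show "a (J x) = - b x" "b (J x) = a x"
    by (auto simp: alpha_eq complex_eq_iff)
qed

lemma gJ_skew: "g (J x) y = - g x (J y)"
  using J(3)[of x "J y"] by (simp add: J(2) g_right)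

lemma f_eq: "f = J e"
  by (rule g_eq) (simp add: gf gJ_skew ge aJ)

text \<open>
  Orthonormality of \<open>e\<close> and \<open>f = J e\<close>: the norm condition says that the squared lengths of \<open>e\<close> and
  \<open>f\<close> add up to \<open>2\<close>, and \<open>J\<close> is an isometry.
\<close>

lemma frame: "a e = 1" "b f = 1" "a f = 0" "b e = 0"
proof -
  have af: "a f = - b e" by (simp add: f_eq aJ)
  moreover have "b e = a f" using gf[of e] ge[of f] sym by simp
  ultimately show 0: "a f = 0" "b e = 0" by auto
  have bf: "b f = a e" by (simp add: f_eq bJ)
  have "sharp g (\<lambda>y. Re (cnj (\<alpha> (\<lambda>_. y)))) = e" "sharp g (\<lambda>y. Im (cnj (\<alpha> (\<lambda>_. y)))) = - f"
    by (rule sharp_eqI; simp add: ge gf g_left a_def b_def)+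
  then have "\<alpha> (case_nat e v) + \<i> * \<alpha> (case_nat (- f) v) = 2" for v
    using conditions(9)[rule_format, of v] by simp
  then have "a e + b f = 2"
    by (auto simp: alpha_eq complex_eq_iff linear_neg[OF linear_ab(1)] linear_neg[OF linear_ab(2)])
  then show "a e = 1" "b f = 1" using bf by auto
qed

lemma linear_h: "linear (\<lambda>x. h x y)" "linear (\<lambda>y. h x y)"
  unfolding h_def
  by (rule linearI; simp add: g_left g_right linear_add[OF linear_ab(1)] linear_add[OF linear_ab(2)]
      linear_cmul[OF linear_ab(1)] linear_cmul[OF linear_ab(2)] algebra_simps)+

lemma linear_R: "linear (\<lambda>x. R x y)" "linear (R x)" and linear_I: "linear (\<lambda>x. I x y)" "linear (I x)"
  unfolding R_def[abs_def] I_def[abs_def]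
  using linear_compose[OF alt_form_2_linear(1)[OF alt(3)] bounded_linear.linear[OF bounded_linear_Re]]
    linear_compose[OF alt_form_2_linear(2)[OF alt(3)] bounded_linear.linear[OF bounded_linear_Re]]
    linear_compose[OF alt_form_2_linear(1)[OF alt(3)] bounded_linear.linear[OF bounded_linear_Im]]
    linear_compose[OF alt_form_2_linear(2)[OF alt(3)] bounded_linear.linear[OF bounded_linear_Im]]
  by (simp_all add: o_def)

lemma h_sym: "h x y = h y x" by (simp add: h_def sym[of x])

lemma hJJ: "h (J x) (J y) = h x y" by (simp add: h_def J aJ bJ)

lemma hJ_skew: "h (J x) y = - h x (J y)"
  by (simp add: h_def gJ_skew aJ bJ)

lemma hJ_self: "h (J x) x = 0" "h x (J x) = 0"
  using hJ_skew[of x x] h_sym[of x "J x"] by auto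

lemma h_e: "h e y = 0" "h y e = 0" and h_f: "h f y = 0" "h y f = 0"
  using sym[of y] by (simp_all add: h_def ge gf frame)

text \<open>
  The fundamental form determines \<open>\<omega>\<close>: subtracting \<open>a \<and> b\<close> removes the plane of \<open>e\<close> and \<open>f\<close> from
  \<open>g(J x, y)\<close>.
\<close>

lemma omega_eq: "\<omega> v = complex_of_real (h (J (v 0)) (v 1))"
proof -
  have c: "alt_form 1 (\<lambda>v. cnj (\<alpha> v))"
    by (rule alt_form_bounded_linear[OF bounded_linear_cnj alt(1)])
  show ?thesis
    using fundamental[of v] unfolding wedge_pt_1_1[OF alt(1) c]
    by (simp add: alpha_eq complex_eq_iff h_def aJ bJ field_simps)
qed

lemma Omega_eq: "\<Omega> v = Complex (R (v 0) (v 1)) (I (v 0) (v 1))"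
  using alt_form_2_pair[OF alt(3), of v] by (simp add: R_def I_def complex_eq_iff)

lemma R_skew: "R y x = - R x y" and I_skew: "I y x = - I x y"
  by (simp_all add: R_def I_def alt_form_2_flip[OF alt(3), of x y])

lemma RJ: "R (J x) y = - I x y" and IJ: "I (J x) y = R x y"
proof -
  have "\<Omega> v + \<i> * \<Omega> (v(0 := J (v 0))) = 0" for v
    using conditions(12)[rule_format, of 0 v] by simp
  from this[of "pair_args x y"] show "R (J x) y = - I x y" "I (J x) y = R x y"
    by (auto simp: Omega_eq complex_eq_iff)
qed

lemma R_J: "R x (J y) = - I x y" and I_J: "I x (J y) = R x y"
  using RJ[of y x] IJ[of y x] R_skew I_skew by (metis minus_minus)+

text \<open>
  The conditions \<open>\<omega> \<and> \<Omega> = 0\<close> (real part) and \<open>\<omega> \<and> \<omega> = \<Omega> \<and> cnj \<Omega> / 2\<close>, evaluated on four vectors.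
\<close>

lemma wedge_at:
  "h (J x) y * R z w - h (J x) z * R y w + h (J x) w * R y z +
     h (J y) z * R x w - h (J y) w * R x z + h (J z) w * R x y = 0"
  "2 * (h (J x) y * h (J z) w - h (J x) z * h (J y) w + h (J x) w * h (J y) z) =
     R x y * R z w - R x z * R y w + R x w * R y z + I x y * I z w - I x z * I y w + I x w * I y z"
proof -
  let ?v = "case_nat x (case_nat y (case_nat z (\<lambda>_. w)))"
  have v: "?v 0 = x" "?v 1 = y" "?v 2 = z" "?v 3 = w" by (simp_all add: eval_nat_numeral)
  have c: "alt_form 2 (\<lambda>v. cnj (\<Omega> v))"
    by (rule alt_form_bounded_linear[OF bounded_linear_cnj alt(3)])
  have "wedge_pt 2 2 \<omega> \<Omega> ?v = 0" "wedge_pt 2 2 \<omega> \<omega> ?v = 1 / 2 * wedge_pt 2 2 \<Omega> (\<lambda>v. cnj (\<Omega> v)) ?v"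
    using fun_cong[OF wedges(1)] fun_cong[OF wedges(3)] by blast+
  then show "h (J x) y * R z w - h (J x) z * R y w + h (J x) w * R y z +
     h (J y) z * R x w - h (J y) w * R x z + h (J z) w * R x y = 0"
  "2 * (h (J x) y * h (J z) w - h (J x) z * h (J y) w + h (J x) w * h (J y) z) =
     R x y * R z w - R x z * R y w + R x w * R y z + I x y * I z w - I x z * I y w + I x w * I y z"
    unfolding wedge_pt_2_2[OF alt(2,2)] wedge_pt_2_2[OF alt(2,3)] wedge_pt_2_2[OF alt(3) c] v
    by (simp_all add: omega_eq Omega_eq complex_eq_iff algebra_simps)
qed

lemma orthogonal_exists:
  obtains y where "h x y = 0" "h (J x) y = 0" "h y y > 0"
proof -
  obtain y where "y \<noteq> 0" "a y = 0" "b y = 0" "h x y = 0" "h (J x) y = 0"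
    by (rule common_kernel_4[OF dim linear_ab linear_h(2)[of x] linear_h(2)[of "J x"]])
  then show ?thesis using that[of y] pos[of y] by (simp add: h_def)
qed

text \<open>
  The source is \<open>\<omega> \<and> \<Omega> = 0\<close>, contracted with \<open>e\<close>: the 1-form \<open>R(e, \<cdot>)\<close> has zero wedge product with
  \<open>\<omega>\<close>, and evaluating this on \<open>x\<close>, \<open>y\<close>, \<open>J y\<close> with \<open>y\<close> orthogonal to \<open>x\<close> and \<open>J x\<close> isolates \<open>R(e, x)\<close>.
  Type (2,0) carries the result over to the imaginary part and to \<open>f = J e\<close>.
\<close>

lemma R_e: "R e x = 0" "R x e = 0" and I_e: "I e x = 0" "I x e = 0"
  and R_f: "R f x = 0" "R x f = 0" and I_f: "I f x = 0" "I x f = 0"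
proof -
  have Re: "R e x = 0" for x
  proof -
    obtain y where y: "h x y = 0" "h (J x) y = 0" "h y y > 0" by (rule orthogonal_exists)
    have "h (J y) (J y) * R e x = 0"
      using wedge_at(1)[of e x y "J y"] y by (simp add: f_eq[symmetric] h_f hJJ)
    then show ?thesis using y by (simp add: hJJ)
  qed
  then have Ie: "I e x = 0" for x using R_J[of e x] by simp
  have "R f x = 0" "I f x = 0" using Re Ie by (simp_all add: f_eq RJ IJ)
  then show "R e x = 0" "R x e = 0" "I e x = 0" "I x e = 0" "R f x = 0" "R x f = 0" "I f x = 0" "I x f =
      0"
    using Re Ie R_skew[of x] I_skew[of x] by simp_all
qed

text \<open>
  The normalisation \<open>\<omega> \<and> \<omega> = \<Omega> \<and> cnj \<Omega> / 2\<close> on the vectors \<open>x\<close>, \<open>J x\<close>, \<open>z\<close>, \<open>J z\<close>. For a hyperkaehler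
  triple this is the expansion of \<open>z\<close> in the orthogonal vectors \<open>x\<close>, \<open>J x\<close>, \<open>K x\<close> and \<open>J (K x)\<close>.
\<close>

lemma Gram_identity: "(R x z)\<^sup>2 + (I x z)\<^sup>2 + (h (J x) z)\<^sup>2 + (h x z)\<^sup>2 = h x x * h z z"
proof -
  have "R x x = 0" "I x x = 0" for x using R_skew[of x x] I_skew[of x x] by auto
  then show ?thesis
    using wedge_at(2)[of x "J x" z "J z"] hJ_skew[of x z]
    by (simp add: RJ R_J IJ I_J hJJ hJ_skew[of "J x"] J(2) power2_eq_square
        linear_neg[OF linear_h(1)] linear_neg[OF linear_h(2)] linear_neg[OF linear_R(2)]
        linear_neg[OF linear_I(2)])
qed

lemma gK: "g (K x) y = R x y"
  unfolding K_def by (rule sharp_works[OF linear_R(2)])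

lemma abK: "a (K x) = 0" "b (K x) = 0"
  using gK[of x e] gK[of x f] ge[of "K x"] gf[of "K x"] sym[of "K x"] by (simp_all add: R_e R_f)

lemma hK: "h (K x) y = R x y" "h y (K x) = R x y"
  using sym[of y "K x"] by (simp_all add: h_def abK gK)

lemma linear_K: "linear K"
  unfolding K_def[abs_def] using linear_R by (intro linear_sharp) (simp add: bilinear_def)

text \<open>
  \<open>K\<close> is an isometry of the 4-plane. Put \<open>z = K x\<close> in the Gram identity: of the four squares only
  that of \<open>R(x, K x) = h(K x, K x)\<close> survives, and one factor cancels unless \<open>K x = 0\<close>. In that case
  \<open>\<Omega>(x, \<cdot>) = 0\<close>, and the Gram identity at a vector orthogonal to \<open>x\<close> and \<open>J x\<close> forces \<open>h(x, x) = 0\<close>.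
\<close>

lemma RxKx: "R x (K x) = h x x"
proof -
  let ?n = "R x (K x)"
  \<comment> \<open>All terms of the Gram identity at \<open>z = K x\<close> except \<open>R(x, z)\<close> vanish.\<close>
  have xx: "R x x = 0" "I x x = 0" using R_skew[of x x] I_skew[of x x] by auto
  have "h x (K x) = 0" "h (J x) (K x) = 0" by (simp_all add: hK xx R_J)
  moreover have "I x (K x) = 0"
    using R_J[of x "K x"] hK(1)[of x "J (K x)"] hJ_self by simp
  moreover have "h (K x) (K x) = ?n" by (simp add: hK)
  ultimately have nn: "?n * ?n = h x x * ?n"
    using Gram_identity[of x "K x"] by (simp add: power2_eq_square)
  show ?thesis
  proof (cases "?n = 0")
    case True
    then have "g (K x) (K x) = 0" by (simp add: gK)
    then have K0: "K x = 0" using pos by fastforce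
    have R0: "R x y = 0" for y using gK[of x y] K0 by (simp add: g_left)
    obtain y where y: "h x y = 0" "h (J x) y = 0" "h y y > 0" by (rule orthogonal_exists)
    have "h x x * h y y = 0"
      using Gram_identity[of x y] R0 R_J[of x y] y by simp
    then show ?thesis using y True by simp
  qed (use nn in auto)
qed

lemma RxKy: "R x (K y) = h x y"
proof -
  have K: "K (x + y) = K x + K y" by (rule linear_add[OF linear_K])
  have "R x (K y) = R y (K x)" using hK(1)[of x "K y"] hK(1)[of y "K x"] h_sym by metis
  then show ?thesis
    using RxKx[of "x + y"] RxKx[of x] RxKx[of y] h_sym[of y x]
    by (simp add: K linear_add[OF linear_R(1)] linear_add[OF linear_R(2)]
        linear_add[OF linear_h(1)] linear_add[OF linear_h(2)])
qed

lemma R_K: "R (K x) y = - h x y" and I_K: "I (K x) y = - h (J x) y"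
proof -
  show RK: "R (K x) y = - h x y" for y using RxKy[of y x] R_skew h_sym by metis
  show "I (K x) y = - h (J x) y" using R_J[of "K x" y] RK[of "J y"] hJ_skew by simp
qed

lemma h_nonneg: "h x x \<ge> 0" and h_zero: "h x x = 0 \<Longrightarrow> a x = 0 \<Longrightarrow> b x = 0 \<Longrightarrow> x = 0"
proof -
  \<comment> \<open>\<open>h(x, x)\<close> is the \<open>g\<close>-square of the projection of \<open>x\<close> to the 4-plane.\<close>
  let ?y = "x - a x *\<^sub>R e - b x *\<^sub>R f"
  have "g ?y ?y = h x x"
    using sym[of x e] sym[of x f]
    by (simp add: g_left g_right ge gf frame h_def algebra_simps)
  moreover have "g ?y ?y \<ge> 0" using pos[of ?y] by (cases "?y = 0") (auto simp: g_left)
  ultimately show "h x x \<ge> 0" by simp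
  show "h x x = 0 \<Longrightarrow> a x = 0 \<Longrightarrow> b x = 0 \<Longrightarrow> x = 0"
    using pos[of x] by (cases "x = 0") (auto simp: h_def)
qed

text \<open>
  The triple \<open>(\<omega>, Re \<Omega>, Im \<Omega>)\<close> is orthogonal with equal squares for the wedge product. These are the
  real and imaginary parts of the wedge conditions, because products of real forms are real.
\<close>

lemma real_imag_wedges:
  defines "r \<equiv> \<lambda>v. complex_of_real (Re (\<Omega> v))" and "s \<equiv> \<lambda>v. complex_of_real (Im (\<Omega> v))"
  shows "alt_form 2 r" "alt_form 2 s" "\<Omega> = (\<lambda>v. r v + \<i> * s v)"
    "wedge_pt 2 2 r r = wedge_pt 2 2 \<omega> \<omega>" "wedge_pt 2 2 s s = wedge_pt 2 2 \<omega> \<omega>"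
    "wedge_pt 2 2 r s = (\<lambda>v. 0)" "wedge_pt 2 2 s r = (\<lambda>v. 0)"
    "wedge_pt 2 2 \<omega> r = (\<lambda>v. 0)" "wedge_pt 2 2 r \<omega> = (\<lambda>v. 0)"
    "wedge_pt 2 2 \<omega> s = (\<lambda>v. 0)" "wedge_pt 2 2 s \<omega> = (\<lambda>v. 0)"
proof -
  show r: "alt_form 2 r" and s: "alt_form 2 s"
    unfolding r_def s_def
    by (rule alt_form_bounded_linear[OF bounded_linear_compose[OF bounded_linear_of_real
        bounded_linear_Re] alt(3)]
          alt_form_bounded_linear[OF bounded_linear_compose[OF bounded_linear_of_real bounded_linear_Im]
          alt(3)])+
  show Om: "\<Omega> = (\<lambda>v. r v + \<i> * s v)"
    by (simp add: r_def s_def fun_eq_iff complex_eq_iff)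
  have cnj_Om: "(\<lambda>v. cnj (\<Omega> v)) = (\<lambda>v. r v + (- \<i>) * s v)"
    by (simp add: r_def s_def fun_eq_iff complex_eq_iff)
  have comm: "wedge_pt 2 2 x y = wedge_pt 2 2 y x" if "alt_form 2 x" "alt_form 2 y" for x y :: "'v ptform"
    using wedge_pt_commute[OF that] by (simp add: fun_eq_iff)
  have ims: "Im (r v) = 0" "Im (s v) = 0" "Im (\<omega> v) = 0" for v
    by (simp_all add: r_def s_def omega_eq)
  note re = wedge_pt_real[OF ims(1) ims(1)] wedge_pt_real[OF ims(1) ims(2)]
    wedge_pt_real[OF ims(2) ims(2)] wedge_pt_real[OF ims(3) ims(1)] wedge_pt_real[OF ims(3) ims(2)]
  have rs0: "wedge_pt 2 2 r r v + \<i> * (wedge_pt 2 2 r s v + wedge_pt 2 2 s r v) - wedge_pt 2 2 s s v =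
      0" for v
    using fun_cong[OF wedges(4)] unfolding Om wedge_pt_bilinear by (simp add: algebra_simps)
  have 1: "wedge_pt 2 2 r r v = wedge_pt 2 2 s s v" "wedge_pt 2 2 r s v = 0" for v
    using rs0[of v] unfolding comm[OF s r] by (auto simp: complex_eq_iff re)
  have w0: "wedge_pt 2 2 \<omega> r v + \<i> * wedge_pt 2 2 \<omega> s v = 0" for v
    using fun_cong[OF wedges(3)] unfolding Om wedge_pt_bilinear by simp
  have 2: "wedge_pt 2 2 \<omega> r v = 0" "wedge_pt 2 2 \<omega> s v = 0" for v
    using w0[of v] by (auto simp: complex_eq_iff re)
  have 3: "wedge_pt 2 2 \<omega> \<omega> v = wedge_pt 2 2 r r v" for v
    using fun_cong[OF wedges(1), of v] unfolding cnj_Om unfolding Om wedge_pt_bilinear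
    using 1[of v] comm[OF s r] by simp
  show "wedge_pt 2 2 r r = wedge_pt 2 2 \<omega> \<omega>" "wedge_pt 2 2 s s = wedge_pt 2 2 \<omega> \<omega>"
    "wedge_pt 2 2 r s = (\<lambda>v. 0)" "wedge_pt 2 2 s r = (\<lambda>v. 0)"
    "wedge_pt 2 2 \<omega> r = (\<lambda>v. 0)" "wedge_pt 2 2 r \<omega> = (\<lambda>v. 0)"
    "wedge_pt 2 2 \<omega> s = (\<lambda>v. 0)" "wedge_pt 2 2 s \<omega> = (\<lambda>v. 0)"
    using 1 2 3 comm[OF s r] comm[OF r alt(2)] comm[OF s alt(2)] by (simp_all add: fun_eq_iff)
qed

text \<open>
  Rotate the first two members of the triple and rescale \<open>b\<close>. The metric is changed along \<open>b\<close> only,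
  and \<open>J'\<close> is read off from the new fundamental form; explicitly \<open>J' = k J + l K\<close> on the 4-plane and
  \<open>J' e = f / t\<close>, \<open>J' f = - t e\<close>. That \<open>J'\<close> is an isometry uses \<open>k\<^sup>2 + l\<^sup>2 = 1\<close> and the
  orthogonality of \<open>J x\<close> and \<open>K x\<close>; an isometry that is skew squares to minus the identity. The type
  of \<open>\<Omega>'\<close> is the quaternion relation for the rotated triple, and the wedge conditions hold because
  rotations preserve the relations of \<open>real_imag_wedges\<close>.
\<close>

lemma rotate_squash:
  fixes k l t :: real
  assumes kl: "k\<^sup>2 + l\<^sup>2 = 1" and t: "t > 0"
  defines "\<alpha>' \<equiv> \<lambda>v. complex_of_real (Re (\<alpha> v)) + \<i> * of_real t * complex_of_real (Im (\<alpha> v))"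
    and "\<omega>' \<equiv> \<lambda>v. of_real k * \<omega> v + of_real l * complex_of_real (Re (\<Omega> v))"
    and "\<Omega>' \<equiv> \<lambda>v. (of_real k * complex_of_real (Re (\<Omega> v)) - of_real l * \<omega> v) +
        \<i> * complex_of_real (Im (\<Omega> v))"
    and "g' \<equiv> \<lambda>x y. g x y + (t\<^sup>2 - 1) * (Im (\<alpha> (\<lambda>_. x)) * Im (\<alpha> (\<lambda>_. y)))"
  defines "J' \<equiv> \<lambda>x. sharp g' (\<lambda>y. Re (\<omega>' (pair_args x y) +
      \<i> / 2 * wedge_pt 1 1 \<alpha>' (\<lambda>v. cnj (\<alpha>' v)) (pair_args x y)))"
  shows "SU2_at J' g' \<alpha>' \<omega>' \<Omega>'"
proof -
  let ?r = "\<lambda>v. complex_of_real (Re (\<Omega> v))" and ?s = "\<lambda>v. complex_of_real (Im (\<Omega> v))"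
  note rs = real_imag_wedges
  have g': "g' x y = h x y + a x * a y + t\<^sup>2 * (b x * b y)" for x y
    by (simp add: g'_def h_def algebra_simps flip: b_def)
  note lin = linear_add[OF linear_ab(1)] linear_add[OF linear_ab(2)] linear_cmul[OF linear_ab(1)]
    linear_cmul[OF linear_ab(2)] linear_add[OF linear_h(1)] linear_add[OF linear_h(2)]
    linear_cmul[OF linear_h(1)] linear_cmul[OF linear_h(2)] linear_diff[OF linear_ab(1)]
    linear_diff[OF linear_ab(2)]
    linear_diff[OF linear_h(1)] linear_diff[OF linear_h(2)] linear_add[OF linear_R(1)]
    linear_add[OF linear_R(2)]
    linear_cmul[OF linear_R(1)] linear_cmul[OF linear_R(2)] linear_diff[OF linear_R(1)]
    linear_diff[OF linear_R(2)]
    linear_add[OF linear_I(1)] linear_add[OF linear_I(2)]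
    linear_cmul[OF linear_I(1)] linear_cmul[OF linear_I(2)] linear_diff[OF linear_I(1)]
    linear_diff[OF linear_I(2)]
  have bil': "bilinear g'"
    unfolding bilinear_def g' by (auto intro!: linearI simp: lin algebra_simps)
  have sym': "g' x y = g' y x" for x y by (simp add: g' h_sym[of x] mult.commute)
  have pos': "g' x x > 0" if "x \<noteq> 0" for x
  proof -
    have "g' x x = h x x + (a x)\<^sup>2 + t\<^sup>2 * (b x)\<^sup>2" by (simp add: g' power2_eq_square)
    moreover have "h x x > 0 \<or> (a x)\<^sup>2 > 0 \<or> t\<^sup>2 * (b x)\<^sup>2 > 0"
      using h_zero[of x] h_nonneg[of x] that t by fastforce
    moreover have "h x x \<ge> 0" "(a x)\<^sup>2 \<ge> 0" "t\<^sup>2 * (b x)\<^sup>2 \<ge> 0" using h_nonneg by simp_all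
    ultimately show ?thesis by linarith
  qed
  interpret g': inner_product_at g'
    by unfold_locales (use bil' sym' pos' in auto)
  have \<alpha>': "\<alpha>' v = Complex (a (v 0)) (t * b (v 0))" for v
    by (simp add: \<alpha>'_def alpha_eq complex_eq_iff)
  have alt_\<alpha>': "alt_form 1 \<alpha>'"
    unfolding alt_form_def \<alpha>' by (auto intro!: linearI simp: lin complex_eq_iff algebra_simps)
  have c\<alpha>': "alt_form 1 (\<lambda>v. cnj (\<alpha>' v))"
    by (rule alt_form_bounded_linear[OF bounded_linear_cnj alt_\<alpha>'])
  have \<omega>': "\<omega>' v = of_real (k * h (J (v 0)) (v 1) + l * R (v 0) (v 1))" for v
    by (simp add: \<omega>'_def omega_eq Omega_eq)
  have \<Omega>': "\<Omega>' v = Complex (k * R (v 0) (v 1) - l * h (J (v 0)) (v 1)) (I (v 0) (v 1))" for v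
    by (simp add: \<Omega>'_def omega_eq Omega_eq complex_eq_iff)
  have F': "\<omega>' v + \<i> / 2 * wedge_pt 1 1 \<alpha>' (\<lambda>v. cnj (\<alpha>' v)) v =
      of_real (k * h (J (v 0)) (v 1) + l * R (v 0) (v 1) + t * (a (v 0) * b (v 1) - b (v 0) * a (v 1)))"
      for v
    unfolding wedge_pt_1_1[OF alt_\<alpha>' c\<alpha>'] unfolding \<alpha>' \<omega>' by (simp add: complex_eq_iff field_simps)
  have J': "J' x = k *\<^sub>R (J x - a x *\<^sub>R f + b x *\<^sub>R e) + l *\<^sub>R K x - (t * b x) *\<^sub>R e + (a x / t) *\<^sub>R f"
      for x
    unfolding J'_def F'
    by (rule g'.sharp_eqI) (use t in \<open>simp add: g' lin frame aJ bJ abK hK h_e h_f power2_eq_square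
        algebra_simps\<close>)
  have hJ': "h (J' x) y = k * h (J x) y + l * R x y" "h y (J' x) = k * h (J x) y + l * R x y" for x y
    using h_sym[of y] by (simp_all add: J' lin h_e h_f hK)
  have abJ': "a (J' x) = - t * b x" "b (J' x) = a x / t" for x
    by (simp_all add: J' lin frame aJ bJ abK)
  have RJ': "R (J' x) y = - k * I x y - l * h x y" and IJ': "I (J' x) y = k * R x y - l * h (J x) y"
    and hJJ': "h (J (J' x)) y = - k * h x y + l * I x y" for x y
  proof -
    show "R (J' x) y = - k * I x y - l * h x y"
      by (simp add: J' lin R_e R_f RJ R_K)
    show "I (J' x) y = k * R x y - l * h (J x) y"
      by (simp add: J' lin I_e I_f IJ I_K)
    have "h (J (J' x)) y = - h (J' x) (J y)" by (rule hJ_skew)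
    also have "\<dots> = - k * h x y + l * I x y" by (simp add: hJ' hJJ R_J)
    finally show "h (J (J' x)) y = - k * h x y + l * I x y" .
  qed
  have iso: "g' (J' x) (J' y) = g' x y" for x y
  proof -
    have 1: "h (J x) (J' y) = k * h x y + l * I x y"
      by (simp add: hJ' hJJ R_J h_sym[of y x] I_skew[of y x])
    have 2: "R x (J' y) = l * h x y - k * I x y"
      using R_skew[of "J' y" x] by (simp add: RJ' h_sym[of y x] I_skew[of y x])
    have "h (J' x) (J' y) = (k\<^sup>2 + l\<^sup>2) * h x y"
      unfolding hJ'(1)[of x "J' y"] 1 2 by (simp add: power2_eq_square algebra_simps)
    then have "h (J' x) (J' y) = h x y" by (simp add: kl)
    then show ?thesis using t by (simp add: g' abJ' power2_eq_square)
  qed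
  have skew: "g' (J' x) y = - g' (J' y) x" for x y
    using t h_sym[of y] hJ_skew[of x y] R_skew[of y x]
    by (simp add: g' hJ' abJ' power2_eq_square h_sym[of "J y"])
  \<comment> \<open>A skew isometry squares to minus the identity.\<close>
  have JJ': "J' (J' x) = - x" for x
  proof (rule g'.g_eq)
    fix y
    have "g' (J' (J' x)) y = - g' (J' y) (J' x)" by (rule skew)
    also have "\<dots> = g' (- x) y" unfolding iso sym'[of y x] g'.g_left ..
    finally show "g' (J' (J' x)) y = g' (- x) y" .
  qed
  have linJ': "linear J'"
    unfolding J'
    by (rule linearI) (simp_all add: lin linear_add[OF J(1)] linear_cmul[OF J(1)] linear_add[OF linear_K]
        linear_cmul[OF linear_K] algebra_simps add_divide_distrib)
  have sh: "sharp g' a = e" "sharp g' (\<lambda>y. t * b y) = (1 / t) *\<^sub>R f" "sharp g' (\<lambda>y. - (t * b y)) =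
      (- 1 / t) *\<^sub>R f"
    by (rule g'.sharp_eqI; use t in \<open>simp add: g' lin linear_neg[OF linear_ab(1)]
        linear_neg[OF linear_ab(2)]
      linear_neg[OF linear_h(1)] frame h_e h_f power2_eq_square\<close>)+
  have sh': "sharp g' (\<lambda>y. Re (\<alpha>' (\<lambda>_. y))) = e" "sharp g' (\<lambda>y. Im (\<alpha>' (\<lambda>_. y))) = (1 / t) *\<^sub>R f"
    "sharp g' (\<lambda>y. Re (cnj (\<alpha>' (\<lambda>_. y)))) = e" "sharp g' (\<lambda>y. Im (cnj (\<alpha>' (\<lambda>_. y)))) = (- 1 / t) *\<^sub>R f"
    using sh by (simp_all add: \<alpha>')
  have alt_\<omega>': "alt_form 2 \<omega>'"
    unfolding \<omega>'_def
    by (rule alt_form_add[OF alt_form_bounded_linear[OF bounded_linear_mult_right alt(2)]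
          alt_form_bounded_linear[OF bounded_linear_mult_right rs(1)]])
  have \<Omega>'_eq: "\<Omega>' = (\<lambda>v. (of_real k * ?r v + (- of_real l) * \<omega> v) + \<i> * ?s v)"
    by (simp add: \<Omega>'_def)
  have c\<Omega>'_eq: "(\<lambda>v. cnj (\<Omega>' v)) = (\<lambda>v. (of_real k * ?r v + (- of_real l) * \<omega> v) + (- \<i>) * ?s v)"
    by (simp add: \<Omega>'_def omega_eq fun_eq_iff)
  have alt_\<Omega>': "alt_form 2 \<Omega>'"
    unfolding \<Omega>'_eq
    by (intro alt_form_add alt_form_bounded_linear[OF bounded_linear_mult_right] alt(2) rs(1,2))
  have kl': "complex_of_real k * complex_of_real k + complex_of_real l * complex_of_real l = 1"
    using kl by (simp only: power2_eq_square flip: of_real_mult of_real_add) simp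
  have ww: "wedge_pt 2 2 \<omega>' \<omega>' = wedge_pt 2 2 \<omega> \<omega>"
  proof
    fix v
    have "wedge_pt 2 2 \<omega>' \<omega>' v =
        (complex_of_real k * complex_of_real k + complex_of_real l * complex_of_real l) * wedge_pt 2 2 \<omega>
        \<omega> v"
      unfolding \<omega>'_def wedge_pt_bilinear rs(4-11) by (simp add: algebra_simps)
    then show "wedge_pt 2 2 \<omega>' \<omega>' v = wedge_pt 2 2 \<omega> \<omega> v" by (simp add: kl')
  qed
  have OOc: "wedge_pt 2 2 \<Omega>' (\<lambda>v. cnj (\<Omega>' v)) v = 2 * wedge_pt 2 2 \<omega> \<omega> v" for v
  proof -
    have "wedge_pt 2 2 \<Omega>' (\<lambda>v. cnj (\<Omega>' v)) v = (complex_of_real k * complex_of_real k +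
        complex_of_real l * complex_of_real l) * wedge_pt 2 2 \<omega> \<omega> v + wedge_pt 2 2 \<omega> \<omega> v"
      unfolding c\<Omega>'_eq unfolding \<Omega>'_eq wedge_pt_bilinear rs(4-11) by (simp add: algebra_simps)
    then show ?thesis by (simp add: kl')
  qed
  have OO: "wedge_pt 2 2 \<Omega>' \<Omega>' v = 0" for v
  proof -
    have "wedge_pt 2 2 \<Omega>' \<Omega>' v = (complex_of_real k * complex_of_real k +
        complex_of_real l * complex_of_real l) * wedge_pt 2 2 \<omega> \<omega> v - wedge_pt 2 2 \<omega> \<omega> v"
      unfolding \<Omega>'_eq wedge_pt_bilinear rs(4-11) by (simp add: algebra_simps)
    then show ?thesis by (simp add: kl')
  qed
  have wO: "wedge_pt 2 2 \<omega>' \<Omega>' v = 0" for v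
    unfolding \<Omega>'_eq \<omega>'_def wedge_pt_bilinear rs(4-11) by (simp add: algebra_simps)
  have type\<Omega>': "\<Omega>' v + \<i> * \<Omega>' (v(j := J' (v j))) = 0" if "j < 2" for v j
  proof -
    have type0: "\<Omega>' v + \<i> * \<Omega>' (v(0 := J' (v 0))) = 0" for v
    proof -
      have "k * R (J' x) y - l * h (J (J' x)) y = - (k\<^sup>2 + l\<^sup>2) * I x y" for x y
        by (simp add: RJ' hJJ' power2_eq_square algebra_simps)
      then show ?thesis by (simp add: \<Omega>' IJ' kl complex_eq_iff)
    qed
    have flip: "\<Omega>' (pair_args x y) = - \<Omega>' (pair_args y x)" for x y by (rule alt_form_2_flip[OF alt_\<Omega>'])
    show ?thesis
    proof (cases "j = 0")
      case True
      then show ?thesis using type0 by simp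
    next
      case False
      then have j: "j = 1" using that by simp
      have "\<Omega>' v = - \<Omega>' (pair_args (v 1) (v 0))" "\<Omega>' (v(1 := J' (v 1))) = -
          \<Omega>' (pair_args (J' (v 1)) (v 0))"
        using alt_form_2_pair[OF alt_\<Omega>'] flip by (metis fun_upd_same fun_upd_other zero_neq_one)+
      moreover have "\<Omega>' ((pair_args (v 1) (v 0))(0 := J' (v 1))) = \<Omega>' (pair_args (J' (v 1)) (v 0))"
        by (rule alt_form_local[OF alt_\<Omega>']) (auto simp: less_2_cases_iff)
      ultimately show ?thesis using type0[of "pair_args (v 1) (v 0)"] by (simp add: j add_eq_0_iff)
    qed
  qed
  have type\<alpha>': "\<alpha>' v + \<i> * \<alpha>' (v(j := J' (v j))) = 0" if "j < 1" for v j
    using that t by (simp add: \<alpha>' abJ' complex_eq_iff)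
  have fund': "\<omega>' v + \<i> / 2 * wedge_pt 1 1 \<alpha>' (\<lambda>v. cnj (\<alpha>' v)) v =
      complex_of_real (g' (J' (v 0)) (v 1))" for v
    unfolding F' using t by (simp add: g' hJ' abJ' power2_eq_square algebra_simps)
  have contr': "\<alpha>' (case_nat e v) + \<i> * \<alpha>' (case_nat ((- 1 / t) *\<^sub>R f) v) = 2"
    "\<Omega>' (case_nat e v) + \<i> * \<Omega>' (case_nat ((1 / t) *\<^sub>R f) v) = 0"
    "\<omega>' (case_nat e v) + \<i> * \<omega>' (case_nat ((1 / t) *\<^sub>R f) v) = 0" for v
    using t by (simp_all add: \<alpha>' \<Omega>' \<omega>' lin linear_neg[OF linear_ab(1)] linear_neg[OF linear_ab(2)]
      frame R_e R_f I_e I_f linear_cmul[OF J(1)] hJ_skew h_e h_f complex_eq_iff)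
  have real': "\<omega>' v \<in> \<real>" for v by (simp only: \<omega>' Reals_of_real)
  have w1: "wedge_pt 2 2 \<omega>' \<omega>' = (\<lambda>v. 1 / 2 * wedge_pt 2 2 \<Omega>' (\<lambda>v. cnj (\<Omega>' v)) v)"
    by (rule ext) (simp only: ww OOc, simp)
  have w2: "\<exists>v. wedge_pt 2 2 \<omega>' \<omega>' v \<noteq> 0" unfolding ww by (rule wedges(2))
  have w3: "wedge_pt 2 2 \<omega>' \<Omega>' = (\<lambda>v. 0)" "wedge_pt 2 2 \<Omega>' \<Omega>' = (\<lambda>v. 0)"
    using wO OO by (intro ext; simp only:)+
  show ?thesis
    unfolding SU2_at_def sh'
    by (intro conjI allI impI)
       (fact bil' sym' pos' linJ' JJ' iso alt_\<alpha>' type\<alpha>' contr' alt_\<omega>' real' alt_\<Omega>' type\<Omega>' w1 w2 w3 fund'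
         | erule pos' type\<alpha>' type\<Omega>')+
qed

text \<open>
  All conditions on \<open>\<Omega>\<close> are linear or quadratic in it, apart from \<open>\<Omega> \<and> cnj \<Omega>\<close>, in which \<open>u\<close> cancels.
\<close>

lemma phase:
  assumes u: "u * cnj u = 1"
  shows "SU2_at J g \<alpha> \<omega> (\<lambda>v. u * \<Omega> v)"
proof -
  have c: "(\<lambda>v. cnj (u * \<Omega> v)) = (\<lambda>v. cnj u * cnj (\<Omega> v))" by simp
  have w: "wedge_pt 2 2 (\<lambda>v. u * \<Omega> v) (\<lambda>v. cnj (u * \<Omega> v)) = wedge_pt 2 2 \<Omega> (\<lambda>v. cnj (\<Omega> v))"
    unfolding c wedge_pt_bilinear using u by (simp add: fun_eq_iff flip: mult.assoc)
  have scale: "u * x + \<i> * (u * y) = u * (x + \<i> * y)" for x y by (simp add: algebra_simps)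
  have alt': "alt_form 2 (\<lambda>v. u * \<Omega> v)"
    by (rule alt_form_bounded_linear[OF bounded_linear_mult_right alt(3)])
  have type': "\<forall>v. \<forall>j<2. u * \<Omega> v + \<i> * (u * \<Omega> (v(j := J (v j)))) = 0"
    unfolding scale using conditions(12) by simp
  have contr': "\<forall>v. u * \<Omega> (case_nat (sharp g (\<lambda>y. Re (\<alpha> (\<lambda>_. y)))) v) +
     \<i> * (u * \<Omega> (case_nat (sharp g (\<lambda>y. Im (\<alpha> (\<lambda>_. y)))) v)) = 0"
    unfolding scale using conditions(19) by simp
  have w': "wedge_pt 2 2 \<omega> \<omega> = (\<lambda>v. 1 / 2 * wedge_pt 2 2 (\<lambda>v. u * \<Omega> v) (\<lambda>v. cnj (u * \<Omega> v)) v)"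
    unfolding w by (rule wedges(1))
  have w0: "wedge_pt 2 2 \<omega> (\<lambda>v. u * \<Omega> v) = (\<lambda>v. 0)" "wedge_pt 2 2 (\<lambda>v. u * \<Omega> v) (\<lambda>v. u * \<Omega> v) = (\<lambda>v. 0)"
    unfolding wedge_pt_bilinear wedges(3,4) by simp_all
  show ?thesis
    unfolding SU2_at_def
    by (intro conjI) (fact conditions alt' type' contr' w' w0)+
qed

end


section \<open>From SU(2) to SU(3) at a point\<close>

lemma wedge_pt_alt_form': "alt_form k a \<Longrightarrow> alt_form l b \<Longrightarrow> n = k + l \<Longrightarrow> alt_form n (wedge_pt k l a b)"
  by (simp only: wedge_pt_alt_form)

text \<open>
  With the degrees of the partial products as separate variables, so that the rule applies when they
  are numerals.
\<close>

lemma wedge_pt_assoc':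
  assumes "alt_form k a" "alt_form l b" "alt_form m c" "q = k + l" "r = l + m"
  shows "wedge_pt q m (wedge_pt k l a b) c = wedge_pt k r a (wedge_pt l m b c)"
  unfolding assms(4,5) by (rule ext) (rule wedge_pt_assoc[OF assms(1-3), symmetric])

lemma wedge_pt_commute_even:
  assumes "alt_form k a" "alt_form l b" "even (k * l)"
  shows "wedge_pt k l a b = wedge_pt l k b a"
  using wedge_pt_commute[OF assms(1,2)] assms(3) by (simp add: fun_eq_iff)

lemma wedge_pt_odd_self:
  assumes "alt_form k a" "odd k"
  shows "wedge_pt k k a a = (\<lambda>v. 0)"
proof
  fix v
  have "wedge_pt k k a a v = - wedge_pt k k a a v"
    using wedge_pt_commute[OF assms(1,1), of v] assms(2) by simp
  then show "wedge_pt k k a a v = 0" by simp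
qed

text \<open>
  In each term of the sum the vector \<open>v j\<close> occurs in exactly one factor, so replacing it by
  \<open>J (v j)\<close> multiplies the term by \<open>i\<close>.
\<close>

lemma wedge_pt_type_k0:
  assumes a: "alt_form k a" "\<And>v j. j < k \<Longrightarrow> a v + \<i> * a (v(j := J (v j))) = 0"
    and b: "alt_form l b" "\<And>v j. j < l \<Longrightarrow> b v + \<i> * b (v(j := J (v j))) = 0"
    and j: "j < k + l"
  shows "wedge_pt k l a b v + \<i> * wedge_pt k l a b (v(j := J (v j))) = 0"
proof -
  let ?v = "v(j := J (v j))"
  have I: "y = \<i> * x" if "x + \<i> * y = 0" for x y :: complex
    using that by (auto simp: complex_eq_iff)
  have each: "of_int (sign \<sigma>) * a (\<lambda>i. ?v (\<sigma> i)) * b (\<lambda>i. ?v (\<sigma> (k + i))) =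
    \<i> * (of_int (sign \<sigma>) * a (\<lambda>i. v (\<sigma> i)) * b (\<lambda>i. v (\<sigma> (k + i))))" if \<sigma>: "\<sigma> permutes {..<k + l}" for \<sigma>
  proof -
    obtain i where i: "\<sigma> i = j" using permutes_surj[OF \<sigma>] by (metis surjD)
    then have il: "i < k + l" using permutes_in_image[OF \<sigma>, of i] j by simp
    have eq: "\<sigma> i' = j \<longleftrightarrow> i' = i" for i'
      using i permutes_inj[OF \<sigma>] by (auto dest: injD)
    show ?thesis
    proof (cases "i < k")
      case True
      have "a (\<lambda>i. ?v (\<sigma> i)) = a ((\<lambda>i. v (\<sigma> i))(i := J (v (\<sigma> i))))"
        by (rule arg_cong[of _ _ a]) (auto simp: fun_eq_iff eq i)
      also have "\<dots> = \<i> * a (\<lambda>i. v (\<sigma> i))"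
        using a(2)[OF True, of "\<lambda>i. v (\<sigma> i)"] by (rule I)
      finally have "a (\<lambda>i. ?v (\<sigma> i)) = \<i> * a (\<lambda>i. v (\<sigma> i))" .
      moreover have "b (\<lambda>i. ?v (\<sigma> (k + i))) = b (\<lambda>i. v (\<sigma> (k + i)))"
        by (rule arg_cong[of _ _ b]) (use True in \<open>auto simp: fun_eq_iff eq\<close>)
      ultimately show ?thesis by (simp only: mult_ac)
    next
      case False
      then have il': "i - k < l" using il by simp
      have "b (\<lambda>i. ?v (\<sigma> (k + i))) = b ((\<lambda>i. v (\<sigma> (k + i)))(i - k := J (v (\<sigma> (k + (i - k))))))"
        by (rule arg_cong[of _ _ b]) (use False in \<open>auto simp: fun_eq_iff eq i\<close>)
      also have "\<dots> = \<i> * b (\<lambda>i. v (\<sigma> (k + i)))"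
        using b(2)[OF il', of "\<lambda>i. v (\<sigma> (k + i))"] by (rule I)
      finally have "b (\<lambda>i. ?v (\<sigma> (k + i))) = \<i> * b (\<lambda>i. v (\<sigma> (k + i)))" .
      moreover have "a (\<lambda>i. ?v (\<sigma> i)) = a (\<lambda>i. v (\<sigma> i))"
        by (rule alt_form_local[OF a(1)]) (use False in \<open>auto simp: eq\<close>)
      ultimately show ?thesis by (simp only: mult_ac)
    qed
  qed
  have "wedge_pt k l a b ?v = \<i> * wedge_pt k l a b v"
    unfolding wedge_pt_def times_divide_eq_right sum_distrib_left
    by (intro arg_cong2[where f = "(/)"] sum.cong refl each) simp
  then show ?thesis by (simp flip: mult.assoc)
qed

context SU2_point
begin

text \<open>
  With \<open>\<theta> = \<alpha> \<and> cnj \<alpha>\<close> one has \<open>\<theta> \<and> \<alpha> = 0\<close>, \<open>\<theta> \<and> \<theta> = 0\<close>, and \<open>\<omega>\<^sup>3 = \<omega> \<and> \<Omega> \<and> cnj \<Omega> / 2 = 0\<close>. Hence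
  \<open>F \<and> \<Psi> = 0\<close> and \<open>F\<^sup>3 = (3 i / 2) \<omega> \<and> \<omega> \<and> \<theta>\<close>, while moving the even factor \<open>\<Omega>\<close> past \<open>cnj \<alpha>\<close> gives
  \<open>\<Psi> \<and> cnj \<Psi> = \<theta> \<and> \<Omega> \<and> cnj \<Omega> = 2 \<omega> \<and> \<omega> \<and> \<theta>\<close>. This 6-form does not vanish because its contraction with
  \<open>e\<close> and \<open>f\<close> is a nonzero multiple of \<open>\<omega> \<and> \<omega>\<close>.
\<close>

lemma SU3_at:
  defines "F \<equiv> \<lambda>v. \<omega> v + \<i> / 2 * wedge_pt 1 1 \<alpha> (\<lambda>v. cnj (\<alpha> v)) v" and "\<Psi> \<equiv> wedge_pt 1 2 \<alpha> \<Omega>"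
  shows "j < 3 \<Longrightarrow> \<Psi> v + \<i> * \<Psi> (v(j := J (v j))) = 0"
    and "wedge_pt 2 3 F \<Psi> = (\<lambda>v. 0)"
    and "4 / 3 * wedge_pt 4 2 (wedge_pt 2 2 F F) F w = \<i> * wedge_pt 3 3 \<Psi> (\<lambda>v. cnj (\<Psi> v)) w"
    and "\<exists>v. wedge_pt 3 3 \<Psi> (\<lambda>v. cnj (\<Psi> v)) v \<noteq> 0"
proof -
  let ?c = "\<lambda>v. cnj (\<alpha> v)" and ?\<theta> = "wedge_pt 1 1 \<alpha> (\<lambda>v. cnj (\<alpha> v))" and ?O = "\<lambda>v. cnj (\<Omega> v)"
  let ?ww = "wedge_pt 2 2 \<omega> \<omega>"
  have c: "alt_form 1 ?c" by (rule alt_form_bounded_linear[OF bounded_linear_cnj alt(1)])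
  have O: "alt_form 2 ?O" by (rule alt_form_bounded_linear[OF bounded_linear_cnj alt(3)])
  have \<theta>: "alt_form 2 ?\<theta>" by (rule wedge_pt_alt_form'[OF alt(1) c]) simp
  have ww: "alt_form 4 ?ww" by (rule wedge_pt_alt_form'[OF alt(2,2)]) simp
  have cO: "alt_form 3 (wedge_pt 1 2 ?c ?O)" by (rule wedge_pt_alt_form'[OF c O]) simp
  note com12 = wedge_pt_commute_even[of 1 _ 2] and com22 = wedge_pt_commute_even[of 2 _ 2]
  have z: "(2::nat) = 1 + 1" "(3::nat) = 1 + 2" "(3::nat) = 2 + 1" "(4::nat) = 2 + 2"
    "(5::nat) = 2 + 3" "(5::nat) = 1 + 4" "even (1 * 2 :: nat)" "even (2 * 2 :: nat)"
    "even (2 * 4 :: nat)" by simp_all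
  show "j < 3 \<Longrightarrow> \<Psi> v + \<i> * \<Psi> (v(j := J (v j))) = 0"
    unfolding \<Psi>_def
    by (rule wedge_pt_type_k0[OF alt(1) _ alt(3)])
       (use conditions(8)[rule_format] conditions(12)[rule_format] in auto)

  have "wedge_pt 2 3 \<omega> \<Psi> = wedge_pt 3 2 (wedge_pt 2 1 \<omega> \<alpha>) \<Omega>"
    unfolding \<Psi>_def by (rule wedge_pt_assoc'[OF alt(2,1,3) z(3,2), symmetric])
  also have "wedge_pt 2 1 \<omega> \<alpha> = wedge_pt 1 2 \<alpha> \<omega>" by (rule com12[OF alt(1,2) z(7), symmetric])
  also have "wedge_pt 3 2 (wedge_pt 1 2 \<alpha> \<omega>) \<Omega> = wedge_pt 1 4 \<alpha> (wedge_pt 2 2 \<omega> \<Omega>)"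
    by (rule wedge_pt_assoc'[OF alt(1,2,3) z(2,4)])
  finally have wPsi: "wedge_pt 2 3 \<omega> \<Psi> = (\<lambda>v. 0)" unfolding wedges(3) wedge_pt_zero_right .
  have "wedge_pt 2 1 ?\<theta> \<alpha> = wedge_pt 1 2 \<alpha> ?\<theta>" by (rule com12[OF alt(1) \<theta> z(7), symmetric])
  also have "\<dots> = wedge_pt 2 1 (wedge_pt 1 1 \<alpha> \<alpha>) ?c"
    by (rule wedge_pt_assoc'[OF alt(1,1) c z(1,1), symmetric])
  also have "\<dots> = (\<lambda>v. 0)" by (simp only: wedge_pt_odd_self[OF alt(1) odd_one] wedge_pt_zero_left)
  finally have \<theta>\<alpha>: "wedge_pt 2 1 ?\<theta> \<alpha> = (\<lambda>v. 0)" .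
  have "wedge_pt 2 3 ?\<theta> \<Psi> = wedge_pt 3 2 (wedge_pt 2 1 ?\<theta> \<alpha>) \<Omega>"
    unfolding \<Psi>_def by (rule wedge_pt_assoc'[OF \<theta> alt(1,3) z(3,2), symmetric])
  then have \<theta>Psi: "wedge_pt 2 3 ?\<theta> \<Psi> = (\<lambda>v. 0)" unfolding \<theta>\<alpha> wedge_pt_zero_left .
  show "wedge_pt 2 3 F \<Psi> = (\<lambda>v. 0)"
    unfolding F_def wedge_pt_add_left wedge_pt_scale_left wPsi \<theta>Psi by simp

  have "wedge_pt 1 2 ?c ?\<theta> = wedge_pt 2 1 ?\<theta> ?c" by (rule com12[OF c \<theta> z(7)])
  also have "\<dots> = wedge_pt 1 2 \<alpha> (wedge_pt 1 1 ?c ?c)" by (rule wedge_pt_assoc'[OF alt(1) c c z(1,1)])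
  also have "\<dots> = (\<lambda>v. 0)" by (simp only: wedge_pt_odd_self[OF c odd_one] wedge_pt_zero_right)
  finally have c\<theta>: "wedge_pt 1 2 ?c ?\<theta> = (\<lambda>v. 0)" .
  have "wedge_pt 2 2 ?\<theta> ?\<theta> = wedge_pt 1 3 \<alpha> (wedge_pt 1 2 ?c ?\<theta>)"
    by (rule wedge_pt_assoc'[OF alt(1) c \<theta> z(1,2)])
  then have \<theta>\<theta>: "wedge_pt 2 2 ?\<theta> ?\<theta> = (\<lambda>v. 0)" unfolding c\<theta> wedge_pt_zero_right .
  have \<theta>w: "wedge_pt 2 2 ?\<theta> \<omega> = wedge_pt 2 2 \<omega> ?\<theta>" by (rule com22[OF \<theta> alt(2) z(8)])
  have FF: "wedge_pt 2 2 F F = (\<lambda>v. ?ww v + \<i> * wedge_pt 2 2 \<omega> ?\<theta> v)"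
    unfolding F_def wedge_pt_bilinear \<theta>w \<theta>\<theta> by (simp add: fun_eq_iff)
  have w\<theta>w: "wedge_pt 4 2 (wedge_pt 2 2 \<omega> ?\<theta>) \<omega> = wedge_pt 4 2 ?ww ?\<theta>"
    unfolding wedge_pt_assoc'[OF alt(2) \<theta> alt(2) z(4,4)] wedge_pt_assoc'[OF alt(2,2) \<theta> z(4,4)] \<theta>w ..
  have w\<theta>\<theta>: "wedge_pt 4 2 (wedge_pt 2 2 \<omega> ?\<theta>) ?\<theta> = (\<lambda>v. 0)"
    unfolding wedge_pt_assoc'[OF alt(2) \<theta> \<theta> z(4,4)] \<theta>\<theta> wedge_pt_zero_right ..
  have "wedge_pt 4 2 ?ww \<omega> = wedge_pt 2 4 \<omega> ?ww" by (rule wedge_pt_assoc'[OF alt(2,2,2) z(4,4)])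
  also have "\<dots> = (\<lambda>v. 1 / 2 * wedge_pt 4 2 (wedge_pt 2 2 \<omega> \<Omega>) ?O v)"
    unfolding wedge_pt_assoc'[OF alt(2,3) O z(4,4)] wedges(1) wedge_pt_scale_right ..
  also have "\<dots> = (\<lambda>v. 0)" unfolding wedges(3) wedge_pt_zero_left by simp
  finally have www: "wedge_pt 4 2 ?ww \<omega> = (\<lambda>v. 0)" .
  have FFF: "wedge_pt 4 2 (wedge_pt 2 2 F F) F = (\<lambda>v. 3 * \<i> / 2 * wedge_pt 4 2 ?ww ?\<theta> v)"
    unfolding FF unfolding F_def wedge_pt_bilinear www w\<theta>w w\<theta>\<theta> by (simp add: fun_eq_iff)

  have Psi_cnj: "(\<lambda>v. cnj (\<Psi> v)) = wedge_pt 1 2 ?c ?O" unfolding \<Psi>_def wedge_pt_cnj ..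
  have "wedge_pt 2 3 \<Omega> (wedge_pt 1 2 ?c ?O) = wedge_pt 3 2 (wedge_pt 2 1 \<Omega> ?c) ?O"
    by (rule wedge_pt_assoc'[OF alt(3) c O z(3,2), symmetric])
  also have "wedge_pt 2 1 \<Omega> ?c = wedge_pt 1 2 ?c \<Omega>" by (rule com12[OF c alt(3) z(7), symmetric])
  also have "wedge_pt 3 2 (wedge_pt 1 2 ?c \<Omega>) ?O = wedge_pt 1 4 ?c (wedge_pt 2 2 \<Omega> ?O)"
    by (rule wedge_pt_assoc'[OF c alt(3) O z(2,4)])
  also have "wedge_pt 2 2 \<Omega> ?O = (\<lambda>v. 2 * ?ww v)" unfolding wedges(1) by (simp add: fun_eq_iff)
  finally have OcO: "wedge_pt 2 3 \<Omega> (wedge_pt 1 2 ?c ?O) = (\<lambda>v. 2 * wedge_pt 1 4 ?c ?ww v)"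
    unfolding wedge_pt_scale_right .
  have PP: "wedge_pt 3 3 \<Psi> (\<lambda>v. cnj (\<Psi> v)) = (\<lambda>v. 2 * wedge_pt 1 5 \<alpha> (wedge_pt 1 4 ?c ?ww) v)"
    unfolding Psi_cnj unfolding \<Psi>_def wedge_pt_assoc'[OF alt(1,3) cO z(2,5)] OcO wedge_pt_scale_right ..
  have \<theta>ww: "wedge_pt 1 5 \<alpha> (wedge_pt 1 4 ?c ?ww) = wedge_pt 4 2 ?ww ?\<theta>"
    unfolding wedge_pt_assoc'[OF alt(1) c ww z(1,6), symmetric]
      by (rule wedge_pt_commute_even[OF \<theta> ww z(9)])
  show "4 / 3 * wedge_pt 4 2 (wedge_pt 2 2 F F) F w = \<i> * wedge_pt 3 3 \<Psi> (\<lambda>v. cnj (\<Psi> v)) w"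
    unfolding FFF PP \<theta>ww by simp

  have ww0: "?ww v = 0" if "v 0 = e \<or> v 0 = f" for v
    using that
    by (auto simp: wedge_pt_2_2[OF alt(2,2)] omega_eq hJ_skew h_e h_f)
  have cww: "wedge_pt 1 4 ?c ?ww v = cnj (\<alpha> (\<lambda>_. v 0)) * ?ww (\<lambda>j. v (Suc j))" if "v 0 = e \<or> v 0 = f" for v
  proof -
    have "(\<Sum>i\<le>4. (- 1) ^ i * cnj (\<alpha> (\<lambda>_. v i)) * ?ww (omit_arg i v)) =
        (\<Sum>i\<in>{0::nat}. (- 1) ^ i * cnj (\<alpha> (\<lambda>_. v i)) * ?ww (omit_arg i v))"
      by (rule sum.mono_neutral_right) (use that in \<open>auto simp: ww0\<close>)
    then show ?thesis unfolding wedge_pt_1_left[OF c ww] by simp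
  qed
  obtain w where w: "?ww w \<noteq> 0" using wedges(2) by blast
  \<comment> \<open>Evaluate on \<open>e\<close>, \<open>f\<close> and four vectors on which \<open>\<omega> \<and> \<omega>\<close> does not vanish.\<close>
  let ?v = "case_nat e (case_nat f w)"
  have cww_alt: "alt_form 5 (wedge_pt 1 4 ?c ?ww)" by (rule wedge_pt_alt_form'[OF c ww]) simp
  have "wedge_pt 1 5 \<alpha> (wedge_pt 1 4 ?c ?ww) ?v =
      (\<Sum>i\<le>5. (- 1) ^ i * \<alpha> (\<lambda>_. ?v i) * wedge_pt 1 4 ?c ?ww (omit_arg i ?v))"
    by (rule wedge_pt_1_left[OF alt(1) cww_alt])
  also have "\<dots> = (\<Sum>i\<in>{0, 1::nat}. (- 1) ^ i * \<alpha> (\<lambda>_. ?v i) * wedge_pt 1 4 ?c ?ww (omit_arg i ?v))"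
  proof (rule sum.mono_neutral_right)
    show "\<forall>i\<in>{..5} - {0, 1::nat}. (- 1) ^ i * \<alpha> (\<lambda>_. ?v i) * wedge_pt 1 4 ?c ?ww (omit_arg i ?v) = 0"
    proof
      fix i :: nat assume "i \<in> {..5} - {0, 1}"
      then have i: "i > 1" by auto
      then have "wedge_pt 1 4 ?c ?ww (omit_arg i ?v) =
          cnj (\<alpha> (\<lambda>_. omit_arg i ?v 0)) * ?ww (\<lambda>j. omit_arg i ?v (Suc j))"
        by (intro cww) simp
      also have "?ww (\<lambda>j. omit_arg i ?v (Suc j)) = 0" by (rule ww0) (use i in simp)
      finally show "(- 1) ^ i * \<alpha> (\<lambda>_. ?v i) * wedge_pt 1 4 ?c ?ww (omit_arg i ?v) = 0" by simp
    qed
  qed auto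
  also have "\<dots> = - 2 * \<i> * ?ww w"
  proof -
    have o: "omit_arg 0 ?v = case_nat f w" "omit_arg 1 ?v = case_nat e w"
      by (auto simp: fun_eq_iff split: nat.split)
    have "wedge_pt 1 4 ?c ?ww (omit_arg 0 ?v) = - \<i> * ?ww w" "wedge_pt 1 4 ?c ?ww (omit_arg 1 ?v) = ?ww w"
      unfolding o by (subst cww; simp add: alpha_eq frame complex_eq_iff)+
    then show ?thesis by (simp add: alpha_eq frame complex_eq_iff)
  qed
  finally show "\<exists>v. wedge_pt 3 3 \<Psi> (\<lambda>v. cnj (\<Psi> v)) v \<noteq> 0"
    unfolding PP using w by (intro exI[of _ ?v]) simp
qed

end


section \<open>SU(2) structures on a manifold\<close>

lemma SU2_structureD:
  assumes "SU2_structure A J g \<alpha> \<omega> \<Omega>"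
  shows "endo_field A J" "metric_field A g" "diff_form A 1 \<alpha>" "diff_form A 2 \<omega>" "diff_form A 2 \<Omega>"
    and "c \<in> A \<Longrightarrow> p \<in> chart_dom c \<Longrightarrow> SU2_at (J c p) (g c p) (\<alpha> c p) (\<omega> c p) (\<Omega> c p)"
proof -
  note S = assms[unfolded SU2_structure_def almost_hermitian_def]
  show fields: "endo_field A J" "metric_field A g" "diff_form A 1 \<alpha>" "diff_form A 2 \<omega>" "diff_form A 2 \<Omega>"
    using S by - (elim conjE, assumption)+
  assume c: "c \<in> A" "p \<in> chart_dom c"
  have herm: "\<forall>c\<in>A. \<forall>p\<in>chart_dom c. (\<forall>x. J c p (J c p x) = - x) \<and> (\<forall>x y. g c p (J c p x) (J c p y) =
      g c p x y)"
    and t1: "type_k0 A J 1 \<alpha>" and t2: "type_k0 A J 2 \<Omega>"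
    and e: "eq_on A (contract g (cnj_form \<alpha>) \<alpha>) (\<lambda>c p v. 2)"
      "eq_on A (wedge 2 2 \<omega> \<omega>) ((1 / 2) \<odot>\<^sub>F wedge 2 2 \<Omega> (cnj_form \<Omega>))"
      "eq_on A (wedge 2 2 \<omega> \<Omega>) zero_form" "eq_on A (wedge 2 2 \<Omega> \<Omega>) zero_form"
      "eq_on A (contract g \<alpha> \<Omega>) zero_form" "eq_on A (contract g \<alpha> \<omega>) zero_form"
      "eq_on A (SU2_F \<alpha> \<omega>) (fundamental_form J g)"
    and r: "real_form A \<omega>" and n: "nowhere_zero A (wedge 2 2 \<omega> \<omega>)"
    using S by - (elim conjE, assumption)+
  note at = e[unfolded eq_on_def, rule_format, OF c]
  show "SU2_at (J c p) (g c p) (\<alpha> c p) (\<omega> c p) (\<Omega> c p)"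
    unfolding SU2_at_def
  proof (intro conjI)
    show "bilinear (g c p)" "\<forall>x y. g c p x y = g c p y x" "\<forall>x. x \<noteq> 0 \<longrightarrow> g c p x x > 0"
      using fields(2) c unfolding metric_field_def by blast+
    show "linear (J c p)" using fields(1) c unfolding endo_field_def by blast
    show "\<forall>x. J c p (J c p x) = - x" "\<forall>x y. g c p (J c p x) (J c p y) = g c p x y"
      using herm c by blast+
    show "alt_form 1 (\<alpha> c p)" "alt_form 2 (\<omega> c p)" "alt_form 2 (\<Omega> c p)"
      using fields(3-5) c unfolding diff_form_def by blast+
    show "\<forall>v. \<forall>j<1. \<alpha> c p v + \<i> * \<alpha> c p (v(j := J c p (v j))) = 0"
      using t1 c unfolding type_k0_def by blast
    show "\<forall>v. \<forall>j<2. \<Omega> c p v + \<i> * \<Omega> c p (v(j := J c p (v j))) = 0"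
      using t2 c unfolding type_k0_def by blast
    show "\<forall>v. \<omega> c p v \<in> \<real>" using r c unfolding real_form_def by blast
    show "\<exists>v. wedge_pt 2 2 (\<omega> c p) (\<omega> c p) v \<noteq> 0" using n c unfolding nowhere_zero_def wedge_def by blast
    show "wedge_pt 2 2 (\<omega> c p) (\<omega> c p) = (\<lambda>v. 1 / 2 * wedge_pt 2 2 (\<Omega> c p) (\<lambda>v. cnj (\<Omega> c p v)) v)"
      using at(2) by (simp only: wedge_def scale_form_def cnj_form_def)
    show "wedge_pt 2 2 (\<omega> c p) (\<Omega> c p) = (\<lambda>v. 0)" "wedge_pt 2 2 (\<Omega> c p) (\<Omega> c p) = (\<lambda>v. 0)"
      using at(3,4) by (simp_all only: wedge_def zero_form_def)
    show "\<forall>v. \<alpha> c p (case_nat (sharp (g c p) (\<lambda>y. Re (cnj (\<alpha> c p (\<lambda>_. y))))) v) +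
       \<i> * \<alpha> c p (case_nat (sharp (g c p) (\<lambda>y. Im (cnj (\<alpha> c p (\<lambda>_. y))))) v) = 2"
      using fun_cong[OF at(1)] unfolding contract_def cnj_form_def by blast
    show "\<forall>v. \<Omega> c p (case_nat (sharp (g c p) (\<lambda>y. Re (\<alpha> c p (\<lambda>_. y)))) v) +
       \<i> * \<Omega> c p (case_nat (sharp (g c p) (\<lambda>y. Im (\<alpha> c p (\<lambda>_. y)))) v) = 0"
      using fun_cong[OF at(5)] unfolding contract_def zero_form_def by blast
    show "\<forall>v. \<omega> c p (case_nat (sharp (g c p) (\<lambda>y. Re (\<alpha> c p (\<lambda>_. y)))) v) +
       \<i> * \<omega> c p (case_nat (sharp (g c p) (\<lambda>y. Im (\<alpha> c p (\<lambda>_. y)))) v) = 0"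
      using fun_cong[OF at(6)] unfolding contract_def zero_form_def by blast
    show "\<forall>v. \<omega> c p v + \<i> / 2 * wedge_pt 1 1 (\<alpha> c p) (\<lambda>v. cnj (\<alpha> c p v)) v =
       complex_of_real (g c p (J c p (v 0)) (v 1))"
      using fun_cong[OF at(7)]
      unfolding SU2_F_def add_form_def scale_form_def wedge_def cnj_form_def fundamental_form_def by blast
  qed
qed

lemma SU2_structureI:
  assumes fields: "endo_field A J" "metric_field A g" "diff_form A 1 \<alpha>" "diff_form A 2 \<omega>"
      "diff_form A 2 \<Omega>"
    and at: "\<And>c p. c \<in> A \<Longrightarrow> p \<in> chart_dom c \<Longrightarrow> SU2_at (J c p) (g c p) (\<alpha> c p) (\<omega> c p) (\<Omega> c p)"
  shows "SU2_structure A J g \<alpha> \<omega> \<Omega>"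
proof -
  have pt: "SU2_point (J c p) (g c p) (\<alpha> c p) (\<omega> c p) (\<Omega> c p)" if "c \<in> A" "p \<in> chart_dom c" for c p
    using at[OF that] by unfold_locales simp_all
  note C = SU2_point.conditions[OF pt]
  show ?thesis
    unfolding SU2_structure_def almost_hermitian_def
  proof (intro conjI fields)
    show "\<forall>c\<in>A. \<forall>p\<in>chart_dom c. (\<forall>x. J c p (J c p x) = - x) \<and> (\<forall>x y. g c p (J c p x) (J c p y) =
        g c p x y)"
      using C(5,6) by blast
    show "type_k0 A J 1 \<alpha>" using C(8) unfolding type_k0_def by blast
    show "type_k0 A J 2 \<Omega>" using C(12) unfolding type_k0_def by blast
    show "real_form A \<omega>" using C(18) unfolding real_form_def by blast
    show "nowhere_zero A (wedge 2 2 \<omega> \<omega>)" using C(14) unfolding nowhere_zero_def wedge_def by blast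
    show "eq_on A (contract g (cnj_form \<alpha>) \<alpha>) (\<lambda>c p v. 2)"
      unfolding eq_on_def contract_def cnj_form_def using C(9) by (intro ballI ext) blast
    show "eq_on A (wedge 2 2 \<omega> \<omega>) ((1 / 2) \<odot>\<^sub>F wedge 2 2 \<Omega> (cnj_form \<Omega>))"
      unfolding eq_on_def wedge_def scale_form_def cnj_form_def using C(13) by blast
    show "eq_on A (wedge 2 2 \<omega> \<Omega>) zero_form" "eq_on A (wedge 2 2 \<Omega> \<Omega>) zero_form"
      unfolding eq_on_def wedge_def zero_form_def using C(15,16) by blast+
    show "eq_on A (contract g \<alpha> \<Omega>) zero_form"
      unfolding eq_on_def contract_def zero_form_def using C(19) by (intro ballI ext) blast
    show "eq_on A (contract g \<alpha> \<omega>) zero_form"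
      unfolding eq_on_def contract_def zero_form_def using C(20) by (intro ballI ext) blast
    show "eq_on A (SU2_F \<alpha> \<omega>) (fundamental_form J g)"
      unfolding eq_on_def SU2_F_def add_form_def scale_form_def wedge_def cnj_form_def fundamental_form_def
      using C(17) by (intro ballI ext) blast
  qed
qed

context manifold6
begin

text \<open>
  The Jacobian is an isometry between the two representatives of the metric, hence injective.
\<close>

lemma jacobian_surj:
  assumes g: "metric_field A g" and c: "c \<in> A" "c' \<in> A" and p: "p \<in> chart_dom c" "p \<in> chart_dom c'"
  shows "surj (jacobian c c' p)"
proof (rule linear_injective_imp_surjective)
  have iso: "g c p x y = g c' p (jacobian c c' p x) (jacobian c c' p y)" for x y
    using g c p unfolding metric_field_def by blast
  have b: "bilinear (g c' p)" and pos: "x \<noteq> 0 \<Longrightarrow> g c p x x > 0" for x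
    using g c p unfolding metric_field_def by blast+
  show lin: "linear (jacobian c c' p)" by (rule linear_jacobian[OF c p])
  show "inj (jacobian c c' p)"
    unfolding linear_injective_0[OF lin]
  proof (intro allI impI)
    fix x assume "jacobian c c' p x = 0"
    then have "g c p x x = 0" by (simp add: iso bilinear_lzero[OF b])
    then show "x = 0" using pos[of x] by auto
  qed
qed simp

lemma inner_product_at: "metric_field A g \<Longrightarrow> c \<in> A \<Longrightarrow> p \<in> chart_dom c \<Longrightarrow> inner_product_at (g c p)"
  unfolding metric_field_def by unfold_locales blast+

text \<open>
  Raising an index of a 2-form yields an endomorphism field: the components of \<open>J x\<close> solve a linear
  system whose matrix is the Gram matrix of \<open>g\<close>, and the transformation law follows from
  nondegeneracy.
\<close>

lemma endo_field_sharp: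
  assumes g: "metric_field A g" and B: "diff_form A 2 B"
  defines "J \<equiv> \<lambda>c p x. sharp (g c p) (\<lambda>y. Re (B c p (pair_args x y)))"
  shows "endo_field A J"
proof -
  have bil: "bilinear (\<lambda>x y. Re (B c p (pair_args x y)))" if "c \<in> A" "p \<in> chart_dom c" for c p
    unfolding bilinear_def
    using linear_compose[OF alt_form_2_linear(1)[OF diff_form_alt[OF B that]]
        bounded_linear.linear[OF bounded_linear_Re]]
      linear_compose[OF alt_form_2_linear(2)[OF diff_form_alt[OF B that]]
      bounded_linear.linear[OF bounded_linear_Re]]
    by (simp add: o_def)
  have J: "g c p (J c p x) y = Re (B c p (pair_args x y))" if "c \<in> A" "p \<in> chart_dom c" for c p x y
    unfolding J_def
    by (rule inner_product_at.sharp_works[OF inner_product_at[OF g that]])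
       (rule bil[OF that, unfolded bilinear_def, THEN conjunct1, rule_format])
  show ?thesis
    unfolding endo_field_def
  proof (intro conjI ballI allI)
    fix c p assume "c \<in> A" "p \<in> chart_dom c"
    then show "linear (J c p)"
      unfolding J_def using inner_product_at.linear_sharp[OF inner_product_at[OF g] bil] by blast
  next
    fix c x assume c: "c \<in> A"
    let ?S = "chart_map c ` chart_dom c"
    let ?G = "\<lambda>p. (\<chi> i j. g c p (axis j 1) (axis i 1)) :: real^6^6"
    have Gmult: "(?G p *v z) $ i = g c p z (axis i 1)" if p: "p \<in> chart_dom c" for p z i
    proof -
      interpret inner_product_at "g c p" by (rule inner_product_at[OF g c p])
      have "g c p z (axis i 1) = g c p (\<Sum>j\<in>UNIV. z $ j *\<^sub>R axis j 1) (axis i 1)"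
        by (simp only: basis_expansion scalar_mult_eq_scaleR[symmetric])
      also have "\<dots> = (\<Sum>j\<in>UNIV. z $ j * g c p (axis j 1) (axis i 1))"
        by (simp only: linear_sum[OF g_linear(1)] g_left real_scaleR_def)
      finally show ?thesis by (simp add: matrix_vector_mult_def mult.commute)
    qed
    have det: "det (?G p) \<noteq> 0" if p: "p \<in> chart_dom c" for p
    proof -
      interpret inner_product_at "g c p" by (rule inner_product_at[OF g c p])
      have "z = 0" if "?G p *v z = 0" for z
      proof -
        have "g c p z (axis i 1) = 0" for i using Gmult[OF p, of z i] that by simp
        then have "g c p z (\<Sum>j\<in>UNIV. z $ j *\<^sub>R axis j 1) = 0"
          by (simp only: linear_sum[OF g_linear(2)] g_right) simp
        then have "g c p z z = 0" by (simp only: basis_expansion scalar_mult_eq_scaleR[symmetric])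
        then show ?thesis using pos[of z] by auto
      qed
      then have "\<exists>M. M ** ?G p = mat 1" by (simp only: matrix_left_invertible_ker) blast
      then show ?thesis by (simp only: invertible_left_inverse[symmetric] invertible_det_nz) simp
    qed
    show "smooth_rep c (\<lambda>p. J c p x)"
      unfolding smooth_rep_def
    proof (rule smooth_on_linear_solution[OF open_chart_image[OF c], where G = "\<lambda>y. ?G (chart_inv c y)"
    and
        b = "\<lambda>y. \<chi> i. Re (B c (chart_inv c y) (pair_args x (axis i 1)))"])
      have "smooth_rep c (\<lambda>p. g c p u w)" for u w
        using g c unfolding metric_field_def by blast
      then show "smooth_on ?S (\<lambda>y. ?G (chart_inv c y) $ i $ j)" for i j
        by (simp add: smooth_rep_def)
      have "smooth_rep c (\<lambda>p. Re (B c p w))" for w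
        by (rule smooth_rep_bounded_linear[OF c bounded_linear_Re diff_form_smooth[OF B c]])
      then show "smooth_on ?S (\<lambda>y. (\<chi> i. Re (B c (chart_inv c y) (pair_args x (axis i 1)))) $ i)" for i
        by (simp add: smooth_rep_def)
      show "det (?G (chart_inv c y)) \<noteq> 0" if "y \<in> ?S" for y
        by (rule det[OF chart_inv_in_dom[OF that]])
      show "?G (chart_inv c y) *v J c (chart_inv c y) x =
          (\<chi> i. Re (B c (chart_inv c y) (pair_args x (axis i 1))))"
        if "y \<in> ?S" for y
        unfolding vec_eq_iff
          by (simp only: Gmult[OF chart_inv_in_dom[OF that]] J[OF c chart_inv_in_dom[OF that]]
              vec_lambda_beta) simp
    qed
  next
    fix c c' p x assume c: "c \<in> A" "c' \<in> A" and "p \<in> chart_dom c \<inter> chart_dom c'"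
    then have p: "p \<in> chart_dom c" "p \<in> chart_dom c'" by auto
    let ?j = "jacobian c c' p"
    show "?j (J c p x) = J c' p (?j x)"
    proof (rule inner_product_at.g_eq[OF inner_product_at[OF g c(2) p(2)]])
      fix y
      obtain z where y: "y = ?j z" using jacobian_surj[OF g c p] by (metis surjD)
      have "g c' p (?j (J c p x)) (?j z) = g c p (J c p x) z"
        using g c p unfolding metric_field_def by (metis IntI)
      also have "\<dots> = Re (B c' p (\<lambda>i. ?j (pair_args x z i)))"
        unfolding J[OF c(1) p(1)] by (simp only: diff_form_transform[OF B c p])
      also have "(\<lambda>i. ?j (pair_args x z i)) = pair_args (?j x) (?j z)"
        by (auto simp: fun_eq_iff split: nat.split)
      finally show "g c' p (?j (J c p x)) y = g c' p (J c' p (?j x)) y"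
        unfolding y J[OF c(2) p(2)] .
    qed
  qed
qed

lemma metric_field_squash:
  assumes g: "metric_field A g" and \<alpha>: "diff_form A 1 \<alpha>"
    and pos: "\<And>c p. c \<in> A \<Longrightarrow> p \<in> chart_dom c \<Longrightarrow>
      inner_product_at (\<lambda>x y. g c p x y + r * (Im (\<alpha> c p (\<lambda>_. x)) * Im (\<alpha> c p (\<lambda>_. y))))"
  shows "metric_field A (\<lambda>c p x y. g c p x y + r * (Im (\<alpha> c p (\<lambda>_. x)) * Im (\<alpha> c p (\<lambda>_. y))))"
  unfolding metric_field_def
proof (intro conjI ballI allI impI)
  fix c p assume c: "c \<in> A" "p \<in> chart_dom c"
  show "bilinear (\<lambda>x y. g c p x y + r * (Im (\<alpha> c p (\<lambda>_. x)) * Im (\<alpha> c p (\<lambda>_. y))))"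
    by (rule inner_product_at.bil[OF pos[OF c]])
  show "g c p x y + r * (Im (\<alpha> c p (\<lambda>_. x)) * Im (\<alpha> c p (\<lambda>_. y))) =
      g c p y x + r * (Im (\<alpha> c p (\<lambda>_. y)) * Im (\<alpha> c p (\<lambda>_. x)))" for x y
    by (rule inner_product_at.sym[OF pos[OF c]])
  show "x \<noteq> 0 \<Longrightarrow> 0 < g c p x x + r * (Im (\<alpha> c p (\<lambda>_. x)) * Im (\<alpha> c p (\<lambda>_. x)))" for x
    by (rule inner_product_at.pos[OF pos[OF c]])
next
  fix c x y assume c: "c \<in> A"
  have "smooth_rep c (\<lambda>p. g c p x y)" using g c unfolding metric_field_def by blast
  then show "smooth_rep c (\<lambda>p. g c p x y + r * (Im (\<alpha> c p (\<lambda>_. x)) * Im (\<alpha> c p (\<lambda>_. y))))"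
    by (intro smooth_rep_add[OF c] smooth_rep_mult[OF c] smooth_rep_const
        smooth_rep_bounded_linear[OF c bounded_linear_Im diff_form_smooth[OF \<alpha> c]])
next
  fix c c' p x y assume c: "c \<in> A" "c' \<in> A" and "p \<in> chart_dom c \<inter> chart_dom c'"
  then have p: "p \<in> chart_dom c" "p \<in> chart_dom c'" by auto
  have "g c p x y = g c' p (jacobian c c' p x) (jacobian c c' p y)"
    using g c p unfolding metric_field_def by (metis IntI)
  then show "g c p x y + r * (Im (\<alpha> c p (\<lambda>_. x)) * Im (\<alpha> c p (\<lambda>_. y))) =
      g c' p (jacobian c c' p x) (jacobian c c' p y) +
        r * (Im (\<alpha> c' p (\<lambda>_. jacobian c c' p x)) * Im (\<alpha> c' p (\<lambda>_. jacobian c c' p y)))"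
    by (simp only: diff_form_transform[OF \<alpha> c p])
qed

lemma SU2_structure_cong:
  assumes S: "SU2_structure A J g \<alpha> \<omega> \<Omega>"
    and forms: "diff_form A 1 \<alpha>'" "diff_form A 2 \<omega>'" "diff_form A 2 \<Omega>'"
    and eq: "eq_on A \<alpha> \<alpha>'" "eq_on A \<omega> \<omega>'" "eq_on A \<Omega> \<Omega>'"
  shows "SU2_structure A J g \<alpha>' \<omega>' \<Omega>'"
proof (rule SU2_structureI[OF SU2_structureD(1,2)[OF S] forms])
  fix c p assume c: "c \<in> A" "p \<in> chart_dom c"
  then have "\<alpha> c p = \<alpha>' c p" "\<omega> c p = \<omega>' c p" "\<Omega> c p = \<Omega>' c p"
    using eq unfolding eq_on_def by blast+
  then show "SU2_at (J c p) (g c p) (\<alpha>' c p) (\<omega>' c p) (\<Omega>' c p)"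
    using SU2_structureD(6)[OF S c] by (simp only:)
qed

lemma SU2_pointI:
  "SU2_structure A J g \<alpha> \<omega> \<Omega> \<Longrightarrow> c \<in> A \<Longrightarrow> p \<in> chart_dom c \<Longrightarrow>
   SU2_point (J c p) (g c p) (\<alpha> c p) (\<omega> c p) (\<Omega> c p)"
  by unfold_locales (simp_all add: SU2_structureD(6))

lemma SU2_structure_phase:
  assumes S: "SU2_structure A J g \<alpha> \<omega> \<Omega>" and u: "u * cnj u = 1"
  shows "SU2_structure A J g \<alpha> \<omega> (u \<odot>\<^sub>F \<Omega>)"
proof (rule SU2_structureI[OF SU2_structureD(1-4)[OF S] diff_form_scale[OF SU2_structureD(5)[OF S]]])
  fix c p assume c: "c \<in> A" "p \<in> chart_dom c"
  show "SU2_at (J c p) (g c p) (\<alpha> c p) (\<omega> c p) ((u \<odot>\<^sub>F \<Omega>) c p)"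
    unfolding scale_form_def by (rule SU2_point.phase[OF SU2_pointI[OF S c] u])
qed

lemma SU2_structure_rotate_squash:
  fixes k l t :: real
  assumes S: "SU2_structure A J g \<alpha> \<omega> \<Omega>" and kl: "k\<^sup>2 + l\<^sup>2 = 1" and t: "t > 0"
  shows "\<exists>J' g'. SU2_structure A J' g' (Re_form \<alpha> \<oplus>\<^sub>F (\<i> * of_real t) \<odot>\<^sub>F Im_form \<alpha>)
    (of_real k \<odot>\<^sub>F \<omega> \<oplus>\<^sub>F of_real l \<odot>\<^sub>F Re_form \<Omega>)
    (of_real k \<odot>\<^sub>F Re_form \<Omega> \<oplus>\<^sub>F (- of_real l) \<odot>\<^sub>F \<omega> \<oplus>\<^sub>F \<i> \<odot>\<^sub>F Im_form \<Omega>)"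
proof -
  note D = SU2_structureD[OF S]
  let ?\<alpha> = "Re_form \<alpha> \<oplus>\<^sub>F (\<i> * of_real t) \<odot>\<^sub>F Im_form \<alpha>"
  let ?\<omega> = "of_real k \<odot>\<^sub>F \<omega> \<oplus>\<^sub>F of_real l \<odot>\<^sub>F Re_form \<Omega>"
  let ?\<Omega> = "of_real k \<odot>\<^sub>F Re_form \<Omega> \<oplus>\<^sub>F (- of_real l) \<odot>\<^sub>F \<omega> \<oplus>\<^sub>F \<i> \<odot>\<^sub>F Im_form \<Omega>"
  let ?g = "\<lambda>c p x y. g c p x y + (t\<^sup>2 - 1) * (Im (\<alpha> c p (\<lambda>_. x)) * Im (\<alpha> c p (\<lambda>_. y)))"
  let ?F = "SU2_F ?\<alpha> ?\<omega>"
  let ?J = "\<lambda>c p x. sharp (?g c p) (\<lambda>y. Re (?F c p (pair_args x y)))"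
  have \<alpha>': "diff_form A 1 ?\<alpha>" by (intro diff_form_add diff_form_scale diff_form_Re diff_form_Im D)
  have \<omega>': "diff_form A 2 ?\<omega>" by (intro diff_form_add diff_form_scale diff_form_Re diff_form_Im D)
  have \<Omega>': "diff_form A 2 ?\<Omega>" by (intro diff_form_add diff_form_scale diff_form_Re diff_form_Im D)
  have "diff_form A (1 + 1) (wedge 1 1 ?\<alpha> (cnj_form ?\<alpha>))"
    by (intro diff_form_wedge \<alpha>' diff_form_cnj)
  then have F': "diff_form A 2 ?F"
    unfolding SU2_F_def one_add_one by (intro diff_form_add diff_form_scale \<omega>')
  have at: "SU2_at (?J c p) (?g c p) (?\<alpha> c p) (?\<omega> c p) (?\<Omega> c p)" if c: "c \<in> A" "p \<in> chart_dom c" for c p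
    using SU2_point.rotate_squash[OF SU2_pointI[OF S c] kl t]
    by (simp only: SU2_F_def add_form_def scale_form_def Re_form_def Im_form_def cnj_form_def wedge_def
        diff_conv_add_uminus mult_minus_left)
  have g': "metric_field A ?g"
  proof (rule metric_field_squash[OF D(2,3)])
    fix c p assume c: "c \<in> A" "p \<in> chart_dom c"
    interpret SU2_point "?J c p" "?g c p" "?\<alpha> c p" "?\<omega> c p" "?\<Omega> c p"
      using at[OF c] by unfold_locales simp_all
    show "inner_product_at (?g c p)" by (rule inner_product_at_axioms)
  qed
  show ?thesis
    by (intro exI, rule SU2_structureI[OF endo_field_sharp[OF g' F'] g' \<alpha>' \<omega>' \<Omega>' at])
qed

lemma SU2_structure_imp_SU3:
  assumes S: "SU2_structure A J g \<alpha> \<omega> \<Omega>"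
  shows "SU3_structure A J g (SU2_F \<alpha> \<omega>) (SU2_Psi \<alpha> \<Omega>)"
proof -
  note D = SU2_structureD[OF S]
  have herm: "almost_hermitian A J g" "eq_on A (SU2_F \<alpha> \<omega>) (fundamental_form J g)"
    using S[unfolded SU2_structure_def] by - (elim conjE, assumption)+
  have \<Psi>: "diff_form A 3 (SU2_Psi \<alpha> \<Omega>)"
    using diff_form_wedge[OF D(3,5)] by (simp add: SU2_Psi_def numeral_3_eq_3)
  note P = SU2_point.SU3_at[OF SU2_pointI[OF S]]
  note defs = SU2_F_def SU2_Psi_def add_form_def scale_form_def cnj_form_def wedge_def zero_form_def
  show ?thesis
    unfolding SU3_structure_def
  proof (intro conjI herm \<Psi>)
    show "type_k0 A J 3 (SU2_Psi \<alpha> \<Omega>)"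
      unfolding type_k0_def defs by (intro ballI allI impI P(1))
    show "eq_on A (wedge 2 3 (SU2_F \<alpha> \<omega>) (SU2_Psi \<alpha> \<Omega>)) zero_form"
      unfolding eq_on_def defs by (intro ballI P(2))
    show "eq_on A ((4 / 3) \<odot>\<^sub>F wedge 4 2 (wedge 2 2 (SU2_F \<alpha> \<omega>) (SU2_F \<alpha> \<omega>)) (SU2_F \<alpha> \<omega>))
        (\<i> \<odot>\<^sub>F wedge 3 3 (SU2_Psi \<alpha> \<Omega>) (cnj_form (SU2_Psi \<alpha> \<Omega>)))"
      unfolding eq_on_def defs by (intro ballI ext P(3))
    show "nowhere_zero A (wedge 3 3 (SU2_Psi \<alpha> \<Omega>) (cnj_form (SU2_Psi \<alpha> \<Omega>)))"
      unfolding nowhere_zero_def defs by (intro ballI P(4))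
  qed
qed

end


section \<open>Half-flatness and the SUSY equations\<close>

lemma eq_on_trans: "eq_on A S T \<Longrightarrow> eq_on A T U \<Longrightarrow> eq_on A S U"
  by (simp add: eq_on_def)

lemma eq_on_sym: "eq_on A S T \<Longrightarrow> eq_on A T S"
  by (simp add: eq_on_def)

context manifold6
begin

lemma ext_d_wedge_at:
  assumes "diff_form A k a" "diff_form A l b" "c \<in> A" "p \<in> chart_dom c"
  shows "ext_d (k + l) (wedge k l a b) c p =
    (\<lambda>v. wedge_pt (Suc k) l (ext_d k a c p) (b c p) v +
    (- 1) ^ k * wedge_pt k (Suc l) (a c p) (ext_d l b c p) v)"
  using ext_d_wedge[OF assms(1,2)] assms(3,4)
  by (simp add: eq_on_def add_form_def scale_form_def wedge_def)

lemma ext_d_add_at: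
  "diff_form A k a \<Longrightarrow> diff_form A k b \<Longrightarrow> c \<in> A \<Longrightarrow> p \<in> chart_dom c \<Longrightarrow>
   ext_d k (a \<oplus>\<^sub>F b) c p v = ext_d k a c p v + ext_d k b c p v"
  using ext_d_add[of k a b] by (simp add: eq_on_def add_form_def)

lemma ext_d_scale_at:
  "diff_form A k a \<Longrightarrow> c \<in> A \<Longrightarrow> p \<in> chart_dom c \<Longrightarrow> ext_d k (z \<odot>\<^sub>F a) c p v = z * ext_d k a c p v"
  using ext_d_scale[of k a z] by (simp add: eq_on_def scale_form_def)

lemma ext_d_wedge_self_closed:
  assumes F: "diff_form A 2 F" and dF: "eq_on A (ext_d 2 F) zero_form"
  shows "eq_on A (ext_d 4 (wedge 2 2 F F)) zero_form"
  unfolding eq_on_def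
proof (intro ballI)
  fix c p assume c: "c \<in> A" "p \<in> chart_dom c"
  have 0: "ext_d 2 F c p = (\<lambda>v. 0)" using dF c by (simp add: eq_on_def zero_form_def)
  show "ext_d 4 (wedge 2 2 F F) c p = zero_form c p"
    using ext_d_wedge_at[OF F F c]
    by (simp add: 0 wedge_pt_zero_left wedge_pt_zero_right zero_form_def)
qed

text \<open>
  Half-flatness of the hatted forms in terms of the projections \<open>P\<close>, \<open>Q\<close> and of \<open>I\<close>. Here
  \<open>F = Q / l + k a \<and> b\<close> and \<open>Re \<Psi> = a \<and> I + b \<and> P\<close>, where the constants \<open>k\<close> and \<open>1 / k\<close> in \<open>\<alpha>h\<close> and
  \<open>\<Omega>h\<close> cancel. With \<open>da = 0\<close> the Leibniz rule turns \<open>dF = 0\<close> into the equation for \<open>dQ\<close> and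
  \<open>d Re \<Psi> = 0\<close> into \<open>d(b \<and> P) = a \<and> dI\<close>. The latter is the equation for \<open>H \<and> a\<close>, since
  \<open>H = (l / k) dI\<close> and a 3-form anticommutes with a 1-form.
\<close>

lemma half_flat_iff_IIA_equations:
  fixes k l :: real
  assumes \<alpha>: "diff_form A 1 \<alpha>" and P: "diff_form A 2 P" and Q: "diff_form A 2 Q" and I: "diff_form A 2 I"
    and rP: "real_form A P" and rI: "real_form A I" and k: "k > 0" and l: "l > 0"
    and da: "eq_on A (ext_d 1 (Re_form \<alpha>)) zero_form"
  defines "\<alpha>h \<equiv> Re_form \<alpha> \<oplus>\<^sub>F (\<i> * of_real k) \<odot>\<^sub>F Im_form \<alpha>"
    and "\<omega>h \<equiv> of_real (1 / l) \<odot>\<^sub>F Q"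
    and "\<Omega>h \<equiv> I \<oplus>\<^sub>F (- \<i> * of_real (1 / k)) \<odot>\<^sub>F P"
  shows "eq_on A (ext_d 2 (SU2_F \<alpha>h \<omega>h)) zero_form \<and>
      eq_on A (ext_d 3 (Re_form (SU2_Psi \<alpha>h \<Omega>h))) zero_form \<longleftrightarrow>
    IIA_equations A k l \<alpha> P Q I"
proof -
  let ?a = "Re_form \<alpha>" and ?b = "Im_form \<alpha>"
  have a: "diff_form A 1 ?a" and b: "diff_form A 1 ?b"
    by (intro diff_form_Re diff_form_Im \<alpha>)+
  have ab: "diff_form A 2 (wedge 1 1 ?a ?b)" and aI: "diff_form A 3 (wedge 1 2 ?a I)"
    and bP: "diff_form A 3 (wedge 1 2 ?b P)"
    using diff_form_wedge[OF a b] diff_form_wedge[OF a I] diff_form_wedge[OF b P]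
    by (simp_all add: numeral_2_eq_2 numeral_3_eq_3)
  have da0: "ext_d 1 ?a c p = (\<lambda>v. 0)" if "c \<in> A" "p \<in> chart_dom c" for c p
    using da that by (simp add: eq_on_def zero_form_def)

  have F: "eq_on A (SU2_F \<alpha>h \<omega>h) (of_real (1 / l) \<odot>\<^sub>F Q \<oplus>\<^sub>F of_real k \<odot>\<^sub>F wedge 1 1 ?a ?b)"
    unfolding eq_on_def
  proof (intro ballI ext)
    fix c p v assume c: "c \<in> A" "p \<in> chart_dom c"
    have aa: "alt_form 1 (\<alpha>h c p)" "alt_form 1 (cnj_form \<alpha>h c p)" "alt_form 1 (?a c p)"
        "alt_form 1 (?b c p)"
      unfolding \<alpha>h_def by (intro diff_form_alt[OF _ c] diff_form_cnj diff_form_add diff_form_scale a b)+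
    show "SU2_F \<alpha>h \<omega>h c p v = (of_real (1 / l) \<odot>\<^sub>F Q \<oplus>\<^sub>F of_real k \<odot>\<^sub>F wedge 1 1 ?a ?b) c p v"
      unfolding SU2_F_def add_form_def scale_form_def wedge_def \<omega>h_def
        wedge_pt_1_1[OF aa(1,2)] wedge_pt_1_1[OF aa(3,4)]
      unfolding \<alpha>h_def cnj_form_def add_form_def scale_form_def Re_form_def Im_form_def
      by (simp add: complex_eq_iff field_simps)
  qed
  have dF: "ext_d 2 (SU2_F \<alpha>h \<omega>h) c p v =
      of_real (1 / l) * (ext_d 2 Q c p v - of_real (k * l) * wedge_pt 1 2 (?a c p) (ext_d 1 ?b c p) v)"
    if c: "c \<in> A" "p \<in> chart_dom c" for c p v
  proof -
    have "ext_d 2 (SU2_F \<alpha>h \<omega>h) c p v =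
        ext_d 2 (of_real (1 / l) \<odot>\<^sub>F Q \<oplus>\<^sub>F of_real k \<odot>\<^sub>F wedge 1 1 ?a ?b) c p v"
      using ext_d_cong[OF F] c unfolding eq_on_def by simp
    also have "\<dots> = of_real (1 / l) * ext_d 2 Q c p v + of_real k * ext_d 2 (wedge 1 1 ?a ?b) c p v"
      by (simp only: ext_d_add_at[OF diff_form_scale[OF Q] diff_form_scale[OF ab] c]
          ext_d_scale_at[OF Q c]
          ext_d_scale_at[OF ab c])
    also have "ext_d 2 (wedge 1 1 ?a ?b) c p v = - wedge_pt 1 2 (?a c p) (ext_d 1 ?b c p) v"
      using ext_d_wedge_at[OF a b c] da0[OF c] by (simp add: numeral_2_eq_2 wedge_pt_zero_left)
    finally show ?thesis using l by (simp add: field_simps)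
  qed

  have Psi: "eq_on A (Re_form (SU2_Psi \<alpha>h \<Omega>h)) (wedge 1 2 ?a I \<oplus>\<^sub>F wedge 1 2 ?b P)"
    unfolding eq_on_def
  proof (intro ballI ext)
    fix c p v assume c: "c \<in> A" "p \<in> chart_dom c"
    have ims: "Im (?a c p v) = 0" "Im (?b c p v) = 0" "Im (I c p v) = 0" "Im (P c p v) = 0" for v
      using rI rP c by (auto simp: Re_form_def Im_form_def real_form_def complex_is_Real_iff)
    note re = wedge_pt_real[of "?a c p" "I c p"] wedge_pt_real[of "?a c p" "P c p"]
      wedge_pt_real[of "?b c p" "I c p"] wedge_pt_real[of "?b c p" "P c p"]
    have "SU2_Psi \<alpha>h \<Omega>h c p v = wedge_pt 1 2 (?a c p) (I c p) v + wedge_pt 1 2 (?b c p) (P c p) v +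
        \<i> * (of_real k * wedge_pt 1 2 (?b c p) (I c p) v -
        of_real (1 / k) * wedge_pt 1 2 (?a c p) (P c p) v)"
      unfolding SU2_Psi_def wedge_def \<alpha>h_def \<Omega>h_def add_form_def scale_form_def wedge_pt_bilinear
      using k by (simp add: algebra_simps)
    then show "Re_form (SU2_Psi \<alpha>h \<Omega>h) c p v = (wedge 1 2 ?a I \<oplus>\<^sub>F wedge 1 2 ?b P) c p v"
      using re ims by (simp add: Re_form_def[of "SU2_Psi _ _"] add_form_def wedge_def complex_eq_iff)
  qed
  have dPsi: "ext_d 3 (Re_form (SU2_Psi \<alpha>h \<Omega>h)) c p v =
      ext_d 3 (wedge 1 2 ?b P) c p v - wedge_pt 1 3 (?a c p) (ext_d 2 I c p) v"
    if c: "c \<in> A" "p \<in> chart_dom c" for c p v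
  proof -
    have "ext_d 3 (Re_form (SU2_Psi \<alpha>h \<Omega>h)) c p v = ext_d 3 (wedge 1 2 ?a I \<oplus>\<^sub>F wedge 1 2 ?b P) c p v"
      using ext_d_cong[OF Psi] c unfolding eq_on_def by simp
    also have "\<dots> = ext_d 3 (wedge 1 2 ?a I) c p v + ext_d 3 (wedge 1 2 ?b P) c p v"
      by (rule ext_d_add_at[OF aI bP c])
    also have "ext_d 3 (wedge 1 2 ?a I) c p v = - wedge_pt 1 3 (?a c p) (ext_d 2 I c p) v"
      using ext_d_wedge_at[OF a I c] da0[OF c] by (simp add: numeral_3_eq_3 wedge_pt_zero_left)
    finally show ?thesis by simp
  qed

  define r where "r = l / k"
  have r: "r > 0" "l = r * k" using k l by (simp_all add: r_def)
  \<comment> \<open>The only candidate for \<open>H\<close>.\<close>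
  define H0 where "H0 = complex_of_real r \<odot>\<^sub>F ext_d 2 I"
  have H0: "diff_form A 3 H0" unfolding H0_def by (intro diff_form_scale diff_form_ext_d_2 I)
  let ?U = "complex_of_real (- r) \<odot>\<^sub>F ext_d 3 (wedge 1 2 ?b P)"
  have HF: "wedge 3 1 H0 ?a c p v = - (of_real r * wedge_pt 1 3 (?a c p) (ext_d 2 I c p) v)"
    if c: "c \<in> A" "p \<in> chart_dom c" for c p v
    using wedge_pt_commute[OF diff_form_alt[OF diff_form_ext_d_2[OF I] c] diff_form_alt[OF a c], of v]
    unfolding H0_def wedge_def scale_form_def wedge_pt_scale_left by simp

  have q1: "eq_on A (ext_d 2 (SU2_F \<alpha>h \<omega>h)) zero_form \<longleftrightarrow>
      eq_on A (ext_d 2 Q) (of_real (k * l) \<odot>\<^sub>F wedge 1 2 ?a (ext_d 1 ?b))"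
    using l by (auto simp: eq_on_def zero_form_def fun_eq_iff dF scale_form_def wedge_def)
  have q2: "eq_on A (ext_d 3 (Re_form (SU2_Psi \<alpha>h \<Omega>h))) zero_form \<longleftrightarrow> eq_on A (wedge 3 1 H0 ?a) ?U"
  proof -
    have "ext_d 3 (Re_form (SU2_Psi \<alpha>h \<Omega>h)) c p v = zero_form c p v \<longleftrightarrow> wedge 3 1 H0 ?a c p v = ?U c p v"
      if "c \<in> A" "p \<in> chart_dom c" for c p v
      unfolding dPsi[OF that] HF[OF that] using r(1) by (auto simp: zero_form_def scale_form_def)
    then show ?thesis unfolding eq_on_def fun_eq_iff by blast
  qed
  have q3: "eq_on A (of_real k \<odot>\<^sub>F H) (of_real l \<odot>\<^sub>F ext_d 2 I) \<longleftrightarrow> eq_on A H H0" for H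
  proof -
    have "of_real k * x = of_real l * y \<longleftrightarrow> x = of_real r * y" for x y :: complex
      using k by (simp add: r(2))
    then show ?thesis by (simp only: eq_on_def H0_def scale_form_def fun_eq_iff)
  qed
  have q4: "eq_on A (wedge 3 1 H ?a) ?U \<longleftrightarrow> eq_on A (wedge 3 1 H0 ?a) ?U" if "eq_on A H H0" for H
    using that by (simp add: eq_on_def wedge_def)
  have refl: "eq_on A H0 H0" by (simp add: eq_on_def)
  show ?thesis
    unfolding IIA_equations_def q1 q2 q3 r_def[symmetric]
    using da q4 H0 refl by blast
qed

text \<open>
  The \<open>SU(3)\<close> identities are those of \<open>SU2_structure_imp_SU3\<close>, and \<open>d(F \<and> F) = 2 F \<and> dF\<close>.
\<close>

lemma symplectic_half_flat_SU2_iff: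
  assumes S: "SU2_structure A J g \<alpha> \<omega> \<Omega>"
  shows "symplectic_half_flat_SU2 A J g \<alpha> \<omega> \<Omega> \<longleftrightarrow>
    eq_on A (ext_d 2 (SU2_F \<alpha> \<omega>)) zero_form \<and> eq_on A (ext_d 3 (Re_form (SU2_Psi \<alpha> \<Omega>))) zero_form"
proof -
  note D = SU2_structureD[OF S]
  have "diff_form A (1 + 1) (wedge 1 1 \<alpha> (cnj_form \<alpha>))"
    by (intro diff_form_wedge D diff_form_cnj)
  then have F: "diff_form A 2 (SU2_F \<alpha> \<omega>)"
    unfolding SU2_F_def one_add_one by (intro diff_form_add diff_form_scale D)
  show ?thesis
    unfolding symplectic_half_flat_SU2_def symplectic_half_flat_SU3_def half_flat_SU3_def
    using S SU2_structure_imp_SU3[OF S] ext_d_wedge_self_closed[OF F] by blast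
qed

lemma half_flat_cong:
  assumes "eq_on A \<alpha> \<alpha>'" "eq_on A \<omega> \<omega>'" "eq_on A \<Omega> \<Omega>'"
  shows "eq_on A (ext_d 2 (SU2_F \<alpha> \<omega>)) zero_form \<longleftrightarrow> eq_on A (ext_d 2 (SU2_F \<alpha>' \<omega>')) zero_form"
    and "eq_on A (ext_d 3 (Re_form (SU2_Psi \<alpha> \<Omega>))) zero_form \<longleftrightarrow>
        eq_on A (ext_d 3 (Re_form (SU2_Psi \<alpha>' \<Omega>'))) zero_form"
proof -
  have "eq_on A (SU2_F \<alpha> \<omega>) (SU2_F \<alpha>' \<omega>')" "eq_on A (Re_form (SU2_Psi \<alpha> \<Omega>)) (Re_form (SU2_Psi \<alpha>' \<Omega>'))"
    using assms by (simp_all add: eq_on_def SU2_F_def SU2_Psi_def add_form_def scale_form_def wedge_def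
        cnj_form_def Re_form_def)
  from this[THEN ext_d_cong] show
    "eq_on A (ext_d 2 (SU2_F \<alpha> \<omega>)) zero_form \<longleftrightarrow> eq_on A (ext_d 2 (SU2_F \<alpha>' \<omega>')) zero_form"
    "eq_on A (ext_d 3 (Re_form (SU2_Psi \<alpha> \<Omega>))) zero_form \<longleftrightarrow>
      eq_on A (ext_d 3 (Re_form (SU2_Psi \<alpha>' \<Omega>'))) zero_form"
    by (blast intro: eq_on_trans eq_on_sym)+
qed

end

lemma IIA_angle:
  assumes "0 < kpar" "kpar < 1" "0 < kperp" "kpar\<^sup>2 + kperp\<^sup>2 = 1"
  shows "sin (IIA_angle kpar kperp) = - kpar" "cos (IIA_angle kpar kperp) = kperp"
proof -
  let ?P = "\<lambda>\<phi>. - pi / 2 < \<phi> \<and> \<phi> < 0 \<and> kpar = - sin \<phi> \<and> kperp = cos \<phi>"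
  have "?P (- arcsin kpar)"
  proof (intro conjI)
    show "- pi / 2 < - arcsin kpar" using arcsin_less_arcsin[of kpar 1] assms by simp
    show "- arcsin kpar < 0" using arcsin_less_arcsin[of 0 kpar] assms by simp
    show "kpar = - sin (- arcsin kpar)" using assms by simp
    have "cos (arcsin kpar) = sqrt (1 - kpar\<^sup>2)" using assms by (intro cos_arcsin) auto
    also have "1 - kpar\<^sup>2 = kperp\<^sup>2" using assms by simp
    finally show "kperp = cos (- arcsin kpar)" using assms by simp
  qed
  moreover have "\<phi> = - arcsin kpar" if "?P \<phi>" for \<phi>
  proof -
    have "sin \<phi> = - kpar" using that by simp
    then have "arcsin (sin \<phi>) = - arcsin kpar" using assms by (simp add: arcsin_minus)
    then show ?thesis using that by (simp add: arcsin_sin)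
  qed
  ultimately have "?P (THE \<phi>. ?P \<phi>)" by (rule theI)
  then show "sin (IIA_angle kpar kperp) = - kpar" "cos (IIA_angle kpar kperp) = kperp"
    unfolding IIA_angle_def by simp_all
qed

text \<open>
  Double angle formulas: up to the factors \<open>kpar\<close> and \<open>kperp\<close> the two projections are the components
  of \<open>(Re \<Omega>, \<omega>)\<close> after a rotation.
\<close>

lemma Re_Omega_projections:
  assumes "0 < kpar" "kpar < 1" "0 < kperp" "kpar\<^sup>2 + kperp\<^sup>2 = 1"
  shows "Re_Omega_par kpar kperp \<omega> \<Omega> =
      of_real kpar \<odot>\<^sub>F (of_real kpar \<odot>\<^sub>F Re_form \<Omega> \<oplus>\<^sub>F (- of_real kperp) \<odot>\<^sub>F \<omega>)"
    and "Re_Omega_perp kpar kperp \<omega> \<Omega> =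
      of_real kperp \<odot>\<^sub>F (of_real kpar \<odot>\<^sub>F \<omega> \<oplus>\<^sub>F of_real kperp \<odot>\<^sub>F Re_form \<Omega>)"
proof -
  have s: "sin (2 * IIA_angle kpar kperp) = - 2 * kpar * kperp"
    and c: "1 - cos (2 * IIA_angle kpar kperp) = 2 * kpar\<^sup>2" "1 + cos (2 * IIA_angle kpar kperp) =
        2 * kperp\<^sup>2"
    using assms(4) by (simp_all add: sin_double cos_double IIA_angle[OF assms])
  show "Re_Omega_par kpar kperp \<omega> \<Omega> =
      of_real kpar \<odot>\<^sub>F (of_real kpar \<odot>\<^sub>F Re_form \<Omega> \<oplus>\<^sub>F (- of_real kperp) \<odot>\<^sub>F \<omega>)"
    "Re_Omega_perp kpar kperp \<omega> \<Omega> =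
      of_real kperp \<odot>\<^sub>F (of_real kpar \<odot>\<^sub>F \<omega> \<oplus>\<^sub>F of_real kperp \<odot>\<^sub>F Re_form \<Omega>)"
    unfolding Re_Omega_par_def Re_Omega_perp_def Let_def s c
    by (simp_all add: fun_eq_iff add_form_def scale_form_def power2_eq_square algebra_simps)
qed

theorem theorem3p1:
  fixes X :: "'a topology" and A :: "'a chart set" and kpar kperp :: real
  assumes M: "smooth_manifold6 X A"
    and kpar: "0 < kpar" "kpar < 1"
    and kperp: "0 < kperp" "kperp < 1"
    and k: "kpar ^ 2 + kperp ^ 2 = 1"
  shows
    "(\<forall>J g \<alpha> \<omega> \<Omega>.
        SU2_structure A J g \<alpha> \<omega> \<Omega> \<and>
        IIA_equations A kpar kperp \<alpha>
          (Re_Omega_par kpar kperp \<omega> \<Omega>) (Re_Omega_perp kpar kperp \<omega> \<Omega>) (Im_form \<Omega>) \<longrightarrow>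
        (let \<alpha>h = Re_form \<alpha> \<oplus>\<^sub>F (\<i> * complex_of_real kpar) \<odot>\<^sub>F Im_form \<alpha>;
             \<omega>h = complex_of_real (1 / kperp) \<odot>\<^sub>F Re_Omega_perp kpar kperp \<omega> \<Omega>;
             \<Omega>h = Im_form \<Omega> \<oplus>\<^sub>F
                  (- \<i> * complex_of_real (1 / kpar)) \<odot>\<^sub>F Re_Omega_par kpar kperp \<omega> \<Omega>
         in (\<exists>Jh gh. symplectic_half_flat_SU2 A Jh gh \<alpha>h \<omega>h \<Omega>h) \<and>
            eq_on A (ext_d 1 (Re_form \<alpha>h)) zero_form))
     \<and>
     (\<forall>Jh gh \<alpha>h \<omega>h \<Omega>h \<alpha> Rpar Rperp I.
        symplectic_half_flat_SU2 A Jh gh \<alpha>h \<omega>h \<Omega>h \<and>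
        eq_on A (ext_d 1 (Re_form \<alpha>h)) zero_form \<and>
        diff_form A 1 \<alpha> \<and>
        diff_form A 2 Rpar \<and> real_form A Rpar \<and>
        diff_form A 2 Rperp \<and> real_form A Rperp \<and>
        diff_form A 2 I \<and> real_form A I \<and>
        eq_on A (complex_of_real (1 / kperp) \<odot>\<^sub>F Rperp) \<omega>h \<and>
        eq_on A (I \<oplus>\<^sub>F (- \<i> * complex_of_real (1 / kpar)) \<odot>\<^sub>F Rpar) \<Omega>h \<and>
        eq_on A (Re_form \<alpha> \<oplus>\<^sub>F (\<i> * complex_of_real kpar) \<odot>\<^sub>F Im_form \<alpha>) \<alpha>h \<longrightarrow>
        IIA_solution A kpar kperp \<alpha> Rpar Rperp I)"
proof -
  interpret manifold6 X A by (rule manifold6.intro) (rule M)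
  note proj = Re_Omega_projections[OF kpar kperp(1) k]
  show ?thesis
  proof (intro conjI allI impI)
    fix J g and \<alpha> \<omega> \<Omega> :: "'a form"
    let ?P = "Re_Omega_par kpar kperp \<omega> \<Omega>" and ?Q = "Re_Omega_perp kpar kperp \<omega> \<Omega>"
    let ?\<alpha>h = "Re_form \<alpha> \<oplus>\<^sub>F (\<i> * complex_of_real kpar) \<odot>\<^sub>F Im_form \<alpha>"
    let ?\<omega>h = "complex_of_real (1 / kperp) \<odot>\<^sub>F ?Q"
    let ?\<Omega>h = "Im_form \<Omega> \<oplus>\<^sub>F (- \<i> * complex_of_real (1 / kpar)) \<odot>\<^sub>F ?P"
    assume "SU2_structure A J g \<alpha> \<omega> \<Omega> \<and> IIA_equations A kpar kperp \<alpha> ?P ?Q (Im_form \<Omega>)"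
    then have S: "SU2_structure A J g \<alpha> \<omega> \<Omega>" and IIA: "IIA_equations A kpar kperp \<alpha> ?P ?Q (Im_form \<Omega>)"
      by blast+
    note D = SU2_structureD[OF S]
    have "real_form A \<omega>" using S unfolding SU2_structure_def by blast
    then have rP: "real_form A ?P"
      unfolding proj by (auto simp: real_form_def scale_form_def add_form_def Re_form_def)
    have rI: "real_form A (Im_form \<Omega>)" by (simp add: real_form_def Im_form_def)
    have P: "diff_form A 2 ?P" and Q: "diff_form A 2 ?Q"
      unfolding proj by (intro diff_form_scale diff_form_add diff_form_Re D)+
    have da: "eq_on A (ext_d 1 (Re_form \<alpha>)) zero_form" using IIA unfolding IIA_equations_def by blast
    have "Re_form ?\<alpha>h = Re_form \<alpha>"
      by (simp add: Re_form_def Im_form_def add_form_def scale_form_def)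
    then have da': "eq_on A (ext_d 1 (Re_form ?\<alpha>h)) zero_form" using da by (simp only:)
    obtain J' g' where "SU2_structure A J' g' ?\<alpha>h
        (of_real kpar \<odot>\<^sub>F \<omega> \<oplus>\<^sub>F of_real kperp \<odot>\<^sub>F Re_form \<Omega>)
        (of_real kpar \<odot>\<^sub>F Re_form \<Omega> \<oplus>\<^sub>F (- of_real kperp) \<odot>\<^sub>F \<omega> \<oplus>\<^sub>F \<i> \<odot>\<^sub>F Im_form \<Omega>)"
      using SU2_structure_rotate_squash[OF S k kpar(1)] by blast
    then have "SU2_structure A J' g' ?\<alpha>h
        (of_real kpar \<odot>\<^sub>F \<omega> \<oplus>\<^sub>F of_real kperp \<odot>\<^sub>F Re_form \<Omega>)
        ((- \<i>) \<odot>\<^sub>F (of_real kpar \<odot>\<^sub>F Re_form \<Omega> \<oplus>\<^sub>F (- of_real kperp) \<odot>\<^sub>F \<omega> \<oplus>\<^sub>F \<i> \<odot>\<^sub>F Im_form \<Omega>))"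
      by (rule SU2_structure_phase) simp
    moreover have "of_real kpar \<odot>\<^sub>F \<omega> \<oplus>\<^sub>F of_real kperp \<odot>\<^sub>F Re_form \<Omega> = ?\<omega>h"
      unfolding proj using kperp by (simp add: fun_eq_iff scale_form_def)
    moreover have "(- \<i>) \<odot>\<^sub>F (of_real kpar \<odot>\<^sub>F Re_form \<Omega> \<oplus>\<^sub>F (-
        of_real kperp) \<odot>\<^sub>F \<omega> \<oplus>\<^sub>F \<i> \<odot>\<^sub>F Im_form \<Omega>) = ?\<Omega>h"
      unfolding proj using kpar by (simp add: fun_eq_iff scale_form_def add_form_def algebra_simps)
    ultimately have S': "SU2_structure A J' g' ?\<alpha>h ?\<omega>h ?\<Omega>h" by (simp only:)
    have "symplectic_half_flat_SU2 A J' g' ?\<alpha>h ?\<omega>h ?\<Omega>h"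
      using half_flat_iff_IIA_equations[OF D(3) P Q diff_form_Im[OF D(5)] rP rI kpar(1) kperp(1) da] IIA
        symplectic_half_flat_SU2_iff[OF S'] by blast
    then show "let \<alpha>h = ?\<alpha>h; \<omega>h = ?\<omega>h; \<Omega>h = ?\<Omega>h
      in (\<exists>Jh gh. symplectic_half_flat_SU2 A Jh gh \<alpha>h \<omega>h \<Omega>h) \<and> eq_on A (ext_d 1 (Re_form \<alpha>h)) zero_form"
      unfolding Let_def using da' by blast
  next
    fix Jh gh and \<alpha>h \<omega>h \<Omega>h \<alpha> P Q I :: "'a form"
    let ?\<alpha> = "Re_form \<alpha> \<oplus>\<^sub>F (\<i> * complex_of_real kpar) \<odot>\<^sub>F Im_form \<alpha>"
    let ?\<omega> = "complex_of_real (1 / kperp) \<odot>\<^sub>F Q"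
    let ?\<Omega> = "I \<oplus>\<^sub>F (- \<i> * complex_of_real (1 / kpar)) \<odot>\<^sub>F P"
    assume asm: "symplectic_half_flat_SU2 A Jh gh \<alpha>h \<omega>h \<Omega>h \<and>
        eq_on A (ext_d 1 (Re_form \<alpha>h)) zero_form \<and>
        diff_form A 1 \<alpha> \<and> diff_form A 2 P \<and> real_form A P \<and> diff_form A 2 Q \<and> real_form A Q \<and>
        diff_form A 2 I \<and> real_form A I \<and> eq_on A ?\<omega> \<omega>h \<and> eq_on A ?\<Omega> \<Omega>h \<and> eq_on A ?\<alpha> \<alpha>h"
    then have half_flat: "symplectic_half_flat_SU2 A Jh gh \<alpha>h \<omega>h \<Omega>h"
      and da_h: "eq_on A (ext_d 1 (Re_form \<alpha>h)) zero_form"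
      and \<alpha>: "diff_form A 1 \<alpha>" and P: "diff_form A 2 P" "real_form A P"
      and Q: "diff_form A 2 Q" "real_form A Q" and I: "diff_form A 2 I" "real_form A I"
      and eq: "eq_on A ?\<alpha> \<alpha>h" "eq_on A ?\<omega> \<omega>h" "eq_on A ?\<Omega> \<Omega>h"
      by blast+
    have Sh: "SU2_structure A Jh gh \<alpha>h \<omega>h \<Omega>h"
      using half_flat unfolding symplectic_half_flat_SU2_def by blast
    have "eq_on A (Re_form \<alpha>) (Re_form \<alpha>h)"
      unfolding eq_on_def
    proof (intro ballI)
      fix c p assume "c \<in> A" "p \<in> chart_dom c"
      then have "\<alpha>h c p = ?\<alpha> c p" using eq(1) unfolding eq_on_def by simp
      then show "Re_form \<alpha> c p = Re_form \<alpha>h c p"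
        by (simp add: Re_form_def Im_form_def add_form_def scale_form_def)
    qed
    then have da: "eq_on A (ext_d 1 (Re_form \<alpha>)) zero_form"
      using ext_d_cong da_h eq_on_trans by blast
    have eqs: "IIA_equations A kpar kperp \<alpha> P Q I"
      using half_flat_iff_IIA_equations[OF \<alpha> P(1) Q(1) I(1) P(2) I(2) kpar(1) kperp(1) da]
        symplectic_half_flat_SU2_iff[OF Sh] half_flat half_flat_cong[OF eq] by blast
    \<comment> \<open>Undo the three operations: phase \<open>i\<close>, opposite rotation, inverse rescaling.\<close>
    have "SU2_structure A Jh gh ?\<alpha> ?\<omega> ?\<Omega>"
      by (rule SU2_structure_cong[OF Sh _ _ _ eq[THEN eq_on_sym]])
         (intro diff_form_add diff_form_scale diff_form_Re diff_form_Im \<alpha> P(1) Q(1) I(1))+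
    then have "SU2_structure A Jh gh ?\<alpha> ?\<omega> (\<i> \<odot>\<^sub>F ?\<Omega>)"
      by (rule SU2_structure_phase) simp
    moreover have "kpar\<^sup>2 + (- kperp)\<^sup>2 = 1" using k by simp
    moreover have "1 / kpar > 0" using kpar by simp
    ultimately obtain J g where S: "SU2_structure A J g
        (Re_form ?\<alpha> \<oplus>\<^sub>F (\<i> * of_real (1 / kpar)) \<odot>\<^sub>F Im_form ?\<alpha>)
        (of_real kpar \<odot>\<^sub>F ?\<omega> \<oplus>\<^sub>F of_real (- kperp) \<odot>\<^sub>F Re_form (\<i> \<odot>\<^sub>F ?\<Omega>))
        (of_real kpar \<odot>\<^sub>F Re_form (\<i> \<odot>\<^sub>F ?\<Omega>) \<oplus>\<^sub>F (-
        of_real (- kperp)) \<odot>\<^sub>F ?\<omega> \<oplus>\<^sub>F \<i> \<odot>\<^sub>F Im_form (\<i> \<odot>\<^sub>F ?\<Omega>))"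
      using SU2_structure_rotate_squash by blast
    \<comment> \<open>The system \<open>P = Re_Omega_par\<close>, \<open>Q = Re_Omega_perp\<close>, solved for \<open>\<omega>\<close> and \<open>Re \<Omega>\<close>.\<close>
    let ?\<omega>' = "of_real (kpar / kperp) \<odot>\<^sub>F Q \<oplus>\<^sub>F of_real (- (kperp / kpar)) \<odot>\<^sub>F P"
    let ?\<Omega>' = "P \<oplus>\<^sub>F Q \<oplus>\<^sub>F \<i> \<odot>\<^sub>F I"
    have real: "Im (P c p v) = 0" "Im (Q c p v) = 0" "Im (I c p v) = 0" if "c \<in> A" "p \<in> chart_dom c"
        for c p v
      using P(2) Q(2) I(2) that by (auto simp: real_form_def complex_is_Real_iff)
    note defs = eq_on_def fun_eq_iff add_form_def scale_form_def Re_form_def Im_form_def complex_eq_iff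
    have kk: "kpar * (kpar * x) + kperp * (kperp * x) = x" for x
      using k by (simp add: power2_eq_square flip: mult.assoc distrib_right)
    have "SU2_structure A J g \<alpha> ?\<omega>' ?\<Omega>'"
    proof (rule SU2_structure_cong[OF S \<alpha>])
      show "diff_form A 2 ?\<omega>'" "diff_form A 2 ?\<Omega>'"
        by (intro diff_form_add diff_form_scale P(1) Q(1) I(1))+
      show "eq_on A (Re_form ?\<alpha> \<oplus>\<^sub>F (\<i> * of_real (1 / kpar)) \<odot>\<^sub>F Im_form ?\<alpha>) \<alpha>"
        using kpar by (simp add: defs)
      show "eq_on A (of_real kpar \<odot>\<^sub>F ?\<omega> \<oplus>\<^sub>F of_real (- kperp) \<odot>\<^sub>F Re_form (\<i> \<odot>\<^sub>F ?\<Omega>)) ?\<omega>'"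
        using kpar kperp by (simp add: defs real)
      show "eq_on A (of_real kpar \<odot>\<^sub>F Re_form (\<i> \<odot>\<^sub>F ?\<Omega>) \<oplus>\<^sub>F (- of_real (- kperp)) \<odot>\<^sub>F ?\<omega> \<oplus>\<^sub>F
          \<i> \<odot>\<^sub>F Im_form (\<i> \<odot>\<^sub>F ?\<Omega>)) ?\<Omega>'"
        using kpar kperp by (simp add: defs real)
    qed
    moreover have "eq_on A P (Re_Omega_par kpar kperp ?\<omega>' ?\<Omega>')"
      unfolding proj using kpar kperp by (simp add: defs real kk algebra_simps)
    moreover have "eq_on A Q (Re_Omega_perp kpar kperp ?\<omega>' ?\<Omega>')"
      unfolding proj using kpar kperp by (simp add: defs real kk algebra_simps)
    moreover have "eq_on A I (Im_form ?\<Omega>')"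
      by (simp add: defs real)
    ultimately show "IIA_solution A kpar kperp \<alpha> P Q I"
      unfolding IIA_solution_def using eqs by blast
  qed
qed

end
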